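(* For every fixed graph $H$ there is a randomized distributed algorithm in the CONGEST model which, given an edge-cut parameter $\varepsilon\in(0,1)$ and a confidence parameter $\delta\in(0,1)$ and run on an $n$-node graph $G$, runs in $O(\mathrm{poly}(1/\varepsilon)(\log(1/\delta)+\log^* n))$ rounds and outputs a partition $\mathcal P=(P^1,\dots,P^k)$ of $V(G)$ such that for each $j$ the subgraph induced by $P^j$ is connected with diameter $\mathrm{poly}(1/\varepsilon)$ and there is a designated node $r^j\in P^j$ whose identifier is known to all nodes of $P^j$; moreover, if $G$ is $H$-minor free, then with probability at least $1-\delta$ the total number of edges of $G$ with endpoints in different parts is at most $\varepsilon n$.
   Context: CONGEST model: synchronous rounds on the input graph $G$ ($n$ nodes), unique $O(\log n)$-bit identifiers, $O(\log n)$-bit message per edge per round, unbounded local computation, private randomness. $\log^*$ is the iterated logarithm. $G$ is $H$-minor free if $H$ is not isomorphic to a graph obtained from a subgraph of $G$ by edge contractions. Constants in $O(\cdot)$ and $\mathrm{poly}(\cdot)$ may depend on $H$. *)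

theory Defs
  imports "HOL-Probability.Probability"
begin

definition simple_graph :: "nat \<Rightarrow> (nat \<Rightarrow> nat \<Rightarrow> bool) \<Rightarrow> bool" where
  "simple_graph n E \<longleftrightarrow> (\<forall>u v. E u v \<longrightarrow> u < n \<and> v < n \<and> u \<noteq> v \<and> E v u)"

definition walk_in :: "(nat \<Rightarrow> nat \<Rightarrow> bool) \<Rightarrow> nat set \<Rightarrow> nat list \<Rightarrow> bool" where
  "walk_in E S xs \<longleftrightarrow> xs \<noteq> [] \<and> set xs \<subseteq> S \<and>
     (\<forall>i. Suc i < length xs \<longrightarrow> E (xs ! i) (xs ! Suc i))"

definition connected_in :: "(nat \<Rightarrow> nat \<Rightarrow> bool) \<Rightarrow> nat set \<Rightarrow> bool" where
  "connected_in E S \<longleftrightarrow>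
     (\<forall>x\<in>S. \<forall>y\<in>S. \<exists>xs. walk_in E S xs \<and> hd xs = x \<and> last xs = y)"

definition has_minor :: "nat \<Rightarrow> (nat \<Rightarrow> nat \<Rightarrow> bool) \<Rightarrow> nat \<Rightarrow> (nat \<Rightarrow> nat \<Rightarrow> bool) \<Rightarrow> bool" where
  "has_minor n E h EH \<longleftrightarrow> (\<exists>Bs :: nat \<Rightarrow> nat set.
     (\<forall>i<h. Bs i \<noteq> {} \<and> Bs i \<subseteq> {0..<n} \<and> connected_in E (Bs i)) \<and>
     (\<forall>i<h. \<forall>j<h. i \<noteq> j \<longrightarrow> Bs i \<inter> Bs j = {}) \<and>
     (\<forall>i<h. \<forall>j<h. EH i j \<longrightarrow> (\<exists>x\<in>Bs i. \<exists>y\<in>Bs j. E x y)))"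

definition minor_free :: "nat \<Rightarrow> (nat \<Rightarrow> nat \<Rightarrow> bool) \<Rightarrow> nat \<Rightarrow> (nat \<Rightarrow> nat \<Rightarrow> bool) \<Rightarrow> bool" where
  "minor_free n E h EH \<longleftrightarrow> \<not> has_minor n E h EH"

definition logstar :: "nat \<Rightarrow> nat" where
  "logstar n = (LEAST k. ((\<lambda>x. log 2 x) ^^ k) (real n) \<le> 1)"

text \<open>Parameters passed to every node: n, epsilon, delta. Local state: nat list.
  Each node has a private infinite random tape (nat \<Rightarrow> bool).
  init: params, own id, set of neighbour ids, tape \<Rightarrow> state.
  msg: params, round, tape, state, target neighbour id \<Rightarrow> message (a number).
  trans: params, round, tape, state, received messages (indexed by sender id) \<Rightarrow> state.
  out: final state \<Rightarrow> output (identifier of the designated node of its part).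
  rounds: number of rounds executed, as function of the parameters.\<close>
record congest_alg =
  a_init :: "nat \<Rightarrow> real \<Rightarrow> real \<Rightarrow> nat \<Rightarrow> nat set \<Rightarrow> (nat \<Rightarrow> bool) \<Rightarrow> nat list"
  a_msg :: "nat \<Rightarrow> real \<Rightarrow> real \<Rightarrow> nat \<Rightarrow> (nat \<Rightarrow> bool) \<Rightarrow> nat list \<Rightarrow> nat \<Rightarrow> nat"
  a_trans :: "nat \<Rightarrow> real \<Rightarrow> real \<Rightarrow> nat \<Rightarrow> (nat \<Rightarrow> bool) \<Rightarrow> nat list \<Rightarrow> (nat \<Rightarrow> nat) \<Rightarrow> nat list"
  a_out :: "nat list \<Rightarrow> nat"
  a_rounds :: "nat \<Rightarrow> real \<Rightarrow> real \<Rightarrow> nat"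

primrec run :: "congest_alg \<Rightarrow> nat \<Rightarrow> real \<Rightarrow> real \<Rightarrow> (nat \<Rightarrow> nat \<Rightarrow> bool) \<Rightarrow> (nat \<Rightarrow> nat)
    \<Rightarrow> (nat \<Rightarrow> nat \<Rightarrow> bool) \<Rightarrow> nat \<Rightarrow> nat \<Rightarrow> nat list" where
  "run A n e d E ids tp 0 =
     (\<lambda>v. a_init A n e d (ids v) (ids ` {u. u < n \<and> E v u}) (tp v))"
| "run A n e d E ids tp (Suc t) =
     (\<lambda>v. a_trans A n e d t (tp v) (run A n e d E ids tp t v)
        (\<lambda>j. if (\<exists>u<n. E v u \<and> ids u = j)
             then (let u = (THE u. u < n \<and> E v u \<and> ids u = j)
                   in a_msg A n e d t (tp u) (run A n e d E ids tp t u) (ids v))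
             else 0))"

definition alg_output :: "congest_alg \<Rightarrow> nat \<Rightarrow> real \<Rightarrow> real \<Rightarrow> (nat \<Rightarrow> nat \<Rightarrow> bool) \<Rightarrow> (nat \<Rightarrow> nat)
    \<Rightarrow> (nat \<Rightarrow> nat \<Rightarrow> bool) \<Rightarrow> nat \<Rightarrow> nat" where
  "alg_output A n e d E ids tp v = a_out A (run A n e d E ids tp (a_rounds A n e d) v)"

definition bandwidth_ok :: "congest_alg \<Rightarrow> nat \<Rightarrow> nat \<Rightarrow> real \<Rightarrow> real \<Rightarrow> (nat \<Rightarrow> nat \<Rightarrow> bool)
    \<Rightarrow> (nat \<Rightarrow> nat) \<Rightarrow> (nat \<Rightarrow> nat \<Rightarrow> bool) \<Rightarrow> bool" where
  "bandwidth_ok A B n e d E ids tp \<longleftrightarrow>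
     (\<forall>t < a_rounds A n e d. \<forall>v<n. \<forall>u<n. E v u \<longrightarrow>
        a_msg A n e d t (tp v) (run A n e d E ids tp t v) (ids u)
          < 2 ^ (B * (nat \<lceil>log 2 (real n)\<rceil> + 1)))"

text \<open>Parts = classes of equal output. Each part contains a node r whose id equals
  the common output (the designated node known to all nodes of the part), and any two
  nodes of a part are joined by a walk inside the part with at most D edges.\<close>
definition valid_partition :: "nat \<Rightarrow> (nat \<Rightarrow> nat \<Rightarrow> bool) \<Rightarrow> (nat \<Rightarrow> nat) \<Rightarrow> (nat \<Rightarrow> nat) \<Rightarrow> real \<Rightarrow> bool" where
  "valid_partition n E ids outp D \<longleftrightarrow>
     (\<forall>v<n. (\<exists>r<n. ids r = outp v \<and> outp r = outp v) \<and>
        (\<forall>u<n. outp u = outp v \<longrightarrow>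
           (\<exists>xs. walk_in E {w. w < n \<and> outp w = outp v} xs \<and> hd xs = u \<and> last xs = v
                 \<and> real (length xs - 1) \<le> D)))"

definition cut_edges :: "nat \<Rightarrow> (nat \<Rightarrow> nat \<Rightarrow> bool) \<Rightarrow> (nat \<Rightarrow> nat) \<Rightarrow> nat" where
  "cut_edges n E outp = card {(u, v). u < v \<and> v < n \<and> E u v \<and> outp u \<noteq> outp v}"

definition coin_tapes :: "(nat \<Rightarrow> nat \<Rightarrow> bool) measure" where
  "coin_tapes = PiM UNIV (\<lambda>_::nat. PiM UNIV (\<lambda>_::nat. measure_pmf (pmf_of_set (UNIV :: bool set))))"

end

theory Submission
  imports Defs "HOL-Library.Nat_Bijection"
begin

text \<open>The algorithm is deterministic. It starts with singleton clusters and repeats a merging phase.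
  A Misra-Gries summary is mergeable, so a convergecast of constant-size summaries along a spanning
  tree lets every cluster find a neighbouring cluster that carries nearly its largest number of
  boundary edges. By Mader's theorem the cluster graph of an \<open>H\<close>-minor free graph is degenerate, so
  the chosen edges carry a constant fraction of all edges between clusters. They form a
  pseudoforest, which Cole-Vishkin recolouring colours with six colours in \<open>O(log* n)\<close> steps.
  Going through the colour classes, each cluster decides by the method of conditional
  expectations whether it is a leaf or a centre, and leaves are merged into the centres they
  chose; a quarter of the chosen weight becomes internal. Radii grow by a factor \<open>3\<close> per phase, and
  \<open>O(log (1/\<epsilon>))\<close> phases suffice.\<close>

section \<open>Dense families of clusters contain complete minors\<close>

text \<open>Bandwidth is the obstacle: a cluster can border on many others, and its exact boundary
  weights do not fit into messages. With \<open>k = 8 * C\<close> counters, where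
  \<open>C = 2 ^ h\<close> is the density constant of Mader's argument, a cluster misjudges every
  weight by at most some \<open>t\<close> with \<open>(k + 1) * t\<close> bounded by its boundary
  weight. Summed over the clusters, this error costs at most half of what sparsity guarantees. Every
  other exchange fills at most two counters, where a summary is exact, so one aggregation routine
  serves all decisions.

  Altogether a factor \<open>4 * C\<close> is lost to sparsity, 2 to the summaries and 4 to the leaf
  choice; each absorbed edge leaves the cut in both orders, so a phase removes at least the fraction
  \<open>1 / (16 * C)\<close> of the cut. With \<open>L\<close> about
  \<open>16 * C * ln (C / e)\<close> phases, both the diameter and the number of rounds are governed
  by \<open>3 ^ L\<close>, a power of \<open>1 / e\<close> up to constants. Partition, diameter and
  round bounds hold on every graph; minor-freeness enters only through sparsity of the cluster
  graphs, and the cut bound then holds with certainty, which covers every \<open>d\<close>.\<close>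

definition inner_rel :: "('a \<Rightarrow> 'a \<Rightarrow> bool) \<Rightarrow> 'a set \<Rightarrow> ('a \<times> 'a) set" where
  "inner_rel adj S = {(x, y). x \<in> S \<and> y \<in> S \<and> adj x y}"

definition conn :: "('a \<Rightarrow> 'a \<Rightarrow> bool) \<Rightarrow> 'a set \<Rightarrow> bool" where
  "conn adj S \<longleftrightarrow> (\<forall>x\<in>S. \<forall>y\<in>S. (x, y) \<in> (inner_rel adj S)\<^sup>*)"

definition touch :: "('a \<Rightarrow> 'a \<Rightarrow> bool) \<Rightarrow> 'a set \<Rightarrow> 'a set \<Rightarrow> bool" where
  "touch adj A B \<longleftrightarrow> (\<exists>x\<in>A. \<exists>y\<in>B. adj x y)"

definition touching_pairs :: "('a \<Rightarrow> 'a \<Rightarrow> bool) \<Rightarrow> 'a set set \<Rightarrow> ('a set \<times> 'a set) set" where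
  "touching_pairs adj F = {(A, B). A \<in> F \<and> B \<in> F \<and> A \<noteq> B \<and> touch adj A B}"

lemma inner_rel_mono: "S \<subseteq> T \<Longrightarrow> inner_rel adj S \<subseteq> inner_rel adj T"
  by (auto simp: inner_rel_def)

lemma conn_Un:
  assumes "conn adj A" "conn adj B" "touch adj A B" and sym: "\<And>x y. adj x y \<Longrightarrow> adj y x"
  shows "conn adj (A \<union> B)"
proof -
  let ?R = "(inner_rel adj (A \<union> B))\<^sup>*"
  obtain a b where ab: "a \<in> A" "b \<in> B" "adj a b" using assms(3) by (auto simp: touch_def)
  have RA: "(inner_rel adj A)\<^sup>* \<subseteq> ?R" "(inner_rel adj B)\<^sup>* \<subseteq> ?R"
    by (auto intro!: rtrancl_mono inner_rel_mono)
  have e: "(a, b) \<in> ?R" "(b, a) \<in> ?R" using ab sym by (auto simp: inner_rel_def)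
  have A: "(x, a) \<in> ?R \<and> (a, x) \<in> ?R" if "x \<in> A" for x
    using that ab RA assms(1) unfolding conn_def by blast
  have B: "(x, b) \<in> ?R \<and> (b, x) \<in> ?R" if "x \<in> B" for x
    using that ab RA assms(2) unfolding conn_def by blast
  have "(x, a) \<in> ?R \<and> (a, x) \<in> ?R" if "x \<in> A \<union> B" for x
    using that A B e by (meson UnE rtrancl_trans)
  then show ?thesis unfolding conn_def by (meson rtrancl_trans)
qed

definition nbrs :: "('a \<Rightarrow> 'a \<Rightarrow> bool) \<Rightarrow> 'a set set \<Rightarrow> 'a set \<Rightarrow> 'a set set" where
  "nbrs adj F A = {B \<in> F. A \<noteq> B \<and> touch adj A B}"

lemma touching_pairs_Sigma: "touching_pairs adj F = Sigma F (nbrs adj F)"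
  by (auto simp: touching_pairs_def nbrs_def)

text \<open>Mader's argument: in a counterexample with the fewest sets, contracting a touching pair
  destroys many pairs, so both sets have many common neighbours; hence the neighbourhood of any
  set is again dense.\<close>

lemma dense_family_contract:
  assumes sym: "\<And>x y. adj x y \<Longrightarrow> adj y x"
    and "finite F" "A \<in> F" "B \<in> F" "A \<noteq> B" "touch adj A B" "A \<union> B \<notin> F - {A, B}"
  shows "card (touching_pairs adj F) \<le>
    card (touching_pairs adj (insert (A \<union> B) (F - {A, B}))) + 2 * card (nbrs adj F A \<inter> nbrs adj F B) + 2"
proof -
  let ?G = "F - {A, B}"
  let ?F' = "insert (A \<union> B) ?G"
  let ?N = "nbrs adj F A \<inter> nbrs adj F B"
  let ?U = "nbrs adj F A \<union> nbrs adj F B - {A, B}"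
  have ts: "touch adj X Y = touch adj Y X" for X Y using sym by (auto simp: touch_def)
  have tU: "touch adj (A \<union> B) Y \<longleftrightarrow> touch adj A Y \<or> touch adj B Y" for Y by (auto simp: touch_def)
  have fin: "finite ?U" "finite ?N" "finite ?G" using assms by (auto simp: nbrs_def)
  have fP: "finite (touching_pairs adj H)" if "finite H" for H
    using that by (rule_tac finite_subset[of _ "H \<times> H"]) (auto simp: touching_pairs_def)
  \<comment> \<open>These are all pairs involving \<open>A\<close> or \<open>B\<close>. The pairs
    \<open>(A, B)\<close> and \<open>(B, A)\<close> are kept only in the first two products;
    counting each of them once yields exactly the \<open>+ 2\<close>.\<close>
  let ?R = "{A} \<times> nbrs adj F A \<union> {B} \<times> nbrs adj F B
      \<union> ((nbrs adj F A - {B}) \<times> {A} \<union> (nbrs adj F B - {A}) \<times> {B})"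
  have dec: "touching_pairs adj F \<subseteq> touching_pairs adj ?G \<union> ?R"
  proof (rule subrelI)
    fix X Y assume XY: "(X, Y) \<in> touching_pairs adj F"
    then have m: "X \<in> F" "Y \<in> F" "X \<noteq> Y" "touch adj X Y" "touch adj Y X"
      by (auto simp: touching_pairs_def ts)
    consider "X = A" | "X = B" | "Y = A" "X \<noteq> A" "X \<noteq> B" | "Y = B" "X \<noteq> A" "X \<noteq> B"
      | "X \<noteq> A" "X \<noteq> B" "Y \<noteq> A" "Y \<noteq> B" by blast
    then show "(X, Y) \<in> touching_pairs adj ?G \<union> ?R"
      using m by cases (simp_all add: touching_pairs_def nbrs_def)
  qed
  \<comment> \<open>The merged set forms a pair, in both orders, with every set of
    \<open>?U\<close>. A set touching just one of \<open>A\<close> and \<open>B\<close> loses no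
    pair by the contraction; only common neighbours do.\<close>
  have sub: "touching_pairs adj ?G \<union> ({A \<union> B} \<times> ?U \<union> ?U \<times> {A \<union> B}) \<subseteq> touching_pairs adj ?F'"
    using assms(7) ts tU by (auto simp: touching_pairs_def nbrs_def)
  have d: "touching_pairs adj ?G \<inter> ({A \<union> B} \<times> ?U \<union> ?U \<times> {A \<union> B}) = {}"
      "({A \<union> B} \<times> ?U) \<inter> (?U \<times> {A \<union> B}) = {}"
    using assms(7) unfolding touching_pairs_def nbrs_def by blast+
  have c1: "card (touching_pairs adj ?G \<union> ({A \<union> B} \<times> ?U \<union> ?U \<times> {A \<union> B}))
      = card (touching_pairs adj ?G) + (card ?U + card ?U)"
    using fP[OF fin(3)] fin(1) by (simp add: card_Un_disjoint d card_cartesian_product del: Un_Diff)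
  have fN: "finite (nbrs adj F A)" "finite (nbrs adj F B)" using assms by (simp_all add: nbrs_def)
  have "card (touching_pairs adj F) \<le> card (touching_pairs adj ?G \<union> ?R)"
    using fP[of ?G] fN fin(3) by (intro card_mono[OF _ dec]) simp
  also have "\<dots> \<le> card (touching_pairs adj ?G) + card ?R" by (rule card_Un_le)
  also have "card ?R
     \<le> (card (nbrs adj F A) + card (nbrs adj F B)) + (card (nbrs adj F A - {B}) + card (nbrs adj F B - {A}))"
    by (rule order.trans[OF card_Un_le], rule add_mono; rule order.trans[OF card_Un_le])
       (simp_all add: card_cartesian_product)
  finally have 1: "card (touching_pairs adj F) \<le> card (touching_pairs adj ?G) +
     ((card (nbrs adj F A) + card (nbrs adj F B)) + (card (nbrs adj F A - {B}) + card (nbrs adj F B - {A})))"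
    by simp
  have BA: "B \<in> nbrs adj F A" "A \<in> nbrs adj F B" using assms ts by (auto simp: nbrs_def)
  have cA: "card (nbrs adj F A) = card (nbrs adj F A - {B}) + 1" "card (nbrs adj F B) = card (nbrs adj F B - {A}) + 1"
    using BA fN by (metis card_Suc_Diff1 Suc_eq_plus1)+
  have Ueq: "?U = (nbrs adj F A - {B}) \<union> (nbrs adj F B - {A})"
    using assms by (auto simp: nbrs_def)
  have "card ((nbrs adj F A - {B}) \<inter> (nbrs adj F B - {A})) = card ?N"
    by (rule arg_cong[where f=card]) (auto simp: nbrs_def)
  then have "card (nbrs adj F A - {B}) + card (nbrs adj F B - {A}) = card ?U + card ?N"
    unfolding Ueq using card_Un_Int[of "nbrs adj F A - {B}" "nbrs adj F B - {A}"] fN by simp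
  moreover have "card (touching_pairs adj ?G) + (card ?U + card ?U) \<le> card (touching_pairs adj ?F')"
    using card_mono[OF fP[of ?F'] sub] c1 fin by simp
  ultimately show ?thesis using 1 cA by linarith
qed

text \<open>Each passage to a neighbourhood halves the density and frees one set that touches
  everything built inside, so \<open>h\<close> branch sets cost a factor \<open>2 ^ h\<close>.
  Branch sets are unions of members of \<open>F\<close>, which lets a contraction be undone in the
  result.\<close>

lemma dense_family_has_complete_minor:
  fixes adj :: "'a \<Rightarrow> 'a \<Rightarrow> bool"
  assumes sym: "\<And>x y. adj x y \<Longrightarrow> adj y x"
  shows "finite F \<Longrightarrow> F \<noteq> {} \<Longrightarrow> (\<forall>A\<in>F. A \<noteq> {} \<and> conn adj A) \<Longrightarrow>
    (\<forall>A\<in>F. \<forall>B\<in>F. A \<noteq> B \<longrightarrow> A \<inter> B = {}) \<Longrightarrow>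
    2 * 2 ^ h * card F \<le> card (touching_pairs adj F) \<Longrightarrow>
    \<exists>G :: nat \<Rightarrow> 'a set set. (\<forall>i<h. G i \<noteq> {} \<and> G i \<subseteq> F \<and> conn adj (\<Union>(G i))) \<and>
      (\<forall>i<h. \<forall>j<h. i \<noteq> j \<longrightarrow> \<Union>(G i) \<inter> \<Union>(G j) = {} \<and> touch adj (\<Union>(G i)) (\<Union>(G j)))"
proof (induction h arbitrary: F)
  case 0
  show ?case by auto
next
  case (Suc h)
  have ts: "touch adj X Y = touch adj Y X" for X Y using sym by (auto simp: touch_def)
  from Suc.prems show ?case
  proof (induction "card F" arbitrary: F rule: less_induct)
    case less
    show ?case
    \<comment> \<open>Below this threshold a contraction loses at most
      \<open>2 * (2 * 2 ^ h - 1) + 2 = 2 * 2 ^ Suc h\<close> pairs, which is what the density bound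
      allows for one set fewer.\<close>
    proof (cases "\<exists>A\<in>F. \<exists>B\<in>F. A \<noteq> B \<and> touch adj A B \<and> card (nbrs adj F A \<inter> nbrs adj F B) < 2 * 2 ^ h")
      case True
      then obtain A B where AB: "A \<in> F" "B \<in> F" "A \<noteq> B" "touch adj A B"
        and few: "card (nbrs adj F A \<inter> nbrs adj F B) < 2 * 2 ^ h" by blast
      let ?F' = "insert (A \<union> B) (F - {A, B})"
      have notin: "A \<union> B \<notin> F - {A, B}"
      proof
        assume "A \<union> B \<in> F - {A, B}"
        then have "A \<union> B \<in> F" "A \<noteq> A \<union> B" by auto
        then have "A \<inter> (A \<union> B) = {}" using less.prems(4) AB(1) by metis
        then have "A = {}" by (simp add: Int_absorb2)
        then show False using less.prems(3) AB(1) by metis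
      qed
      have "card {A, B} = 2" using AB(3) by simp
      moreover have "card {A, B} \<le> card F" using AB(1,2) by (intro card_mono less.prems(1)) simp
      ultimately
      have c: "card F = Suc (card ?F')"
        using notin AB(1,2) less.prems(1) by (simp add: card_Diff_subset del: Diff_insert2 Diff_insert)
      have "card (touching_pairs adj F) \<le> card (touching_pairs adj ?F')
          + 2 * card (nbrs adj F A \<inter> nbrs adj F B) + 2"
        by (rule dense_family_contract[OF sym less.prems(1) AB notin])
      then have dens: "2 * 2 ^ Suc h * card ?F' \<le> card (touching_pairs adj ?F')"
        using few less.prems(5) unfolding c by simp
      have "\<exists>G :: nat \<Rightarrow> 'a set set. (\<forall>i<Suc h. G i \<noteq> {} \<and> G i \<subseteq> ?F' \<and> conn adj (\<Union>(G i))) \<and>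
        (\<forall>i<Suc h. \<forall>j<Suc h. i \<noteq> j \<longrightarrow> \<Union>(G i) \<inter> \<Union>(G j) = {} \<and> touch adj (\<Union>(G i)) (\<Union>(G j)))"
      proof (rule less.hyps)
        show "card ?F' < card F" using c by simp
        show "finite ?F'" "?F' \<noteq> {}" using less.prems by auto
        show "\<forall>A\<in>?F'. A \<noteq> {} \<and> conn adj A"
        proof -
          have "conn adj (A \<union> B)"
            using less.prems(3) AB by (intro conn_Un) (auto intro: sym)
          moreover have "A \<union> B \<noteq> {}" using less.prems(3) AB(1) by blast
          ultimately show ?thesis using less.prems(3) by simp
        qed
        have d: "X \<inter> (A \<union> B) = {}" if "X \<in> F - {A, B}" for X
        proof -
          from that have "X \<in> F" "X \<noteq> A" "X \<noteq> B" by auto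
          then have "X \<inter> A = {}" "X \<inter> B = {}" using AB less.prems(4) by metis+
          then show ?thesis by blast
        qed
        show "\<forall>X\<in>?F'. \<forall>Y\<in>?F'. X \<noteq> Y \<longrightarrow> X \<inter> Y = {}"
        proof (intro ballI impI)
          fix X Y assume XY: "X \<in> ?F'" "Y \<in> ?F'" "X \<noteq> Y"
          then consider "X = A \<union> B" "Y \<in> F - {A, B}" | "Y = A \<union> B" "X \<in> F - {A, B}" | "X \<in> F" "Y \<in> F" by fast
          then show "X \<inter> Y = {}"
            using d[of X] d[of Y] XY(3) less.prems(4) by cases (simp_all add: Int_commute)
        qed
        show "2 * 2 ^ Suc h * card ?F' \<le> card (touching_pairs adj ?F')" by (rule dens)
      qed
      then obtain G :: "nat \<Rightarrow> 'a set set" where G: "\<forall>i<Suc h. G i \<noteq> {} \<and> G i \<subseteq> ?F' \<and> conn adj (\<Union>(G i))"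
        "\<forall>i<Suc h. \<forall>j<Suc h. i \<noteq> j \<longrightarrow> \<Union>(G i) \<inter> \<Union>(G j) = {} \<and> touch adj (\<Union>(G i)) (\<Union>(G j))" by blast
      \<comment> \<open>Splitting the contracted set into \<open>A\<close> and \<open>B\<close>
        leaves each union unchanged, so connectivity, disjointness and touching carry over.\<close>
      define G' where "G' i = (if A \<union> B \<in> G i then insert A (insert B (G i - {A \<union> B})) else G i)" for i
      have U: "\<Union>(G' i) = \<Union>(G i)" for i by (auto simp: G'_def split: if_splits)
      show ?thesis
      proof (intro exI[of _ G'] conjI)
        have "G' i \<noteq> {} \<and> G' i \<subseteq> F" if "i < Suc h" for i
        proof -
          have "G i \<noteq> {}" "G i \<subseteq> ?F'" using G(1) that by blast+
          moreover from this(2) have "G i - {A \<union> B} \<subseteq> F" by auto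
          ultimately show ?thesis using AB(1,2) unfolding G'_def by (cases "A \<union> B \<in> G i") simp_all
        qed
        then show "\<forall>i<Suc h. G' i \<noteq> {} \<and> G' i \<subseteq> F \<and> conn adj (\<Union>(G' i))"
          using G(1) unfolding U by simp
        show "\<forall>i<Suc h. \<forall>j<Suc h. i \<noteq> j \<longrightarrow>
            \<Union>(G' i) \<inter> \<Union>(G' j) = {} \<and> touch adj (\<Union>(G' i)) (\<Union>(G' j))"
          using G(2) unfolding U .
      qed
    next
      case False
      have "0 < card F" using less.prems by (simp add: card_gt_0_iff)
      then have "0 < 2 * 2 ^ Suc h * card F" by simp
      then have "0 < card (touching_pairs adj F)" using less.prems(5) by linarith
      then obtain A B where AB: "A \<in> F" "B \<in> F" "A \<noteq> B" "touch adj A B"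
        by (fastforce simp: touching_pairs_def card_gt_0_iff)
      let ?N = "nbrs adj F A"
      have sub: "?N \<subseteq> F" "A \<notin> ?N" by (auto simp: nbrs_def)
      have fin: "finite ?N" using sub less.prems(1) finite_subset by blast
      have eq: "nbrs adj ?N X = ?N \<inter> nbrs adj F X" for X by (auto simp: nbrs_def)
      have "2 * 2 ^ h \<le> card (nbrs adj ?N X)" if "X \<in> ?N" for X
      proof -
        have "X \<in> F" "A \<noteq> X" "touch adj A X" using that by (simp_all add: nbrs_def)
        then have "2 * 2 ^ h \<le> card (?N \<inter> nbrs adj F X)" using False AB(1) by (meson not_less)
        then show ?thesis unfolding eq .
      qed
      then have "(\<Sum>X\<in>?N. 2 * 2 ^ h) \<le> (\<Sum>X\<in>?N. card (nbrs adj ?N X))" by (rule sum_mono)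
      also have "\<dots> = card (touching_pairs adj ?N)"
      proof -
        have "finite (nbrs adj ?N X)" for X using fin unfolding eq by simp
        then show ?thesis unfolding touching_pairs_Sigma using fin by simp
      qed
      finally have dens: "2 * 2 ^ h * card ?N \<le> card (touching_pairs adj ?N)" by (simp add: mult.commute)
      have "\<exists>G :: nat \<Rightarrow> 'a set set. (\<forall>i<h. G i \<noteq> {} \<and> G i \<subseteq> ?N \<and> conn adj (\<Union>(G i))) \<and>
        (\<forall>i<h. \<forall>j<h. i \<noteq> j \<longrightarrow> \<Union>(G i) \<inter> \<Union>(G j) = {} \<and> touch adj (\<Union>(G i)) (\<Union>(G j)))"
      proof (rule Suc.IH[OF fin _ _ _ dens])
        show "?N \<noteq> {}" using AB by (auto simp: nbrs_def)
        show "\<forall>A\<in>?N. A \<noteq> {} \<and> conn adj A" using less.prems(3) sub(1) by (meson subsetD)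
        show "\<forall>X\<in>?N. \<forall>Y\<in>?N. X \<noteq> Y \<longrightarrow> X \<inter> Y = {}" using less.prems(4) sub(1) by (meson subsetD)
      qed
      then obtain G :: "nat \<Rightarrow> 'a set set" where G: "\<forall>i<h. G i \<noteq> {} \<and> G i \<subseteq> ?N \<and> conn adj (\<Union>(G i))"
        "\<forall>i<h. \<forall>j<h. i \<noteq> j \<longrightarrow> \<Union>(G i) \<inter> \<Union>(G j) = {} \<and> touch adj (\<Union>(G i)) (\<Union>(G j))" by blast
      have tA: "touch adj A (\<Union>(G i)) \<and> touch adj (\<Union>(G i)) A \<and> A \<inter> \<Union>(G i) = {} \<and> \<Union>(G i) \<inter> A = {}" if "i < h" for i
      proof -
        have Gi: "G i \<noteq> {}" "G i \<subseteq> ?N" using G(1) that by blast+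
        then obtain X where X: "X \<in> G i" "X \<in> ?N" by blast
        then have "touch adj A X" by (simp add: nbrs_def)
        then have 1: "touch adj A (\<Union>(G i))" using X(1) unfolding touch_def by blast
        have "A \<inter> Y = {}" if "Y \<in> G i" for Y
        proof -
          have "Y \<in> F" "A \<noteq> Y" using that Gi(2) by (auto simp: nbrs_def)
          then show ?thesis using less.prems(4) AB(1) by metis
        qed
        then have 2: "A \<inter> \<Union>(G i) = {}" by blast
        show ?thesis using 1 2 ts[of A "\<Union>(G i)"] by (simp add: Int_commute)
      qed
      \<comment> \<open>The set \<open>A\<close> itself is the additional branch set: it touches
        each of its neighbours and is disjoint from all of them.\<close>
      let ?G = "G(h := {A})"
      have P: "?G i \<noteq> {} \<and> ?G i \<subseteq> F \<and> conn adj (\<Union>(?G i))" if "i < Suc h" for i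
      proof (cases "i = h")
        case True
        then show ?thesis using AB(1) less.prems(3) by simp
      next
        case False
        then have "i < h" using that by simp
        then have "G i \<noteq> {}" "G i \<subseteq> ?N" "conn adj (\<Union>(G i))" using G(1) by blast+
        then show ?thesis using False sub(1) by auto
      qed
      have Q: "\<Union>(?G i) \<inter> \<Union>(?G j) = {} \<and> touch adj (\<Union>(?G i)) (\<Union>(?G j))"
        if ij: "i < Suc h" "j < Suc h" "i \<noteq> j" for i j
      proof -
        consider "i = h" "j < h" | "j = h" "i < h" | "i < h" "j < h" using ij less_SucE by metis
        then show ?thesis
          using ij(3) G(2) tA[of i] tA[of j] by cases simp_all
      qed
      show ?thesis using P Q by (intro exI[of _ ?G] conjI allI impI) simp_all
    qed
  qed
qed

text \<open>Peel off a vertex with fewer than \<open>2 * C\<close> neighbours: its remaining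
  incident weight is at most \<open>2 * C\<close> times its own maximum, and counting both orders
  gives \<open>4 * C\<close>. Only the maximum of the peeled vertex is charged, so it suffices that
  every cluster knows its own heaviest edge.\<close>

lemma sparse_weight_bound:
  fixes w :: "nat \<Rightarrow> nat \<Rightarrow> nat" and mx :: "nat \<Rightarrow> nat"
  assumes "finite R" and sym: "\<And>r s. w r s = w s r"
    and mx: "\<And>r s. r \<in> R \<Longrightarrow> s \<in> R \<Longrightarrow> r \<noteq> s \<Longrightarrow> w r s \<le> mx r"
    and sparse: "\<And>F. F \<subseteq> R \<Longrightarrow> F \<noteq> {} \<Longrightarrow>
      card {(r, s). r \<in> F \<and> s \<in> F \<and> r \<noteq> s \<and> 0 < w r s} < 2 * C * card F"
  shows "(\<Sum>r\<in>R. \<Sum>s\<in>R - {r}. w r s) \<le> 4 * C * (\<Sum>r\<in>R. mx r)"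
  using assms(1) mx sparse
proof (induction "card R" arbitrary: R rule: less_induct)
  case less
  show ?case
  proof (cases "R = {}")
    case False
    let ?N = "\<lambda>r. {s \<in> R. r \<noteq> s \<and> 0 < w r s}"
    have "\<exists>r\<in>R. card (?N r) < 2 * C"
    proof (rule ccontr)
      assume "\<not> ?thesis"
      then have "(\<Sum>r\<in>R. 2 * C) \<le> (\<Sum>r\<in>R. card (?N r))" by (intro sum_mono) (simp add: not_less)
      also have "\<dots> = card (Sigma R ?N)" using less.prems(1) by simp
      also have "Sigma R ?N = {(r, s). r \<in> R \<and> s \<in> R \<and> r \<noteq> s \<and> 0 < w r s}" by blast
      finally show False using less.prems(3)[OF order.refl False] by (simp add: mult.commute)
    qed
    then obtain r where r: "r \<in> R" "card (?N r) < 2 * C" by blast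
    let ?R = "R - {r}"
    have "card ?R < card R" using r less.prems(1) by (meson card_Diff1_less)
    then have IH: "(\<Sum>q\<in>?R. \<Sum>s\<in>?R - {q}. w q s) \<le> 4 * C * (\<Sum>q\<in>?R. mx q)"
      using less.prems(1,2) by (intro less.hyps less.prems(3)) auto
    have deg: "(\<Sum>s\<in>?R. w r s) \<le> 2 * C * mx r"
    proof -
      have "(\<Sum>s\<in>?R. w r s) = (\<Sum>s\<in>?N r. w r s)"
        using less.prems(1) by (intro sum.mono_neutral_right) auto
      also have "\<dots> \<le> (\<Sum>s\<in>?N r. mx r)" using less.prems(2) r(1) by (intro sum_mono) simp
      also have "\<dots> \<le> 2 * C * mx r" using r(2) by (simp add: mult_right_mono)
      finally show ?thesis .
    qed
    have "(\<Sum>q\<in>?R. \<Sum>s\<in>R - {q}. w q s) = (\<Sum>q\<in>?R. w q r + (\<Sum>s\<in>?R - {q}. w q s))"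
    proof (intro sum.cong refl)
      fix q assume "q \<in> ?R"
      then have "r \<in> R - {q}" "R - {q} - {r} = ?R - {q}" using r(1) by auto
      then show "(\<Sum>s\<in>R - {q}. w q s) = w q r + (\<Sum>s\<in>?R - {q}. w q s)"
        using less.prems(1) sum.remove[of "R - {q}" r "w q"] by simp
    qed
    also have "\<dots> = (\<Sum>q\<in>?R. w r q) + (\<Sum>q\<in>?R. \<Sum>s\<in>?R - {q}. w q s)"
      by (simp add: sum.distrib sym[of _ r])
    finally have "(\<Sum>q\<in>R. \<Sum>s\<in>R - {q}. w q s)
        = 2 * (\<Sum>q\<in>?R. w r q) + (\<Sum>q\<in>?R. \<Sum>s\<in>?R - {q}. w q s)"
      using r(1) less.prems(1) by (simp add: sum.remove[of R r])
    also have "\<dots> \<le> 2 * (2 * C * mx r) + 4 * C * (\<Sum>q\<in>?R. mx q)"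
      using deg IH by linarith
    also have "\<dots> = 4 * C * (\<Sum>q\<in>R. mx q)"
      using r(1) less.prems(1) by (simp add: sum.remove[of R r] algebra_simps)
    finally show ?thesis .
  qed simp
qed

section \<open>Deciding between leaf and centre without randomness\<close>

text \<open>If each cluster with \<open>l = 1\<close> independently becomes a leaf (\<open>l = 2\<close>) or a centre (\<open>l = 0\<close>) with
  probability \<open>1/2\<close>, this is four times the expected weight of the edges from a leaf to a centre.\<close>

definition leaf_potential :: "nat set \<Rightarrow> (nat \<Rightarrow> nat) \<Rightarrow> (nat \<Rightarrow> int) \<Rightarrow> (nat \<Rightarrow> int) \<Rightarrow> int" where
  "leaf_potential R pt om l = (\<Sum>r\<in>R. if pt r = 0 then 0 else om r * l r * (2 - l (pt r - 1)))"

text \<open>The potential is affine in each single value \<open>l r\<close>, and no summand contains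
  two factors from an independent set \<open>A\<close>. Hence simultaneous changes on
  \<open>A\<close> contribute independently, each being its step \<open>l' r - 1\<close> times the
  gain as a leaf minus the gain as a centre; \<open>choice\<close> says that the step has the right
  sign.\<close>

lemma leaf_potential_step:
  fixes om l l' :: "nat \<Rightarrow> int" and pt :: "nat \<Rightarrow> nat"
  assumes "finite R" "A \<subseteq> R"
    and indep: "\<And>r. r \<in> A \<Longrightarrow> pt r \<noteq> 0 \<Longrightarrow> pt r - 1 \<notin> A"
    and one: "\<And>r. r \<in> A \<Longrightarrow> l r = 1"
    and same: "\<And>r. r \<notin> A \<Longrightarrow> l' r = l r"
    and choice: "\<And>r. r \<in> A \<Longrightarrow> 0 \<le> (l' r - 1) * ((if pt r = 0 then 0 else om r * (2 - l (pt r - 1)))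
        - (\<Sum>u\<in>{u \<in> R. pt u = Suc r}. om u * l u))"
  shows "leaf_potential R pt om l \<le> leaf_potential R pt om l'"
proof -
  have finA: "finite A" using assms finite_subset by blast
  let ?S0 = "\<lambda>r. if pt r = 0 then 0 else om r * (2 - l (pt r - 1))"
  let ?S1 = "\<lambda>r. \<Sum>u\<in>{u \<in> R. pt u = Suc r}. om u * l u"
  let ?g = "\<lambda>l r. if pt r = 0 then 0 else om r * l r * (2 - l (pt r - 1))"
  \<comment> \<open>The summand of \<open>r\<close> can change through \<open>r\<close> itself or
    through its target, but by independence never through both.\<close>
  have pw: "?g l' r - ?g l r = (if r \<in> A then (l' r - 1) * ?S0 r else 0)
      - (\<Sum>q\<in>A. if pt r = Suc q then (l' q - 1) * (om r * l r) else 0)" for r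
  proof (cases "pt r")
    case (Suc q)
    have *: "(\<Sum>q'\<in>A. if pt r = Suc q' then (l' q' - 1) * (om r * l r) else 0)
        = (if q \<in> A then (l' q - 1) * (om r * l r) else 0)"
      using Suc finA by simp
    show ?thesis unfolding * using Suc indep[of r] one[of r] one[of q] same[of r] same[of q]
      by (auto simp: algebra_simps)
  qed simp
  have "leaf_potential R pt om l' - leaf_potential R pt om l = (\<Sum>r\<in>R. ?g l' r - ?g l r)"
    unfolding leaf_potential_def by (rule sum_subtractf[symmetric])
  also have "\<dots> = (\<Sum>r\<in>R. if r \<in> A then (l' r - 1) * ?S0 r else 0)
      - (\<Sum>r\<in>R. \<Sum>q\<in>A. if pt r = Suc q then (l' q - 1) * (om r * l r) else 0)"
    unfolding pw by (rule sum_subtractf)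
  also have "(\<Sum>r\<in>R. if r \<in> A then (l' r - 1) * ?S0 r else 0) = (\<Sum>r\<in>A. (l' r - 1) * ?S0 r)"
    using assms(1,2) by (simp add: sum.inter_restrict[symmetric] Int_absorb1)
  also have "(\<Sum>r\<in>R. \<Sum>q\<in>A. if pt r = Suc q then (l' q - 1) * (om r * l r) else 0)
      = (\<Sum>q\<in>A. (l' q - 1) * ?S1 q)"
  proof (subst sum.swap, intro sum.cong refl)
    fix q
    have "(\<Sum>r\<in>R. if pt r = Suc q then (l' q - 1) * (om r * l r) else 0)
        = (\<Sum>r\<in>{u \<in> R. pt u = Suc q}. (l' q - 1) * (om r * l r))"
      using assms(1) by (rule sum.inter_filter[symmetric])
    then show "(\<Sum>r\<in>R. if pt r = Suc q then (l' q - 1) * (om r * l r) else 0) = (l' q - 1) * ?S1 q"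
      by (simp add: sum_distrib_left)
  qed
  also have "(\<Sum>r\<in>A. (l' r - 1) * ?S0 r) - (\<Sum>q\<in>A. (l' q - 1) * ?S1 q)
      = (\<Sum>r\<in>A. (l' r - 1) * (?S0 r - ?S1 r))"
    by (simp only: sum_subtractf[symmetric] right_diff_distrib)
  also have "\<dots> \<ge> 0" using choice by (intro sum_nonneg) blast
  finally show ?thesis by simp
qed

section \<open>Cole-Vishkin recolouring\<close>

definition cv_bit :: "nat \<Rightarrow> nat \<Rightarrow> nat" where "cv_bit a i = a div 2 ^ i mod 2"

text \<open>The new colour packs the index of the lowest bit in which \<open>a\<close> differs from
  the target's colour \<open>b\<close> together with the own bit there. The default \<open>0\<close>
  for equal colours keeps the result small on arbitrary arguments.\<close>

definition cv_step :: "nat \<Rightarrow> nat \<Rightarrow> nat" where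
  "cv_step a b = (if a = b then 0 else
     (let i = (LEAST i. cv_bit a i \<noteq> cv_bit b i) in 2 * i + cv_bit a i))"

lemma cv_bit_differs: "a \<noteq> b \<Longrightarrow> \<exists>i. cv_bit a i \<noteq> cv_bit b i"
proof (rule ccontr)
  assume "a \<noteq> b" "\<not> (\<exists>i. cv_bit a i \<noteq> cv_bit b i)"
  then have "bit a i = bit b i" for i unfolding cv_bit_def bit_iff_odd by (metis odd_iff_mod_2_eq_one)
  then show False using \<open>a \<noteq> b\<close> by (auto simp: bit_eq_iff)
qed

lemma cv_step_obtain:
  assumes "a \<noteq> b"
  obtains i where "cv_step a b = 2 * i + cv_bit a i" "cv_bit a i \<noteq> cv_bit b i"
  using LeastI_ex[OF cv_bit_differs[OF assms]] assms that by (auto simp: cv_step_def Let_def)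

lemma cv_bit_le: "cv_bit a i \<le> 1"
  unfolding cv_bit_def by (metis One_nat_def less_Suc_eq_le mod_less_divisor pos2 numeral_2_eq_2)

lemma cv_step_inj_index:
  assumes "2 * i + cv_bit a x = 2 * j + cv_bit b y"
  shows "i = j" "cv_bit a x = cv_bit b y"
  using assms cv_bit_le[of a x] cv_bit_le[of b y] by presburger+

text \<open>Equal new colours would agree both in the index and in the bit, but at that index
  \<open>a\<close> and \<open>b\<close> differ.\<close>

lemma cv_step_proper: "a \<noteq> b \<Longrightarrow> b \<noteq> c \<Longrightarrow> cv_step a b \<noteq> cv_step b c"
  by (metis cv_step_obtain cv_step_inj_index)

text \<open>A cluster without a target keeps \<open>b mod 2\<close>, which is what recolouring
  yields against an imaginary target differing in bit \<open>0\<close>; the previous argument then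
  applies.\<close>

lemma cv_step_proper_root: "a \<noteq> b \<Longrightarrow> cv_step a b \<noteq> b mod 2"
proof
  assume "a \<noteq> b" and eq: "cv_step a b = b mod 2"
  have "b mod 2 = 2 * 0 + cv_bit b 0" by (simp add: cv_bit_def)
  then show False using eq \<open>a \<noteq> b\<close> by (metis cv_step_obtain cv_step_inj_index)
qed

lemma cv_step_less:
  assumes "a < 2 ^ b" "c < 2 ^ b" "0 < b"
  shows "cv_step a c < 2 * b"
proof (cases "a = c")
  case False
  then obtain i where i: "cv_step a c = 2 * i + cv_bit a i" "cv_bit a i \<noteq> cv_bit c i"
    by (rule cv_step_obtain)
  have "i < b"
  proof (rule ccontr)
    assume "\<not> i < b"
    then have "(2::nat) ^ b \<le> 2 ^ i" by simp
    then have "a < 2 ^ i" "c < 2 ^ i" using assms by linarith+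
    then show False using i(2) by (simp add: cv_bit_def)
  qed
  then show ?thesis using i(1) cv_bit_le[of a i] by linarith
qed (use assms in \<open>simp add: cv_step_def\<close>)

text \<open>By \<open>cv_step_less\<close> a recolouring step turns \<open>b\<close>-bit colours into \<open>cv_bits b\<close>-bit colours.\<close>

definition cv_bits :: "nat \<Rightarrow> nat" where "cv_bits b = (LEAST c. 2 * b \<le> 2 ^ c)"

lemma cv_bits_ge: "2 * b \<le> 2 ^ cv_bits b"
  unfolding cv_bits_def by (rule LeastI[of _ "2 * b"]) (simp add: less_imp_le)

lemma cv_bits_le: "2 * b \<le> 2 ^ c \<Longrightarrow> cv_bits b \<le> c"
  unfolding cv_bits_def by (rule Least_le)

text \<open>The iteration gets stuck here: \<open>2 * 3\<close> colours still need three bits. This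
  is where the six colours come from.\<close>

lemma cv_bits_small: "b \<le> 3 \<Longrightarrow> cv_bits b \<le> 3"
  by (rule cv_bits_le) simp

text \<open>From \<open>b = 4\<close> on, \<open>2 * b\<close> is at most
  \<open>2 ^ (b - 1)\<close>, with equality at \<open>4\<close>.\<close>

lemma cv_bits_decreases: "4 \<le> b \<Longrightarrow> cv_bits b < b"
proof -
  assume b: "4 \<le> b"
  have "2 * b \<le> 2 ^ (b - 1)"
    using b
  proof (induction b rule: dec_induct)
    case (step n)
    then obtain m where "n = Suc m" by (cases n) auto
    then show ?case using step by simp
  qed simp
  then have "cv_bits b \<le> b - 1" by (rule cv_bits_le)
  then show ?thesis using b by simp
qed

lemma cv_bits_funpow_le: "b \<le> K \<Longrightarrow> 3 \<le> K \<Longrightarrow> (cv_bits ^^ m) b \<le> K"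
proof (induction m)
  case (Suc m)
  then show ?case using cv_bits_small[of "(cv_bits ^^ m) b"] cv_bits_decreases[of "(cv_bits ^^ m) b"]
    by simp linarith
qed simp

lemma cv_bits_funpow_small: "b \<le> m + 3 \<Longrightarrow> (cv_bits ^^ m) b \<le> 3"
proof (induction m arbitrary: b)
  case (Suc m)
  have "cv_bits b \<le> m + 3" using Suc.prems cv_bits_small[of b] cv_bits_decreases[of b] by linarith
  then show ?case using Suc.IH by (simp add: funpow_swap1)
qed simp

text \<open>Of the additive \<open>2\<close>, one comes from doubling the number of colours and one
  from rounding up to whole bits.\<close>

lemma cv_bits_log: "1 \<le> b \<Longrightarrow> real (cv_bits b) \<le> 2 + log 2 b"
proof -
  assume b: "1 \<le> b"
  have "log 2 b \<ge> 0" using b by simp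
  have "log 2 (real (2 * b)) \<le> real (nat \<lceil>1 + log 2 b\<rceil>)"
    using b by (simp add: log_mult)
  then have "real (2 * b) \<le> 2 powr real (nat \<lceil>1 + log 2 b\<rceil>)" using b by (subst (asm) log_le_iff) simp_all
  also have "\<dots> = real (2 ^ nat \<lceil>1 + log 2 b\<rceil>)" by (simp add: powr_realpow)
  finally have "2 * b \<le> 2 ^ nat \<lceil>1 + log 2 b\<rceil>" using of_nat_le_iff by blast
  then have "cv_bits b \<le> nat \<lceil>1 + log 2 b\<rceil>" by (rule cv_bits_le)
  then show ?thesis using \<open>log 2 b \<ge> 0\<close> by linarith
qed

text \<open>The condition \<open>5 \<le> K\<close> required from here on is fixed by
  \<open>log 2 6 \<le> 3\<close>; the inequality fails for \<open>K = 4\<close>.\<close>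

lemma five_log_bound: "5 \<le> K \<Longrightarrow> 2 + log 2 (1 + real K) \<le> real K"
proof (induction K rule: dec_induct)
  case base
  have "log 2 (6::real) \<le> 3" by (subst log_le_iff) (simp_all add: powr_numeral)
  then show ?case by simp
next
  case (step m)
  have "1 + real (Suc m) \<le> 2 * (1 + real m)" by simp
  then have "log 2 (1 + real (Suc m)) \<le> log 2 (2 * (1 + real m))" by (subst log_le_cancel_iff) simp_all
  also have "\<dots> = 1 + log 2 (1 + real m)" by (subst log_mult) simp_all
  finally show ?case using step by simp
qed

text \<open>Since \<open>cv_bits\<close> exceeds the logarithm by up to \<open>2\<close>, an
  additive slack \<open>K\<close> is carried along. For \<open>x > 1\<close>,
  \<open>x + K \<le> x * (1 + K)\<close>, so one step turns the slack into
  \<open>2 + log 2 (1 + K)\<close>, which is again at most \<open>K\<close>. Taking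
  \<open>max x 1\<close> covers an iterated logarithm that has already dropped below
  \<open>1\<close>.\<close>

lemma cv_bits_iterated_log:
  assumes "5 \<le> K"
  shows "((\<lambda>x. log 2 x) ^^ k) x \<le> 1 \<Longrightarrow> real b \<le> max x 1 + real K \<Longrightarrow> (cv_bits ^^ k) b \<le> K + 1"
proof (induction k arbitrary: x b)
  case 0
  then show ?case by simp
next
  case (Suc k)
  show ?case
  proof (cases "x \<le> 1 \<or> b = 0")
    case True
    then have "b \<le> K + 1" using Suc.prems(2) assms by auto
    then show ?thesis using assms by (intro cv_bits_funpow_le) auto
  next
    case False
    then have x: "1 < x" "1 \<le> b" by auto
    have "real b \<le> x + K" using Suc.prems(2) x by simp
    also have "\<dots> \<le> x * (1 + K)" using x mult_right_mono[of 1 x "real K"] by (simp add: algebra_simps)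
    finally have "log 2 b \<le> log 2 (x * (1 + K))" using x by (subst log_le_cancel_iff) auto
    also have "\<dots> = log 2 x + log 2 (1 + K)" using x by (subst log_mult) auto
    finally have "real (cv_bits b) \<le> log 2 x + (2 + log 2 (1 + real K))"
      using cv_bits_log[OF x(2)] by simp
    then have "real (cv_bits b) \<le> max (log 2 x) 1 + real K" using five_log_bound[OF assms] by linarith
    moreover have "((\<lambda>x. log 2 x) ^^ k) (log 2 x) \<le> 1" using Suc.prems(1) by (simp add: funpow_swap1)
    ultimately have "(cv_bits ^^ k) (cv_bits b) \<le> K + 1" by (intro Suc.IH)
    then show ?thesis by (simp add: funpow_swap1)
  qed
qed

lemma iterated_log_le_1: "x \<le> real m \<Longrightarrow> \<exists>k. ((\<lambda>x. log 2 x) ^^ k) x \<le> 1"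
proof (induction m arbitrary: x)
  case 0
  then show ?case by (intro exI[of _ 0]) simp
next
  case (Suc m)
  show ?case
  proof (cases "x \<le> 1")
    case True
    then show ?thesis by (intro exI[of _ 0]) simp
  next
    case False
    have "real (Suc m) \<le> 2 powr real m"
      using of_nat_mono[OF Suc_leI[OF less_exp[of m]]] by (simp add: powr_realpow)
    then have "x \<le> 2 powr real m" using Suc.prems by linarith
    then have "log 2 x \<le> real m" using False by (subst log_le_iff) auto
    then obtain k where "((\<lambda>x. log 2 x) ^^ k) (log 2 x) \<le> 1" using Suc.IH by blast
    then show ?thesis by (intro exI[of _ "Suc k"]) (simp add: funpow_swap1)
  qed
qed

lemma logstar_le_1: "((\<lambda>x. log 2 x) ^^ logstar n) (real n) \<le> 1"
  unfolding logstar_def by (rule LeastI_ex) (rule iterated_log_le_1[OF order.refl])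

text \<open>After \<open>logstar n\<close> steps \<open>K + 1\<close> bits are left; each further
  step removes at least one bit until three remain.\<close>

lemma cv_bits_logstar:
  assumes "5 \<le> K" "real b \<le> real n + real K"
  shows "(cv_bits ^^ (logstar n + K)) b \<le> 3"
proof -
  have "(cv_bits ^^ logstar n) b \<le> K + 1"
    using assms logstar_le_1 by (intro cv_bits_iterated_log[where x = "real n"]) auto
  then have "(cv_bits ^^ K) ((cv_bits ^^ logstar n) b) \<le> 3"
    using assms(1) by (intro cv_bits_funpow_small) simp
  then show ?thesis by (metis add.commute comp_apply funpow_add)
qed

section \<open>Rounds on node states\<close>

text \<open>The state of a node: the identifier \<open>ld\<close> of its cluster leader; the neighbouring cluster \<open>pt\<close>
  chosen by its cluster and its parent \<open>par\<close> in the spanning tree (both shifted by one, with \<open>0\<close> for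
  none); the colour \<open>cl\<close> of its cluster; the side \<open>lf\<close> of its cluster (\<open>0\<close> centre, \<open>1\<close> undecided,
  \<open>2\<close> leaf, \<open>3\<close> leaf that is about to join the cluster \<open>pt\<close>); and the counters \<open>sm\<close> of the current
  convergecast. Every node broadcasts its whole state in every round.\<close>

record st =
  ld :: nat
  pt :: nat
  cl :: nat
  lf :: nat
  par :: nat
  sm :: "nat \<Rightarrow> nat"

type_synonym round = "nat \<Rightarrow> st \<Rightarrow> nat set \<Rightarrow> (nat \<Rightarrow> st) \<Rightarrow> st"

definition step :: "(nat \<Rightarrow> nat \<Rightarrow> bool) \<Rightarrow> round \<Rightarrow> (nat \<Rightarrow> st) \<Rightarrow> nat \<Rightarrow> st" where
  "step adj F s = (\<lambda>v. F v (s v) {u. adj v u} s)"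

definition exec :: "(nat \<Rightarrow> nat \<Rightarrow> bool) \<Rightarrow> round list \<Rightarrow> (nat \<Rightarrow> st) \<Rightarrow> nat \<Rightarrow> st" where
  "exec adj Fs s = fold (step adj) Fs s"

lemma exec_simps [simp]:
  "exec adj [] s = s"
  "exec adj (F # Fs) s = exec adj Fs (step adj F s)"
  "exec adj (Fs @ Gs) s = exec adj Gs (exec adj Fs s)"
  by (simp_all add: exec_def)

lemma exec_replicate_Suc:
  "exec adj (replicate (Suc t) F) s = step adj F (exec adj (replicate t F) s)"
  by (induction t arbitrary: s) simp_all

text \<open>\<open>step\<close> hands the whole network state to a round. A node of the real network
  can decode only what its neighbours sent and sees junk elsewhere; this condition makes the two
  executions agree.\<close>

definition local_round :: "round \<Rightarrow> bool" where
  "local_round F \<longleftrightarrow> (\<forall>v s Nb r r'. (\<forall>j\<in>Nb. r j = r' j) \<longrightarrow> F v s Nb r = F v s Nb r')"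

section \<open>Misra-Gries summaries\<close>

text \<open>The Misra-Gries reduction: all counters are lowered by the least amount that leaves at most
  \<open>k\<close> of them positive.\<close>

definition trim :: "nat \<Rightarrow> nat \<Rightarrow> (nat \<Rightarrow> nat) \<Rightarrow> nat \<Rightarrow> nat" where
  "trim k N f = (\<lambda>j. if j < N then f j - (LEAST t. card {i. i < N \<and> t < f i} \<le> k) else 0)"

lemma trim_support: "card {j. trim k N f j \<noteq> 0} \<le> k"
proof -
  define t where "t = (LEAST t. card {i. i < N \<and> t < f i} \<le> k)"
  \<comment> \<open>No counter exceeds the sum of all, so the set minimised over by
    \<open>LEAST\<close> is nonempty.\<close>
  have "card {i. i < N \<and> (\<Sum>j<N. f j) < f i} \<le> k"
  proof -
    have "f i \<le> (\<Sum>j<N. f j)" if "i < N" for i using that by (intro member_le_sum) auto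
    then have "{i. i < N \<and> (\<Sum>j<N. f j) < f i} = {}" using leD by blast
    then show ?thesis by (metis card.empty le0)
  qed
  then have "card {i. i < N \<and> t < f i} \<le> k" unfolding t_def by (rule LeastI)
  moreover have "{j. trim k N f j \<noteq> 0} = {i. i < N \<and> t < f i}" by (auto simp: trim_def t_def)
  ultimately show ?thesis by simp
qed

text \<open>By minimality of \<open>t\<close>, more than \<open>k\<close> counters exceed
  \<open>t - 1\<close>. At least \<open>k + 1\<close> counters therefore lose the full
  \<open>t\<close>.\<close>

lemma trim_loss:
  "\<exists>t. (\<forall>j<N. trim k N f j \<le> f j \<and> f j \<le> trim k N f j + t) \<and>
       (\<Sum>j<N. trim k N f j) + (k + 1) * t \<le> (\<Sum>j<N. f j)"
proof -
  define t where "t = (LEAST t. card {i. i < N \<and> t < f i} \<le> k)"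
  have tr: "trim k N f j = f j - t" if "j < N" for j using that by (simp add: trim_def t_def)
  have "(\<Sum>j<N. f j - t) + (k + 1) * t \<le> (\<Sum>j<N. f j)"
  proof (cases t)
    case (Suc t')
    then have "\<not> card {i. i < N \<and> t' < f i} \<le> k" unfolding t_def by (metis lessI not_less_Least)
    moreover have "{i. i < N \<and> t' < f i} = {i. i < N \<and> t \<le> f i}" using Suc by auto
    ultimately have "k + 1 \<le> card {i. i < N \<and> t \<le> f i}" by simp
    from mult_le_mono1[OF this, of t] have "(k + 1) * t \<le> (\<Sum>j\<in>{i. i < N \<and> t \<le> f i}. t)" by simp
    also have "\<dots> = (\<Sum>j<N. if t \<le> f j then t else 0)"
      by (subst sum.inter_filter[symmetric]) (auto intro!: sum.cong)
    finally have "(\<Sum>j<N. f j - t) + (k + 1) * t \<le> (\<Sum>j<N. (f j - t) + (if t \<le> f j then t else 0))"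
      by (simp add: sum.distrib)
    also have "\<dots> \<le> (\<Sum>j<N. f j)" by (intro sum_mono) simp
    finally show ?thesis .
  qed (simp add: sum_mono)
  then show ?thesis by (intro exI[of _ t]) (auto simp: tr)
qed

text \<open>The uniform error \<open>t\<close> is paid for by lost mass: every unit of error has
  removed at least \<open>k + 1\<close> units from the total. In this form errors add under merging,
  and no bound on the number of merges is required.\<close>

definition summary :: "nat \<Rightarrow> nat \<Rightarrow> (nat \<Rightarrow> nat) \<Rightarrow> (nat \<Rightarrow> nat) \<Rightarrow> bool" where
  "summary k N S W \<longleftrightarrow> (\<forall>j\<ge>N. S j = 0) \<and> (\<exists>t. (\<forall>j<N. S j \<le> W j \<and> W j \<le> S j + t) \<and>
     (\<Sum>j<N. S j) + (k + 1) * t \<le> (\<Sum>j<N. W j))"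

lemma summary_trim: "summary k N f W \<Longrightarrow> summary k N (trim k N f) W"
proof -
  assume "summary k N f W"
  then obtain t where t: "\<forall>j<N. f j \<le> W j \<and> W j \<le> f j + t" "(\<Sum>j<N. f j) + (k + 1) * t \<le> (\<Sum>j<N. W j)"
    unfolding summary_def by blast
  obtain u where u: "\<forall>j<N. trim k N f j \<le> f j \<and> f j \<le> trim k N f j + u"
    "(\<Sum>j<N. trim k N f j) + (k + 1) * u \<le> (\<Sum>j<N. f j)" using trim_loss by blast
  have "\<forall>j<N. trim k N f j \<le> W j \<and> W j \<le> trim k N f j + (t + u)" using t(1) u(1) by fastforce
  moreover have "(\<Sum>j<N. trim k N f j) + (k + 1) * (t + u) \<le> (\<Sum>j<N. W j)"
    using t(2) u(2) by (simp add: algebra_simps)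
  moreover have "\<forall>j\<ge>N. trim k N f j = 0" by (simp add: trim_def)
  ultimately show ?thesis unfolding summary_def by blast
qed

text \<open>Errors and lost masses both add up over the children, and the own counts
  \<open>f\<close> enter with error zero.\<close>

lemma summary_add_sum:
  assumes "finite X" "\<And>x. x \<in> X \<Longrightarrow> summary k N (S x) (W x)" "\<forall>j\<ge>N. f j = 0"
  shows "summary k N (\<lambda>j. f j + (\<Sum>x\<in>X. S x j)) (\<lambda>j. f j + (\<Sum>x\<in>X. W x j))"
proof -
  have "\<forall>x\<in>X. \<exists>t. (\<forall>j<N. S x j \<le> W x j \<and> W x j \<le> S x j + t) \<and>
     (\<Sum>j<N. S x j) + (k + 1) * t \<le> (\<Sum>j<N. W x j)" using assms(2) unfolding summary_def by blast
  then obtain t where t: "\<And>x. x \<in> X \<Longrightarrow> \<forall>j<N. S x j \<le> W x j \<and> W x j \<le> S x j + t x"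
     "\<And>x. x \<in> X \<Longrightarrow> (\<Sum>j<N. S x j) + (k + 1) * t x \<le> (\<Sum>j<N. W x j)" by metis
  have "(\<Sum>j<N. f j + (\<Sum>x\<in>X. S x j)) + (k + 1) * (\<Sum>x\<in>X. t x)
      = (\<Sum>j<N. f j) + (\<Sum>x\<in>X. (\<Sum>j<N. S x j) + (k + 1) * t x)"
    using sum.swap[of "\<lambda>j x. S x j" X "{..<N}"] by (simp add: sum.distrib sum_distrib_left algebra_simps)
  also have "\<dots> \<le> (\<Sum>j<N. f j) + (\<Sum>x\<in>X. \<Sum>j<N. W x j)" using t(2) by (simp add: sum_mono)
  also have "\<dots> = (\<Sum>j<N. f j + (\<Sum>x\<in>X. W x j))"
    using sum.swap[of "\<lambda>j x. W x j" X "{..<N}"] by (simp add: sum.distrib)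
  finally have 1: "(\<Sum>j<N. f j + (\<Sum>x\<in>X. S x j)) + (k + 1) * (\<Sum>x\<in>X. t x) \<le> (\<Sum>j<N. f j + (\<Sum>x\<in>X. W x j))" .
  have 2: "f j + (\<Sum>x\<in>X. S x j) \<le> f j + (\<Sum>x\<in>X. W x j) \<and>
      f j + (\<Sum>x\<in>X. W x j) \<le> f j + (\<Sum>x\<in>X. S x j) + (\<Sum>x\<in>X. t x)" if "j < N" for j
    using t(1) that by (auto simp: sum.distrib[symmetric] intro!: sum_mono)
  have 3: "\<forall>j\<ge>N. f j + (\<Sum>x\<in>X. S x j) = 0" using assms(2,3) by (simp add: summary_def)
  show ?thesis unfolding summary_def
    using 1 2 3 by (intro conjI exI[of _ "\<Sum>x\<in>X. t x"]) blast+
qed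

text \<open>With at most \<open>k\<close> counters in use an error \<open>t\<close> can remove at
  most \<open>k * t\<close> in total, yet it must have removed \<open>(k + 1) * t\<close>. Hence
  \<open>t = 0\<close>.\<close>

lemma summary_exact:
  assumes "summary k N S W" "card {j. j < N \<and> W j \<noteq> 0} \<le> k" "j < N"
  shows "S j = W j"
proof -
  obtain t where t: "\<And>j. j < N \<Longrightarrow> S j \<le> W j \<and> W j \<le> S j + t"
    "(\<Sum>j<N. S j) + (k + 1) * t \<le> (\<Sum>j<N. W j)" using assms(1) unfolding summary_def by blast
  have "(\<Sum>j<N. W j) = (\<Sum>j\<in>{j. j < N \<and> W j \<noteq> 0}. W j)" by (intro sum.mono_neutral_right) auto
  also have "\<dots> \<le> (\<Sum>j\<in>{j. j < N \<and> W j \<noteq> 0}. S j + t)" using t(1) by (intro sum_mono) auto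
  also have "\<dots> = (\<Sum>j\<in>{j. j < N \<and> W j \<noteq> 0}. S j) + card {j. j < N \<and> W j \<noteq> 0} * t"
    by (simp add: sum.distrib)
  also have "\<dots> \<le> (\<Sum>j<N. S j) + k * t" using assms(2) by (intro add_mono sum_mono2 mult_right_mono) auto
  finally have "t = 0" using t(2) by simp
  then show ?thesis using t(1)[OF assms(3)] by simp
qed

text \<open>In \<open>up_round\<close> the cap \<open>M\<close> is never reached, but it makes the bound on message sizes an
  invariant of each single round. Only the root of a cluster acts in \<open>root_round\<close>.\<close>

definition bfs_round :: round where
  "bfs_round v s Nb r = (if par s = 0 \<and> (\<exists>j\<in>Nb. ld (r j) = ld s \<and> par (r j) \<noteq> 0)
     then s\<lparr>par := Suc (SOME j. j \<in> Nb \<and> ld (r j) = ld s \<and> par (r j) \<noteq> 0)\<rparr> else s)"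

definition up_round :: "nat \<Rightarrow> nat \<Rightarrow> nat \<Rightarrow> (st \<Rightarrow> st \<Rightarrow> nat \<Rightarrow> nat) \<Rightarrow> round" where
  "up_round k N M c v s Nb r = s\<lparr>sm := trim k N (\<lambda>j. min M ((\<Sum>y\<in>Nb. c s (r y) j)
      + (\<Sum>y\<in>{y\<in>Nb. ld (r y) = ld s \<and> par (r y) = Suc v}. sm (r y) j)))\<rparr>"

definition root_round :: "(st \<Rightarrow> (nat \<Rightarrow> nat) \<Rightarrow> st) \<Rightarrow> round" where
  "root_round dec v s Nb r = (if ld s = v then dec s (sm s) else s)\<lparr>par := par s, sm := \<lambda>_. 0\<rparr>"

definition down_round :: round where
  "down_round v s Nb r = (if ld s \<noteq> v \<and> par s - 1 \<in> Nb then (r (par s - 1))\<lparr>par := par s\<rparr> else s)\<lparr>sm := \<lambda>_. 0\<rparr>"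

text \<open>Afterwards \<open>par\<close> is nonzero exactly at the leaders, which makes them the
  seeds of the next breadth-first search.\<close>

definition merge_round :: round where
  "merge_round v s Nb r = (let l = if lf s = 3 then pt s - 1 else ld s in
     \<lparr>ld = l, pt = 0, cl = 0, lf = 0, par = (if l = v then Suc v else 0), sm = \<lambda>_. 0\<rparr>)"

lemma local_rounds:
  "local_round bfs_round" "local_round (up_round k N M c)" "local_round (root_round dec)"
  "local_round down_round" "local_round merge_round"
proof -
  show "local_round bfs_round" unfolding local_round_def bfs_round_def
    by (intro allI impI) (simp cong: conj_cong bex_cong)
  show "local_round (up_round k N M c)" unfolding local_round_def up_round_def
  proof (intro allI impI)
    fix v and s :: st and Nb and r r' :: "nat \<Rightarrow> st" assume e: "\<forall>j\<in>Nb. r j = r' j"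
    have "{y\<in>Nb. ld (r y) = ld s \<and> par (r y) = Suc v} = {y\<in>Nb. ld (r' y) = ld s \<and> par (r' y) = Suc v}"
      using e by auto
    then show "s\<lparr>sm := trim k N (\<lambda>j. min M ((\<Sum>y\<in>Nb. c s (r y) j)
        + (\<Sum>y\<in>{y\<in>Nb. ld (r y) = ld s \<and> par (r y) = Suc v}. sm (r y) j)))\<rparr>
      = s\<lparr>sm := trim k N (\<lambda>j. min M ((\<Sum>y\<in>Nb. c s (r' y) j)
        + (\<Sum>y\<in>{y\<in>Nb. ld (r' y) = ld s \<and> par (r' y) = Suc v}. sm (r' y) j)))\<rparr>"
      using e by simp
  qed
qed (simp_all add: local_round_def root_round_def down_round_def merge_round_def)

text \<open>The invariant behind the message size: identifiers, colours and parents are bounded by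
  \<open>N\<close>, counters by \<open>M\<close>, and at most \<open>k\<close> counters have to be
  transmitted.\<close>

definition small :: "nat \<Rightarrow> nat \<Rightarrow> nat \<Rightarrow> st \<Rightarrow> bool" where
  "small k N M s \<longleftrightarrow> ld s < N \<and> pt s \<le> N \<and> cl s < N \<and> lf s \<le> 3 \<and> par s \<le> N \<and>
     (\<forall>j\<ge>N. sm s j = 0) \<and> (\<forall>j. sm s j \<le> M) \<and> card {j. sm s j \<noteq> 0} \<le> k"

definition small_round :: "nat \<Rightarrow> nat \<Rightarrow> nat \<Rightarrow> round \<Rightarrow> bool" where
  "small_round k N M F \<longleftrightarrow> (\<forall>v s Nb r. v < N \<longrightarrow> small k N M s \<longrightarrow> Nb \<subseteq> {..<N} \<longrightarrow>
     (\<forall>j\<in>Nb. small k N M (r j)) \<longrightarrow> small k N M (F v s Nb r))"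

definition small_dec :: "nat \<Rightarrow> nat \<Rightarrow> nat \<Rightarrow> (st \<Rightarrow> (nat \<Rightarrow> nat) \<Rightarrow> st) \<Rightarrow> bool" where
  "small_dec k N M dec \<longleftrightarrow> (\<forall>s S. small k N M s \<longrightarrow> (\<forall>j\<ge>N. S j = 0) \<longrightarrow> small k N M (dec s S))"

lemma small_rounds:
  "small_round k N M bfs_round" "small_round k N M (up_round k N M c)"
  "small_dec k N M dec \<Longrightarrow> small_round k N M (root_round dec)"
  "small_round k N M down_round" "small_round k N M merge_round"
proof -
  show "small_round k N M bfs_round"
    unfolding small_round_def
  proof (intro allI impI)
    fix v and s :: st and Nb and r :: "nat \<Rightarrow> st" assume a: "small k N M s" "Nb \<subseteq> {..<N}"
    let ?P = "\<lambda>j. j \<in> Nb \<and> ld (r j) = ld s \<and> par (r j) \<noteq> 0"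
    show "small k N M (bfs_round v s Nb r)"
    proof (cases "\<exists>j. ?P j")
      case True
      then have "(SOME j. ?P j) \<in> Nb" by (metis (mono_tags, lifting) someI_ex)
      then show ?thesis using a by (auto simp: bfs_round_def small_def)
    next
      case False
      then have "bfs_round v s Nb r = s" by (auto simp: bfs_round_def)
      then show ?thesis using a by simp
    qed
  qed
  have tl: "trim k N (\<lambda>j. min M (f j)) i \<le> M" for f i
    by (auto simp: trim_def min_def)
  show "small_round k N M (up_round k N M c)"
    unfolding small_round_def up_round_def using tl trim_support
    by (auto simp: small_def) (simp_all add: trim_def)
  show "small_round k N M (root_round dec)" if "small_dec k N M dec"
    unfolding small_round_def
  proof (intro allI impI)
    fix v and s :: st and Nb and r :: "nat \<Rightarrow> st" assume "small k N M s"
    then have "small k N M (dec s (sm s))" "small k N M s"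
      using that by (auto simp: small_dec_def small_def)
    then show "small k N M (root_round dec v s Nb r)" by (auto simp: root_round_def small_def)
  qed
  show "small_round k N M down_round"
    by (auto simp: small_round_def down_round_def small_def)
  show "small_round k N M merge_round"
    by (auto simp: small_round_def merge_round_def small_def Let_def)
qed

lemma small_exec:
  assumes "\<And>F. F \<in> set Fs \<Longrightarrow> small_round k N M F" and "\<And>u v. adj u v \<Longrightarrow> u \<in> V \<and> v \<in> V"
    and "V \<subseteq> {..<N}" "\<And>v. v \<in> V \<Longrightarrow> small k N M (s v)" "v \<in> V"
  shows "small k N M (exec adj Fs s v)"
  using assms(1,4,5)
proof (induction Fs arbitrary: s v)
  case (Cons F Fs)
  have "small k N M (step adj F s u)" if "u \<in> V" for u
  proof -
    have "small_round k N M F" using Cons.prems(1) by simp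
    moreover have "{w. adj u w} \<subseteq> {..<N}" "\<forall>j\<in>{w. adj u w}. small k N M (s j)" "u < N"
      using assms(2,3) Cons.prems(2) that by blast+
    ultimately show ?thesis
      using Cons.prems(2)[OF that] unfolding small_round_def step_def by blast
  qed
  then show ?case using Cons.IH Cons.prems by simp
qed simp

section \<open>Spanning trees and aggregation in clusters\<close>

text \<open>The information that is common to all nodes of a cluster between aggregations; parent
  pointers and counters differ from node to node.\<close>

definition core :: "st \<Rightarrow> st" where
  "core s = s\<lparr>par := 0, sm := \<lambda>_. 0\<rparr>"

lemma core_simps [simp]:
  "core (core s) = core s" "ld (core s) = ld s" "pt (core s) = pt s" "cl (core s) = cl s"
  "lf (core s) = lf s" "core (s\<lparr>par := p\<rparr>) = core s" "core (s\<lparr>sm := f\<rparr>) = core s"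
  by (simp_all add: core_def)

lemma small_core: "small k N M s \<Longrightarrow> small k N M (core s)"
  by (simp add: small_def core_def)

text \<open>After \<open>t\<close> rounds a counter covers descendants at relative depth less than
  \<open>t\<close>, so a tree of depth \<open>D\<close> takes \<open>Suc D\<close> rounds upwards.
  Downwards, \<open>D\<close> rounds suffice because the root already holds its decision.\<close>

definition agg :: "nat \<Rightarrow> nat \<Rightarrow> nat \<Rightarrow> nat \<Rightarrow> (st \<Rightarrow> st \<Rightarrow> nat \<Rightarrow> nat) \<Rightarrow> (st \<Rightarrow> (nat \<Rightarrow> nat) \<Rightarrow> st) \<Rightarrow> round list" where
  "agg k N M D c dec = replicate (Suc D) (up_round k N M c) @ root_round dec # replicate D down_round"

definition core_query :: "(st \<Rightarrow> st \<Rightarrow> nat \<Rightarrow> nat) \<Rightarrow> bool" where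
  "core_query c \<longleftrightarrow> (\<forall>s s'. c s s' = c (core s) (core s'))"

text \<open>With at most \<open>card V\<close> neighbours at each of at most \<open>card V\<close>
  nodes, the bound \<open>4\<close> keeps all totals below the cap \<open>M\<close> of
  \<open>network\<close>.\<close>

definition bounded_query :: "nat \<Rightarrow> nat \<Rightarrow> nat \<Rightarrow> (st \<Rightarrow> st \<Rightarrow> nat \<Rightarrow> nat) \<Rightarrow> bool" where
  "bounded_query k N M c \<longleftrightarrow> (\<forall>s s' j. small k N M s \<longrightarrow> small k N M s' \<longrightarrow>
     c s s' j \<le> 4 \<and> (N \<le> j \<longrightarrow> c s s' j = 0))"

definition core_dec :: "(st \<Rightarrow> (nat \<Rightarrow> nat) \<Rightarrow> st) \<Rightarrow> bool" where
  "core_dec dec \<longleftrightarrow> (\<forall>s S. core (dec s S) = core (dec (core s) S) \<and> ld (dec s S) = ld s)"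

locale network =
  fixes V :: "nat set" and adj :: "nat \<Rightarrow> nat \<Rightarrow> bool" and k N M :: nat
  assumes finite_V: "finite V" and adj_sym: "adj u v \<Longrightarrow> adj v u"
    and adj_V: "adj u v \<Longrightarrow> u \<in> V \<and> v \<in> V" and adj_irrefl: "\<not> adj v v"
    and V_less: "V \<subseteq> {..<N}" and M_large: "card V * (card V * 4) \<le> M"
begin

definition rel :: "(nat \<Rightarrow> nat) \<Rightarrow> (nat \<times> nat) set" where
  "rel l = {(x, y). adj x y \<and> l x = l y}"

definition rad :: "nat \<Rightarrow> (nat \<Rightarrow> nat) \<Rightarrow> bool" where
  "rad D l \<longleftrightarrow> (\<forall>v\<in>V. l v \<in> V \<and> l (l v) = l v \<and> (\<exists>m\<le>D. (l v, v) \<in> rel l ^^ m))"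

text \<open>The depth is a certificate used only in proofs and is not stored in any state; its
  decrease along parents rules out cycles. A root points to itself, so its \<open>par\<close> is
  nonzero like that of every reached node.\<close>

definition tree_at :: "(nat \<Rightarrow> nat) \<Rightarrow> (nat \<Rightarrow> nat) \<Rightarrow> (nat \<Rightarrow> nat) \<Rightarrow> nat \<Rightarrow> bool" where
  "tree_at l p dep v \<longleftrightarrow> (if l v = v then dep v = 0 \<and> p v = Suc v
     else (\<exists>u. p v = Suc u \<and> adj v u \<and> l u = l v \<and> dep v = Suc (dep u)))"

definition tree :: "nat \<Rightarrow> (nat \<Rightarrow> nat) \<Rightarrow> (nat \<Rightarrow> nat) \<Rightarrow> (nat \<Rightarrow> nat) \<Rightarrow> bool" where
  "tree D l p dep \<longleftrightarrow> (\<forall>v\<in>V. dep v \<le> D \<and> tree_at l p dep v)"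

lemma finite_nbrs: "finite {u. adj v u}"
  by (rule finite_subset[OF _ finite_V]) (use adj_V in blast)

text \<open>Depths are assigned when a node is reached and never change. The clause that parents
  have been reached preserves this: a newly reached node is never the parent of an older one, so
  updating its depth does not disturb the tree.\<close>

lemma bfs_invariant:
  assumes s0: "\<And>v. v \<in> V \<Longrightarrow> ld (s v) = l v"
    and p0: "\<And>v. v \<in> V \<Longrightarrow> par (s v) = (if l v = v then Suc v else 0)"
  shows "\<exists>dep. (\<forall>v\<in>V. let s' = exec adj (replicate t bfs_round) s in
      s' v = (s v)\<lparr>par := par (s' v)\<rparr> \<and>
      (par (s' v) \<noteq> 0 \<longrightarrow> dep v \<le> t \<and> tree_at l (\<lambda>v. par (s' v)) dep v \<and>
         (l v \<noteq> v \<longrightarrow> par (s' (par (s' v) - 1)) \<noteq> 0)) \<and>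
      (\<forall>m\<le>t. (l v, v) \<in> rel l ^^ m \<longrightarrow> par (s' v) \<noteq> 0))"
proof (induction t)
  case 0
  have "par (s v) \<noteq> 0" if "v \<in> V" "(l v, v) \<in> rel l ^^ 0" for v using that p0 by simp
  then show ?case using p0 by (intro exI[of _ "\<lambda>_. 0"]) (auto simp: tree_at_def Let_def)
next
  case (Suc t)
  define s1 where "s1 = exec adj (replicate t bfs_round) s"
  from Suc obtain dep where dep: "\<And>v. v \<in> V \<Longrightarrow> s1 v = (s v)\<lparr>par := par (s1 v)\<rparr>"
    "\<And>v. v \<in> V \<Longrightarrow> par (s1 v) \<noteq> 0 \<Longrightarrow> dep v \<le> t \<and> tree_at l (\<lambda>v. par (s1 v)) dep v \<and>
         (l v \<noteq> v \<longrightarrow> par (s1 (par (s1 v) - 1)) \<noteq> 0)"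
    "\<And>v m. v \<in> V \<Longrightarrow> m \<le> t \<Longrightarrow> (l v, v) \<in> rel l ^^ m \<Longrightarrow> par (s1 v) \<noteq> 0"
    unfolding s1_def Let_def by blast
  have ld1: "ld (s1 v) = l v" if "v \<in> V" for v using dep(1)[OF that] s0[OF that] by (metis st.select_convs(1) st.surjective st.update_convs(5))
  define s2 where "s2 = step adj bfs_round s1"
  have ex: "exec adj (replicate (Suc t) bfs_round) s = s2"
    unfolding s2_def s1_def by (rule exec_replicate_Suc)
  let ?P = "\<lambda>v j. adj v j \<and> ld (s1 j) = ld (s1 v) \<and> par (s1 j) \<noteq> 0"
  have s2: "s2 v = (if par (s1 v) = 0 \<and> (\<exists>j. ?P v j) then (s1 v)\<lparr>par := Suc (SOME j. ?P v j)\<rparr> else s1 v)" for v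
    by (simp add: s2_def step_def bfs_round_def Bex_def)
  define new where "new v \<longleftrightarrow> par (s1 v) = 0 \<and> (\<exists>j. ?P v j)" for v
  have new: "\<exists>j. ?P v j \<and> par (s2 v) = Suc j" if "new v" for v
  proof -
    have "?P v (SOME j. ?P v j)" by (rule someI_ex) (use that new_def in blast)
    moreover have "par (s2 v) = Suc (SOME j. ?P v j)" using that unfolding new_def s2 by simp
    ultimately show ?thesis by blast
  qed
  have old: "s2 v = s1 v" if "\<not> new v" for v using that unfolding new_def s2 by simp
  define dep' where "dep' v = (if new v then Suc (dep (par (s2 v) - 1)) else dep v)" for v
  have stay: "par (s1 v) \<noteq> 0 \<Longrightarrow> par (s2 v) = par (s1 v) \<and> dep' v = dep v" for v
    unfolding dep'_def new_def s2 by simp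
  have main: "s2 v = (s v)\<lparr>par := par (s2 v)\<rparr> \<and>
      (par (s2 v) \<noteq> 0 \<longrightarrow> dep' v \<le> Suc t \<and> tree_at l (\<lambda>v. par (s2 v)) dep' v \<and>
         (l v \<noteq> v \<longrightarrow> par (s2 (par (s2 v) - 1)) \<noteq> 0)) \<and>
      (\<forall>m\<le>Suc t. (l v, v) \<in> rel l ^^ m \<longrightarrow> par (s2 v) \<noteq> 0)" if v: "v \<in> V" for v
  proof (intro conjI impI allI)
    show "s2 v = (s v)\<lparr>par := par (s2 v)\<rparr>"
    proof (cases "new v")
      case True
      then show ?thesis using dep(1)[OF v] unfolding new_def s2 by simp
    qed (use dep(1)[OF v] old in simp)
  next
    assume p: "par (s2 v) \<noteq> 0"
    have "dep' v \<le> Suc t \<and> tree_at l (\<lambda>v. par (s2 v)) dep' v \<and>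
         (l v \<noteq> v \<longrightarrow> par (s2 (par (s2 v) - 1)) \<noteq> 0)"
    proof (cases "new v")
      case True
      obtain j where j: "?P v j" "par (s2 v) = Suc j" using new[OF True] by blast
      have jV: "j \<in> V" "l j = l v" using j(1) adj_V ld1 v by metis+
      have "l v \<noteq> v"
        using dep(3)[OF v, of 0] True unfolding new_def by auto
      then show ?thesis
        using j jV dep(2)[OF jV(1)] stay[of j] True by (auto simp: tree_at_def dep'_def)
    next
      case False
      then have p1: "par (s1 v) \<noteq> 0" using p old by simp
      note d = dep(2)[OF v p1]
      show ?thesis
      proof (cases "l v = v")
        case True
        then show ?thesis using d stay[OF p1] by (simp add: tree_at_def)
      next
        case False
        then show ?thesis using d stay[OF p1] stay[of "par (s1 v) - 1"] by (auto simp: tree_at_def)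
      qed
    qed
    then show "dep' v \<le> Suc t" "tree_at l (\<lambda>v. par (s2 v)) dep' v"
      "l v \<noteq> v \<Longrightarrow> par (s2 (par (s2 v) - 1)) \<noteq> 0" by blast+
  next
    fix m assume m: "m \<le> Suc t" "(l v, v) \<in> rel l ^^ m"
    show "par (s2 v) \<noteq> 0"
    proof (cases "m \<le> t")
      case True
      then show ?thesis using dep(3)[OF v _ m(2)] stay by simp
    next
      case False
      then have "m = Suc t" using m by simp
      then obtain u where u: "(l v, u) \<in> rel l ^^ t" "adj u v" "l u = l v"
        using m(2) by (auto simp: rel_def)
      have uV: "u \<in> V" using u adj_V by blast
      have "(l u, u) \<in> rel l ^^ t" using u by simp
      then have "par (s1 u) \<noteq> 0" using dep(3)[OF uV] by blast
      then have "?P v u" using u ld1 uV v adj_sym by auto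
      then have "new v \<or> par (s1 v) \<noteq> 0" unfolding new_def by blast
      then show ?thesis using new stay by fastforce
    qed
  qed
  show ?case unfolding ex Let_def using main by blast
qed

lemma bfs_tree:
  assumes rad: "rad D l" and s0: "\<And>v. v \<in> V \<Longrightarrow> ld (s v) = l v"
    and p0: "\<And>v. v \<in> V \<Longrightarrow> par (s v) = (if l v = v then Suc v else 0)"
    and s': "s' = exec adj (replicate D bfs_round) s"
  shows "\<exists>dep. tree D l (\<lambda>v. par (s' v)) dep" "v \<in> V \<Longrightarrow> s' v = (s v)\<lparr>par := par (s' v)\<rparr>"
proof -
  from bfs_invariant[OF s0 p0, of D] obtain dep where dep: "\<forall>v\<in>V.
      s' v = (s v)\<lparr>par := par (s' v)\<rparr> \<and>
      (par (s' v) \<noteq> 0 \<longrightarrow> dep v \<le> D \<and> tree_at l (\<lambda>v. par (s' v)) dep v \<and>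
         (l v \<noteq> v \<longrightarrow> par (s' (par (s' v) - 1)) \<noteq> 0)) \<and>
      (\<forall>m\<le>D. (l v, v) \<in> rel l ^^ m \<longrightarrow> par (s' v) \<noteq> 0)"
    unfolding s' Let_def by blast
  then have "par (s' v) \<noteq> 0" if "v \<in> V" for v using rad that unfolding rad_def by blast
  then show "\<exists>dep. tree D l (\<lambda>v. par (s' v)) dep" using dep unfolding tree_def by blast
  show "v \<in> V \<Longrightarrow> s' v = (s v)\<lparr>par := par (s' v)\<rparr>" using dep by blast
qed

section \<open>Convergecast sums\<close>

definition children :: "(nat \<Rightarrow> nat) \<Rightarrow> (nat \<Rightarrow> nat) \<Rightarrow> nat \<Rightarrow> nat set" where
  "children l p v = {y. adj v y \<and> l y = l v \<and> p y = Suc v}"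

text \<open>The recursion that \<open>up_round\<close> performs, without trimming and cap: the exact
  quantity that the counters summarise after \<open>t\<close> rounds.\<close>

primrec subtotal :: "(nat \<Rightarrow> nat) \<Rightarrow> (nat \<Rightarrow> nat) \<Rightarrow> (nat \<Rightarrow> nat \<Rightarrow> nat) \<Rightarrow> nat \<Rightarrow> nat \<Rightarrow> nat \<Rightarrow> nat" where
  "subtotal l p own 0 = (\<lambda>v j. 0)"
| "subtotal l p own (Suc t) = (\<lambda>v j. own v j + (\<Sum>y\<in>children l p v. subtotal l p own t y j))"

text \<open>The children of the nodes on level \<open>i\<close> partition level
  \<open>i + 1\<close>. Summing over a whole level instead of one node lets the induction proceed
  without describing individual subtrees.\<close>

lemma subtotal_level:
  assumes "tree D l p dep"
  shows "(\<Sum>v\<in>{v\<in>V. l v = r \<and> dep v = i}. subtotal l p own t v j)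
     = (\<Sum>v\<in>{v\<in>V. l v = r \<and> i \<le> dep v \<and> dep v < i + t}. own v j)"
proof (induction t arbitrary: i)
  case 0
  have "{v \<in> V. l v = r \<and> i \<le> dep v \<and> dep v < i + 0} = {}" by auto
  then show ?case by (simp del: Collect_empty_eq)
next
  case (Suc t)
  let ?L = "\<lambda>i. {v\<in>V. l v = r \<and> dep v = i}"
  have ch: "children l p v \<subseteq> V" for v using adj_V by (auto simp: children_def)
  have "?L (Suc i) = (\<Union>v\<in>?L i. children l p v)"
  proof
    show "?L (Suc i) \<subseteq> (\<Union>v\<in>?L i. children l p v)"
    proof
      fix y assume y: "y \<in> ?L (Suc i)"
      then have "tree_at l p dep y" using assms by (simp add: tree_def)
      then have "l y \<noteq> y" using y by (auto simp: tree_at_def)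
      then obtain u where "p y = Suc u" "adj y u" "l u = l y" "dep y = Suc (dep u)"
        using \<open>tree_at l p dep y\<close> by (auto simp: tree_at_def)
      then have "y \<in> children l p u" "u \<in> ?L i" using y adj_sym adj_V by (auto simp: children_def)
      then show "y \<in> (\<Union>v\<in>?L i. children l p v)" by blast
    qed
    show "(\<Union>v\<in>?L i. children l p v) \<subseteq> ?L (Suc i)"
    proof
      fix y assume "y \<in> (\<Union>v\<in>?L i. children l p v)"
      then obtain v where v: "v \<in> ?L i" "adj v y" "l y = l v" "p y = Suc v" by (auto simp: children_def)
      then have "y \<in> V" "v \<noteq> y" using adj_V adj_irrefl by blast+
      then have "tree_at l p dep y" using assms by (simp add: tree_def)
      then have "dep y = Suc (dep v)" using v \<open>v \<noteq> y\<close> by (auto simp: tree_at_def split: if_splits)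
      then show "y \<in> ?L (Suc i)" using v \<open>y \<in> V\<close> by simp
    qed
  qed
  then have "(\<Sum>y\<in>?L (Suc i). subtotal l p own t y j)
      = (\<Sum>v\<in>?L i. \<Sum>y\<in>children l p v. subtotal l p own t y j)"
    using finite_V finite_subset[OF ch finite_V]
    by (simp only:) (intro sum.UNION_disjoint, auto simp: children_def)
  then have "(\<Sum>v\<in>?L i. subtotal l p own (Suc t) v j)
      = (\<Sum>v\<in>?L i. own v j) + (\<Sum>v\<in>{v\<in>V. l v = r \<and> Suc i \<le> dep v \<and> dep v < Suc i + t}. own v j)"
    by (simp add: sum.distrib Suc.IH)
  also have "\<dots> = (\<Sum>v\<in>?L i \<union> {v\<in>V. l v = r \<and> Suc i \<le> dep v \<and> dep v < Suc i + t}. own v j)"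
    using finite_V by (intro sum.union_disjoint[symmetric]) auto
  also have "?L i \<union> {v\<in>V. l v = r \<and> Suc i \<le> dep v \<and> dep v < Suc i + t}
      = {v\<in>V. l v = r \<and> i \<le> dep v \<and> dep v < i + Suc t}" by auto
  finally show ?case .
qed

lemma subtotal_le:
  assumes "tree D l p dep" "v \<in> V"
  shows "subtotal l p own t v j \<le> (\<Sum>u\<in>V. own u j)"
proof -
  have "subtotal l p own t v j \<le> (\<Sum>u\<in>{u\<in>V. l u = l v \<and> dep u = dep v}. subtotal l p own t u j)"
    using assms(2) finite_V by (intro member_le_sum) auto
  also have "\<dots> = (\<Sum>u\<in>{u\<in>V. l u = l v \<and> dep v \<le> dep u \<and> dep u < dep v + t}. own u j)"
    by (rule subtotal_level[OF assms(1)])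
  also have "\<dots> \<le> (\<Sum>u\<in>V. own u j)" using finite_V by (intro sum_mono2) auto
  finally show ?thesis .
qed

lemma subtotal_root:
  assumes "tree D l p dep" "r \<in> V" "l r = r"
  shows "subtotal l p own (Suc D) r j = (\<Sum>v\<in>{v\<in>V. l v = r}. own v j)"
proof -
  have "{v\<in>V. l v = r \<and> dep v = 0} = {r}"
  proof -
    have "dep v = 0 \<longleftrightarrow> l v = v" if "v \<in> V" for v
      using assms(1) that by (auto simp: tree_def tree_at_def split: if_splits)
    then show ?thesis using assms(2,3) by auto
  qed
  moreover have "{v\<in>V. l v = r \<and> 0 \<le> dep v \<and> dep v < 0 + Suc D} = {v\<in>V. l v = r}"
    using assms(1) by (auto simp: tree_def le_imp_less_Suc)
  ultimately show ?thesis using subtotal_level[OF assms(1), where r = r and i = 0 and t = "Suc D"] by (simp del: subtotal.simps)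
qed

end

section \<open>Weights between clusters and correctness of aggregation\<close>

context network
begin

definition weight :: "(nat \<Rightarrow> nat) \<Rightarrow> nat \<Rightarrow> nat \<Rightarrow> nat" where
  "weight l r s = card {(x, y). adj x y \<and> l x = r \<and> l y = s}"

lemma weight_sym: "weight l r s = weight l s r"
proof -
  have "{(x, y). adj x y \<and> l x = r \<and> l y = s} = prod.swap ` {(x, y). adj x y \<and> l x = s \<and> l y = r}"
    using adj_sym by (auto simp: image_iff)
  then show ?thesis by (simp add: weight_def card_image)
qed

lemma finite_adj: "finite {(x, y). adj x y \<and> P x y}"
  by (rule finite_subset[of _ "V \<times> V"]) (use adj_V finite_V in auto)

text \<open>What the nodes of a cluster count edge by edge becomes a weighted sum over clusters,
  since the counted value depends only on the cluster at the other end.\<close>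

lemma sum_cluster_nbrs:
  fixes f :: "nat \<Rightarrow> nat"
  shows "(\<Sum>x\<in>{x\<in>V. l x = r}. \<Sum>y\<in>{y. adj x y}. f (l y)) = (\<Sum>s\<in>l ` V. weight l r s * f s)"
proof -
  have "(\<Sum>x\<in>{x\<in>V. l x = r}. \<Sum>y\<in>{y. adj x y}. f (l y))
      = (\<Sum>(x, y)\<in>Sigma {x\<in>V. l x = r} (\<lambda>x. {y. adj x y}). f (l y))"
    using finite_V finite_nbrs by (simp add: sum.Sigma)
  also have "Sigma {x\<in>V. l x = r} (\<lambda>x. {y. adj x y}) = {(x, y). adj x y \<and> l x = r}"
    using adj_V by auto
  also have "(\<Sum>(x, y)\<in>{(x, y). adj x y \<and> l x = r}. f (l y))
      = (\<Sum>s\<in>l ` V. \<Sum>(x, y)\<in>{z \<in> {(x, y). adj x y \<and> l x = r}. l (snd z) = s}. f (l y))"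
    using finite_adj adj_V finite_V by (intro sum.group[symmetric]) auto
  also have "\<dots> = (\<Sum>s\<in>l ` V. weight l r s * f s)"
  proof (intro sum.cong refl)
    fix s
    have "{z \<in> {(x, y). adj x y \<and> l x = r}. l (snd z) = s} = {(x, y). adj x y \<and> l x = r \<and> l y = s}" by auto
    moreover have "(\<Sum>(x, y)\<in>{(x, y). adj x y \<and> l x = r \<and> l y = s}. f (l y))
        = (\<Sum>z\<in>{(x, y). adj x y \<and> l x = r \<and> l y = s}. f s)" by (intro sum.cong) auto
    ultimately show "(\<Sum>(x, y)\<in>{z \<in> {(x, y). adj x y \<and> l x = r}. l (snd z) = s}. f (l y)) = weight l r s * f s"
      by (simp add: weight_def)
  qed
  finally show ?thesis .
qed

text \<open>The network state \<open>s\<close> represents the assignment \<open>X\<close> of cluster states to leaders.\<close>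

definition rep :: "nat \<Rightarrow> (nat \<Rightarrow> nat) \<Rightarrow> (nat \<Rightarrow> st) \<Rightarrow> (nat \<Rightarrow> st) \<Rightarrow> bool" where
  "rep D l X s \<longleftrightarrow> rad D l \<and> (\<exists>dep. tree D l (\<lambda>v. par (s v)) dep) \<and>
     (\<forall>v\<in>V. core (s v) = X (l v) \<and> ld (s v) = l v \<and> sm (s v) = (\<lambda>_. 0) \<and> small k N M (s v))"

lemma step_up_round:
  "step adj (up_round k N M c) s v = (s v)\<lparr>sm := trim k N (\<lambda>j. min M ((\<Sum>y\<in>{u. adj v u}. c (s v) (s y) j)
      + (\<Sum>y\<in>{y \<in> {u. adj v u}. ld (s y) = ld (s v) \<and> par (s y) = Suc v}. sm (s y) j)))\<rparr>"
  by (simp add: step_def up_round_def)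

lemma up_invariant:
  assumes c: "core_query c" "bounded_query k N M c"
    and tree: "tree D l (\<lambda>v. par (s v)) dep"
    and s: "\<And>v. v \<in> V \<Longrightarrow> ld (s v) = l v \<and> sm (s v) = (\<lambda>_. 0) \<and> small k N M (s v)"
    and own: "own = (\<lambda>v j. \<Sum>y\<in>{u. adj v u}. c (core (s v)) (core (s y)) j)"
    and v: "v \<in> V"
  defines "s' t \<equiv> exec adj (replicate t (up_round k N M c)) s"
  shows "s' t v = (s v)\<lparr>sm := sm (s' t v)\<rparr> \<and>
    summary k N (sm (s' t v)) (subtotal l (\<lambda>v. par (s v)) own t v)"
  using v
proof (induction t arbitrary: v)
  case 0
  then show ?case using s[of v] by (auto simp: s'_def summary_def intro!: exI[of _ 0])
next
  case (Suc t)
  let ?p = "\<lambda>v. par (s v)"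
  let ?T = "subtotal l ?p own"
  have IH: "s' t u = (s u)\<lparr>sm := sm (s' t u)\<rparr>" "summary k N (sm (s' t u)) (?T t u)" if "u \<in> V" for u
    using Suc.IH[OF that] by blast+
  have st: "core (s' t u) = core (s u) \<and> ld (s' t u) = l u \<and> par (s' t u) = par (s u)" if "u \<in> V" for u
    using IH(1)[OF that] s[OF that] by (metis core_simps(7) st.select_convs(1,5) st.surjective st.update_convs(6))
  have nb: "\<And>y. adj v y \<Longrightarrow> y \<in> V" using adj_V by blast
  have ch: "{y \<in> {u. adj v u}. ld (s' t y) = ld (s' t v) \<and> par (s' t y) = Suc v} = children l ?p v"
    unfolding children_def using st nb Suc.prems by auto
  have ow: "(\<Sum>y\<in>{u. adj v u}. c (s' t v) (s' t y) j) = own v j" for j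
    unfolding own
  proof (intro sum.cong refl)
    fix y assume "y \<in> {u. adj v u}"
    then have "core (s' t v) = core (s v)" "core (s' t y) = core (s y)" using st nb Suc.prems by auto
    then show "c (s' t v) (s' t y) j = c (core (s v)) (core (s y)) j"
      using c(1) unfolding core_query_def by metis
  qed
  have chV: "children l ?p v \<subseteq> V" using nb by (auto simp: children_def)
  have bnd: "own u j \<le> card V * 4" "N \<le> j \<Longrightarrow> own u j = 0" if "u \<in> V" for u j
  proof -
    have b: "c (core (s u)) (core (s y)) j \<le> 4 \<and> (N \<le> j \<longrightarrow> c (core (s u)) (core (s y)) j = 0)" if "adj u y" for y
      using c(2) small_core s \<open>u \<in> V\<close> adj_V[OF that] unfolding bounded_query_def by blast
    have "own u j \<le> (\<Sum>y\<in>{w. adj u w}. 4)" unfolding own using b by (intro sum_mono) simp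
    also have "\<dots> \<le> card V * 4"
      using card_mono[OF finite_V, of "{w. adj u w}"] adj_V by auto
    finally show "own u j \<le> card V * 4" .
    show "N \<le> j \<Longrightarrow> own u j = 0" unfolding own using b by (intro sum.neutral) simp
  qed
  \<comment> \<open>Summaries never overestimate, so the exact total over the network bounds every
    counter and the cap has no effect.\<close>
  have le_M: "own v j + (\<Sum>y\<in>children l ?p v. sm (s' t y) j) \<le> M" for j
  proof (cases "j < N")
    case True
    have "(\<Sum>y\<in>children l ?p v. sm (s' t y) j) \<le> (\<Sum>y\<in>children l ?p v. ?T t y j)"
      using IH(2) chV True by (intro sum_mono) (auto simp: summary_def)
    then have "own v j + (\<Sum>y\<in>children l ?p v. sm (s' t y) j) \<le> ?T (Suc t) v j" by simp
    also have "\<dots> \<le> (\<Sum>u\<in>V. own u j)" using tree Suc.prems by (rule subtotal_le)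
    also have "\<dots> \<le> (\<Sum>u\<in>V. card V * 4)" using bnd(1) by (intro sum_mono) blast
    also have "\<dots> \<le> M" using M_large by simp
    finally show ?thesis .
  next
    case False
    then have "sm (s' t y) j = 0" if "y \<in> V" for y using IH(2)[OF that] by (simp add: summary_def)
    then show ?thesis using False bnd(2)[OF Suc.prems] chV by (simp add: subset_iff)
  qed
  have eq: "s' (Suc t) v = (s' t v)\<lparr>sm := trim k N (\<lambda>j. own v j + (\<Sum>y\<in>children l ?p v. sm (s' t y) j))\<rparr>"
    unfolding s'_def exec_replicate_Suc step_up_round
    unfolding s'_def[symmetric] ch ow using le_M by (simp add: min_absorb2)
  have "summary k N (\<lambda>j. own v j + (\<Sum>y\<in>children l ?p v. sm (s' t y) j)) (?T (Suc t) v)"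
    unfolding subtotal.simps
    using chV finite_V IH(2) bnd(2)[OF Suc.prems]
    by (intro summary_add_sum) (auto intro: finite_subset)
  then have "summary k N (sm (s' (Suc t) v)) (?T (Suc t) v)" unfolding eq by (simp add: summary_trim)
  moreover have "s' (Suc t) v = (s v)\<lparr>sm := sm (s' (Suc t) v)\<rparr>"
    unfolding eq using arg_cong[OF IH(1)[OF Suc.prems], of "sm_update (\<lambda>_. F)" for F] by simp
  ultimately show ?case by blast
qed

text \<open>A node deeper than \<open>t\<close> may copy an outdated state from its parent. This is
  harmless, as the leader is the same and \<open>par\<close> is restored; the decision itself
  advances one level per round.\<close>

lemma down_invariant:
  assumes tree: "tree D l (\<lambda>v. par (s v)) dep"
    and s: "\<And>v. v \<in> V \<Longrightarrow> ld (s v) = l v \<and> sm (s v) = (\<lambda>_. 0)"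
    and root: "\<And>v. v \<in> V \<Longrightarrow> l v = v \<Longrightarrow> core (s v) = Y v"
    and v: "v \<in> V"
  defines "s' t \<equiv> exec adj (replicate t down_round) s"
  shows "ld (s' t v) = l v \<and> sm (s' t v) = (\<lambda>_. 0) \<and> par (s' t v) = par (s v) \<and>
     (dep v \<le> t \<longrightarrow> core (s' t v) = Y (l v))"
  using v
proof (induction t arbitrary: v)
  case 0
  then have "tree_at l (\<lambda>v. par (s v)) dep v" using tree by (simp add: tree_def)
  then show ?case using 0 s root by (auto simp: s'_def tree_at_def split: if_splits)
next
  case (Suc t)
  have at: "tree_at l (\<lambda>v. par (s v)) dep v" using tree Suc.prems by (simp add: tree_def)
  note IHv = Suc.IH[OF Suc.prems]
  have eq: "s' (Suc t) v = (if ld (s' t v) \<noteq> v \<and> adj v (par (s' t v) - 1)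
      then (s' t (par (s' t v) - 1))\<lparr>par := par (s' t v)\<rparr> else s' t v)\<lparr>sm := \<lambda>_. 0\<rparr>"
    unfolding s'_def exec_replicate_Suc by (simp add: step_def down_round_def)
  show ?case
  proof (cases "l v = v")
    case True
    then have "dep v = 0" using at by (simp add: tree_at_def)
    moreover have "s' (Suc t) v = (s' t v)\<lparr>sm := \<lambda>_. 0\<rparr>" unfolding eq using IHv True by simp
    ultimately show ?thesis using IHv by simp
  next
    case False
    then obtain u where u: "par (s v) = Suc u" "adj v u" "l u = l v" "dep v = Suc (dep u)"
      using at by (auto simp: tree_at_def)
    have uV: "u \<in> V" using u adj_V by blast
    have "s' (Suc t) v = (s' t u)\<lparr>par := par (s v), sm := \<lambda>_. 0\<rparr>" unfolding eq using IHv u False by simp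
    then show ?thesis using Suc.IH[OF uV] u by simp
  qed
qed

lemma tree_cong:
  "tree D l p dep \<Longrightarrow> (\<And>v. v \<in> V \<Longrightarrow> p' v = p v) \<Longrightarrow> tree D l p' dep"
  by (simp add: tree_def tree_at_def)

text \<open>On the cluster level an aggregation is a single step: every leader applies
  \<open>dec\<close> to some summary of its weighted counts. The summary is left unspecified so that
  callers may use it approximately or, with few counters, exactly.\<close>

lemma agg_correct:
  assumes rep: "rep D l X s" and c: "core_query c" "bounded_query k N M c"
    and d: "core_dec dec" "small_dec k N M dec"
  shows "\<exists>S. (\<forall>r\<in>l ` V. summary k N (S r) (\<lambda>j. \<Sum>q\<in>l ` V. weight l r q * c (X r) (X q) j)) \<and>
     rep D l (\<lambda>r. core (dec (X r) (S r))) (exec adj (agg k N M D c dec) s)"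
proof -
  from rep obtain dep where rad: "rad D l" and tree: "tree D l (\<lambda>v. par (s v)) dep"
    and s: "\<And>v. v \<in> V \<Longrightarrow> core (s v) = X (l v) \<and> ld (s v) = l v \<and> sm (s v) = (\<lambda>_. 0) \<and> small k N M (s v)"
    unfolding rep_def by blast
  have small_s: "small k N M (s v)" if "v \<in> V" for v using s[OF that] by (elim conjE)
  define own where "own = (\<lambda>v j. \<Sum>y\<in>{u. adj v u}. c (core (s v)) (core (s y)) j)"
  define s1 where "s1 = exec adj (replicate (Suc D) (up_round k N M c)) s"
  define s2 where "s2 = step adj (root_round dec) s1"
  define s3 where "s3 = exec adj (replicate D down_round) s2"
  have ex: "exec adj (agg k N M D c dec) s = s3"
    unfolding agg_def s3_def s2_def s1_def by (simp del: replicate.simps)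
  have up: "s1 v = (s v)\<lparr>sm := sm (s1 v)\<rparr>"
    "summary k N (sm (s1 v)) (subtotal l (\<lambda>v. par (s v)) own (Suc D) v)" if "v \<in> V" for v
    using up_invariant[OF c tree _ own_def that, of "Suc D"] s unfolding s1_def by blast+
  define S where "S r = sm (s1 r)" for r
  have sum: "summary k N (S r) (\<lambda>j. \<Sum>q\<in>l ` V. weight l r q * c (X r) (X q) j)" if "r \<in> l ` V" for r
  proof -
    have r: "r \<in> V" "l r = r" using that rad by (auto simp: rad_def)
    have "subtotal l (\<lambda>v. par (s v)) own (Suc D) r j = (\<Sum>q\<in>l ` V. weight l r q * c (X r) (X q) j)" for j
    proof -
      have "(\<Sum>v\<in>{v\<in>V. l v = r}. own v j) = (\<Sum>v\<in>{v\<in>V. l v = r}. \<Sum>y\<in>{y. adj v y}. c (X r) (X (l y)) j)"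
        unfolding own_def
      proof (intro sum.cong refl)
        fix x y assume "x \<in> {v\<in>V. l v = r}" "y \<in> {u. adj x u}"
        then show "c (core (s x)) (core (s y)) j = c (X r) (X (l y)) j" using s adj_V by auto
      qed
      also have "\<dots> = (\<Sum>q\<in>l ` V. weight l r q * c (X r) (X q) j)" by (rule sum_cluster_nbrs)
      finally show ?thesis using subtotal_root[OF tree r, of own j] by simp
    qed
    then have "subtotal l (\<lambda>v. par (s v)) own (Suc D) r = (\<lambda>j. \<Sum>q\<in>l ` V. weight l r q * c (X r) (X q) j)" by blast
    then show ?thesis using up(2)[OF r(1)] unfolding S_def by simp
  qed
  have c1: "core (s1 v) = core (s v) \<and> ld (s1 v) = l v \<and> par (s1 v) = par (s v)" if "v \<in> V" for v
    using up(1)[OF that] s[OF that] by (metis core_simps(7) st.select_convs(1,5) st.surjective st.update_convs(6))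
  have s2: "s2 v = (if ld (s1 v) = v then dec (s1 v) (sm (s1 v)) else s1 v)\<lparr>par := par (s1 v), sm := \<lambda>_. 0\<rparr>" for v
    by (simp add: s2_def step_def root_round_def)
  define Y where "Y = (\<lambda>r. core (dec (X r) (S r)))"
  have s2': "ld (s2 v) = l v \<and> sm (s2 v) = (\<lambda>_. 0) \<and> par (s2 v) = par (s v)" if "v \<in> V" for v
    using c1[OF that] d(1) unfolding s2 core_dec_def by simp
  have root: "core (s2 v) = Y v" if "v \<in> V" "l v = v" for v
  proof -
    have "core (s2 v) = core (dec (s1 v) (S v))" unfolding s2 S_def using c1[OF that(1)] that(2) by simp
    also have "\<dots> = core (dec (core (s1 v)) (S v))" using d(1) unfolding core_dec_def by metis
    also have "core (s1 v) = X v" using c1[OF that(1)] s[OF that(1)] that(2) by simp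
    finally show ?thesis unfolding Y_def .
  qed
  have tree2: "tree D l (\<lambda>v. par (s2 v)) dep"
    by (rule tree_cong[OF tree]) (use s2' in blast)
  have dn: "ld (s3 v) = l v \<and> sm (s3 v) = (\<lambda>_. 0) \<and> par (s3 v) = par (s v) \<and> core (s3 v) = Y (l v)" if "v \<in> V" for v
  proof -
    have "dep v \<le> D" using tree that by (simp add: tree_def)
    moreover have "ld (s3 v) = l v \<and> sm (s3 v) = (\<lambda>_. 0) \<and> par (s3 v) = par (s2 v) \<and>
        (dep v \<le> D \<longrightarrow> core (s3 v) = Y (l v))"
      unfolding s3_def
    proof (rule down_invariant[where s = s2, OF tree2])
      show "ld (s2 u) = l u \<and> sm (s2 u) = (\<lambda>_. 0)" if "u \<in> V" for u using s2'[OF that] by (elim conjE) (intro conjI)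
    qed (use root that in blast)+
    ultimately show ?thesis using s2'[OF that] by (elim conjE) (intro conjI; simp)
  qed
  have tree3: "tree D l (\<lambda>v. par (s3 v)) dep"
    by (rule tree_cong[OF tree]) (use dn in blast)
  have sm3: "small k N M (s3 v)" if "v \<in> V" for v
    unfolding ex[symmetric]
  proof (rule small_exec[OF _ adj_V V_less _ that])
    fix F assume "F \<in> set (agg k N M D c dec)"
    then have "F = up_round k N M c \<or> F = root_round dec \<or> F = down_round"
      unfolding agg_def by (simp del: replicate.simps) (metis in_set_replicate)
    then show "small_round k N M F" using small_rounds d(2) by blast
  qed (auto intro: small_s)
  have "rep D l Y s3"
    unfolding rep_def by (intro conjI ballI rad exI[of _ dep] tree3) (simp_all add: dn sm3)
  then show ?thesis unfolding ex Y_def by (intro exI[of _ S] conjI ballI sum)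
qed

end

section \<open>Choosing, colouring and orienting heavy edges between clusters\<close>

definition count_query :: "st \<Rightarrow> st \<Rightarrow> nat \<Rightarrow> nat" where
  "count_query s s' j = (if ld s' \<noteq> ld s \<and> j = ld s' then 1 else 0)"

text \<open>Leader identifiers serve as the initial colours; they are distinct, hence proper along
  every chosen edge.\<close>

definition pick_dec :: "st \<Rightarrow> (nat \<Rightarrow> nat) \<Rightarrow> st" where
  "pick_dec s S = s\<lparr>pt := (if \<exists>j. 0 < S j then Suc (SOME j. \<forall>i. S i \<le> S j) else 0), cl := ld s, lf := 1\<rparr>"

text \<open>The colour of the target is transmitted as the index of the only counter that becomes
  positive; all counters stay zero if there is no target.\<close>

definition colour_query :: "st \<Rightarrow> st \<Rightarrow> nat \<Rightarrow> nat" where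
  "colour_query s s' j = (if pt s = Suc (ld s') \<and> j = cl s' then 1 else 0)"

definition colour_dec :: "st \<Rightarrow> (nat \<Rightarrow> nat) \<Rightarrow> st" where
  "colour_dec s S = s\<lparr>cl := (if \<exists>j. 0 < S j then cv_step (cl s) (SOME j. 0 < S j) else cl s mod 2)\<rparr>"

text \<open>Counter \<open>0\<close> collects what the cluster gains in the potential as a leaf, counter \<open>1\<close> what it gains
  as a centre.\<close>

definition side_query :: "st \<Rightarrow> st \<Rightarrow> nat \<Rightarrow> nat" where
  "side_query s s' j = (if j = 0 \<and> pt s = Suc (ld s') then 2 - lf s' else 0)
     + (if j = 1 \<and> pt s' = Suc (ld s) then lf s' else 0)"

definition side_dec :: "nat \<Rightarrow> st \<Rightarrow> (nat \<Rightarrow> nat) \<Rightarrow> st" where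
  "side_dec a s S = s\<lparr>lf := (if cl s = a then (if pt s \<noteq> 0 \<and> S 1 \<le> S 0 then 2 else 0) else lf s)\<rparr>"

definition join_query :: "st \<Rightarrow> st \<Rightarrow> nat \<Rightarrow> nat" where
  "join_query s s' j = (if j = 0 \<and> pt s = Suc (ld s') \<and> lf s' = 0 then 1 else 0)"

definition join_dec :: "st \<Rightarrow> (nat \<Rightarrow> nat) \<Rightarrow> st" where
  "join_dec s S = s\<lparr>lf := (if lf s = 2 \<and> 0 < S 0 then 3 else lf s)\<rparr>"

lemma core_queries:
  "core_query count_query" "core_query colour_query" "core_query side_query" "core_query join_query"
  by (simp_all add: core_query_def count_query_def colour_query_def side_query_def join_query_def fun_eq_iff)

lemma core_decs: "core_dec pick_dec" "core_dec colour_dec" "core_dec (side_dec a)" "core_dec join_dec"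
  by (simp_all add: core_dec_def pick_dec_def colour_dec_def side_dec_def join_dec_def core_def)

lemma bounded_queries:
  assumes "2 \<le> N"
  shows "bounded_query k N M count_query" "bounded_query k N M colour_query"
    "bounded_query k N M side_query" "bounded_query k N M join_query"
  using assms
  by (auto simp: bounded_query_def count_query_def colour_query_def side_query_def join_query_def small_def)

lemma argmax_exists:
  fixes S :: "nat \<Rightarrow> nat"
  assumes "\<forall>j\<ge>N. S j = 0"
  shows "\<exists>j. \<forall>i. S i \<le> S j"
proof -
  have "S ` {..N} \<noteq> {}" "finite (S ` {..N})" by auto
  then obtain j where j: "j \<le> N" "S j = Max (S ` {..N})" by (metis Max_in atMost_iff imageE)
  have "S i \<le> S j" for i
  proof (cases "i \<le> N")
    case True
    then show ?thesis unfolding j(2) by simp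
  next
    case False
    then show ?thesis using assms by simp
  qed
  then show ?thesis by blast
qed

lemma small_decs:
  assumes N: "N = 2 ^ b" "0 < b"
  shows "small_dec k N M pick_dec" "small_dec k N M colour_dec" "small_dec k N M (side_dec a)"
    "small_dec k N M join_dec"
proof -
  show "small_dec k N M pick_dec"
    unfolding small_dec_def
  proof (intro allI impI)
    fix s :: st and S :: "nat \<Rightarrow> nat" assume s: "small k N M s" and S: "\<forall>j\<ge>N. S j = 0"
    let ?j = "SOME j. \<forall>i. S i \<le> S j"
    have j: "\<forall>i. S i \<le> S ?j" by (rule someI_ex[OF argmax_exists[OF S]])
    have "?j < N" if "\<exists>j. 0 < S j"
      using that j S by (metis less_le_trans not_less not_less_zero)
    then show "small k N M (pick_dec s S)"
      using s by (cases "\<exists>j. 0 < S j") (simp_all add: pick_dec_def small_def Suc_le_eq del: ex_simps)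
  qed
  have N2: "2 \<le> N" using N by (simp add: self_le_power)
  have b2: "2 * b \<le> 2 ^ b" using Suc_leI[OF less_exp[of "b - 1"]] N(2) by (cases b) auto
  show "small_dec k N M colour_dec"
    unfolding small_dec_def
  proof (intro allI impI)
    fix s :: st and S :: "nat \<Rightarrow> nat" assume s: "small k N M s" and S: "\<forall>j\<ge>N. S j = 0"
    let ?j = "SOME j. 0 < S j"
    have "cv_step (cl s) ?j < N" if "\<exists>j. 0 < S j"
    proof -
      have "0 < S ?j" using that by (rule someI_ex)
      then have "?j < N" using S by (metis not_less not_less_zero)
      then have "cv_step (cl s) ?j < 2 * b" using s N by (intro cv_step_less) (auto simp: small_def)
      then show ?thesis using b2 N(1) by simp
    qed
    moreover have "cl s mod 2 < N" using N2 by (meson less_le_trans mod_less_divisor pos2)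
    ultimately show "small k N M (colour_dec s S)"
      using s by (auto simp: colour_dec_def small_def)
  qed
qed (auto simp: small_dec_def side_dec_def join_dec_def small_def)

lemma sum_delta_mult:
  fixes w :: "'a \<Rightarrow> nat"
  assumes "finite R" "q \<in> R"
  shows "(\<Sum>s\<in>R. w s * (if P \<and> s = q then f s else 0)) = (if P then w q * f q else 0)"
proof -
  have "(\<Sum>s\<in>R. w s * (if P \<and> s = q then f s else 0)) = (\<Sum>s\<in>R. if s = q then (if P then w q * f q else 0) else 0)"
    by (intro sum.cong) auto
  then show ?thesis using assms by simp
qed

text \<open>Two counters are needed for an exact comparison of the two sides, and \<open>N\<close>
  is a power of two so that the identifiers are initial colours of \<open>b\<close> bits.\<close>

locale phase_network = network +
  fixes b :: nat
  assumes k2: "2 \<le> k" and N: "N = 2 ^ b" and b_pos: "0 < b"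
begin

lemma N2: "2 \<le> N" using N b_pos by (simp add: self_le_power)

definition leaders :: "(nat \<Rightarrow> nat) \<Rightarrow> nat set" where
  "leaders l = l ` V"

lemma finite_leaders: "finite (leaders l)" using finite_V by (simp add: leaders_def)

lemma rep_root: "rep D l X s \<Longrightarrow> r \<in> leaders l \<Longrightarrow> ld (X r) = r \<and> small k N M (X r) \<and> r \<in> V"
proof -
  assume rep: "rep D l X s" and "r \<in> leaders l"
  then have r: "r \<in> V" "l r = r" by (auto simp: rep_def rad_def leaders_def)
  then have "core (s r) = X r" "ld (s r) = r" "small k N M (s r)" using rep by (auto simp: rep_def)
  then show ?thesis using small_core r(1) by (metis core_simps(2))
qed

definition picked :: "(nat \<Rightarrow> nat) \<Rightarrow> (nat \<Rightarrow> st) \<Rightarrow> bool" where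
  "picked l X \<longleftrightarrow> (\<forall>r\<in>leaders l. pt (X r) = 0 \<or>
     (\<exists>q\<in>leaders l. q \<noteq> r \<and> pt (X r) = Suc q \<and> 0 < weight l r q))"

lemma picked_target:
  "picked l X \<Longrightarrow> r \<in> leaders l \<Longrightarrow> pt (X r) \<noteq> 0 \<Longrightarrow>
    \<exists>q. q \<in> leaders l \<and> q \<noteq> r \<and> pt (X r) = Suc q \<and> 0 < weight l r q"
  unfolding picked_def by auto

definition out_weight :: "(nat \<Rightarrow> nat) \<Rightarrow> (nat \<Rightarrow> st) \<Rightarrow> nat \<Rightarrow> nat" where
  "out_weight l X r = (if pt (X r) = 0 then 0 else weight l r (pt (X r) - 1))"

text \<open>The chosen edge misses the maximum by at most an error \<open>t\<close> that is charged
  to the boundary weight of the cluster.\<close>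

definition heavy :: "(nat \<Rightarrow> nat) \<Rightarrow> (nat \<Rightarrow> st) \<Rightarrow> bool" where
  "heavy l X \<longleftrightarrow> (\<forall>r\<in>leaders l. \<exists>t. (\<forall>q\<in>leaders l - {r}. weight l r q \<le> out_weight l X r + t) \<and>
     (k + 1) * t \<le> (\<Sum>q\<in>leaders l - {r}. weight l r q))"

definition coloured :: "nat \<Rightarrow> (nat \<Rightarrow> nat) \<Rightarrow> (nat \<Rightarrow> st) \<Rightarrow> bool" where
  "coloured B l X \<longleftrightarrow> (\<forall>r\<in>leaders l. cl (X r) < B \<and> (pt (X r) \<noteq> 0 \<longrightarrow> cl (X r) \<noteq> cl (X (pt (X r) - 1))))"

lemma pick_phase:
  assumes rep: "rep D l X s"
  shows "\<exists>X'. rep D l X' (exec adj (agg k N M D count_query pick_dec) s) \<and> picked l X' \<and> heavy l X' \<and>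
     coloured N l X' \<and> (\<forall>r\<in>leaders l. lf (X' r) = 1)"
proof -
  let ?R = "leaders l"
  let ?W = "\<lambda>r j. \<Sum>q\<in>?R. weight l r q * count_query (X r) (X q) j"
  obtain S where S: "\<forall>r\<in>?R. summary k N (S r) (?W r)"
    and rep': "rep D l (\<lambda>r. core (pick_dec (X r) (S r))) (exec adj (agg k N M D count_query pick_dec) s)"
    using agg_correct[folded leaders_def, OF rep core_queries(1) bounded_queries(1)[OF N2] core_decs(1) small_decs(1)[OF N b_pos]] by blast
  define X' where "X' = (\<lambda>r. core (pick_dec (X r) (S r)))"
  have X': "cl (X' r) = r" "lf (X' r) = 1"
    "pt (X' r) = (if \<exists>j. 0 < S r j then Suc (SOME j. \<forall>i. S r i \<le> S r j) else 0)" if "r \<in> ?R" for r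
    using rep_root[OF rep that] by (auto simp: X'_def pick_dec_def)
  have W: "?W r j = (if j \<in> ?R - {r} then weight l r j else 0)" if r: "r \<in> ?R" for r j
  proof -
    have "?W r j = (\<Sum>q\<in>?R. if q = j then (if j \<noteq> r then weight l r j else 0) else 0)"
      using rep_root[OF rep] r by (intro sum.cong) (auto simp: count_query_def)
    moreover have "(\<Sum>q\<in>?R. if q = j then (if j \<noteq> r then weight l r j else 0) else 0)
        = (if j \<in> ?R then (if j \<noteq> r then weight l r j else 0) else 0)"
      by (rule sum.delta[OF finite_leaders])
    moreover have "\<dots> = (if j \<in> ?R - {r} then weight l r j else 0)"
      by (cases "j \<in> ?R"; cases "j = r") (simp_all only: Diff_iff singleton_iff if_True if_False not_True_eq_False simp_thms)
    ultimately show ?thesis by (rule trans[OF trans])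
  qed
  have main: "(pt (X' r) = 0 \<or> (\<exists>q\<in>?R. q \<noteq> r \<and> pt (X' r) = Suc q \<and> 0 < weight l r q)) \<and>
    (\<exists>t. (\<forall>q\<in>?R - {r}. weight l r q \<le> out_weight l X' r + t) \<and>
     (k + 1) * t \<le> (\<Sum>q\<in>?R - {r}. weight l r q))" if r: "r \<in> ?R" for r
  proof -
    obtain t where t: "\<forall>j\<ge>N. S r j = 0" "\<forall>j<N. S r j \<le> ?W r j \<and> ?W r j \<le> S r j + t"
      "(\<Sum>j<N. S r j) + (k + 1) * t \<le> (\<Sum>j<N. ?W r j)"
      using S r unfolding summary_def by blast
    have RN: "q < N" if "q \<in> ?R" for q using rep_root[OF rep that] V_less by blast
    have "(\<Sum>j<N. ?W r j) = (\<Sum>j\<in>?R - {r}. ?W r j)"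
      using W[OF r] RN by (intro sum.mono_neutral_right) auto
    also have "\<dots> = (\<Sum>j\<in>?R - {r}. weight l r j)" using W[OF r] by (intro sum.cong) auto
    finally have tk: "(k + 1) * t \<le> (\<Sum>j\<in>?R - {r}. weight l r j)" using t(3) by simp
    let ?j = "SOME j. \<forall>i. S r i \<le> S r j"
    have j: "\<forall>i. S r i \<le> S r ?j" by (rule someI_ex[OF argmax_exists[OF t(1)]])
    show ?thesis
    proof (cases "\<exists>j. 0 < S r j")
      case True
      then have pos: "0 < S r ?j" using j by (metis less_le_trans)
      then have "?j < N" using t(1) by (metis not_less not_less_zero)
      then have le: "S r ?j \<le> ?W r ?j" using t(2) by blast
      then have "?W r ?j \<noteq> 0" using pos by linarith
      then have jR: "?j \<in> ?R" "?j \<noteq> r" "?W r ?j = weight l r ?j" using W[OF r] by (auto split: if_splits)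
      have pt: "pt (X' r) = Suc ?j" using X'(3)[OF r] True by simp
      have "weight l r q \<le> out_weight l X' r + t" if "q \<in> ?R - {r}" for q
      proof -
        have "weight l r q = ?W r q" using W[OF r, of q] that by simp
        also have "\<dots> \<le> S r q + t" using t(2) RN that by blast
        also have "\<dots> \<le> S r ?j + t" using j by simp
        also have "\<dots> \<le> weight l r ?j + t" using le jR(3) by simp
        finally show ?thesis using pt by (simp add: out_weight_def)
      qed
      moreover have "0 < weight l r ?j" using le jR(3) pos by linarith
      ultimately show ?thesis using jR(1,2) pt tk by blast
    next
      \<comment> \<open>Trimming may erase every counter, so a cluster with neighbours can end up
        without a target. All its boundary weights are then at most \<open>t\<close>, and the value
        \<open>0\<close> of \<open>out_weight\<close> still satisfies the bound.\<close>
      case False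
      have "weight l r q \<le> out_weight l X' r + t" if "q \<in> ?R - {r}" for q
      proof -
        have "weight l r q = ?W r q" using W[OF r, of q] that by simp
        also have "\<dots> \<le> S r q + t" using t(2) RN that by blast
        finally show ?thesis using False by simp
      qed
      moreover have "pt (X' r) = 0" using X'(3)[OF r] False by simp
      ultimately show ?thesis using tk by blast
    qed
  qed
  have "coloured N l X'"
    unfolding coloured_def
  proof (intro ballI conjI impI)
    fix r assume r: "r \<in> ?R"
    show "cl (X' r) < N" using X'(1)[OF r] rep_root[OF rep r] V_less by auto
    assume "pt (X' r) \<noteq> 0"
    then obtain q where "q \<in> ?R" "q \<noteq> r" "pt (X' r) = Suc q" using conjunct1[OF main[OF r]] by auto
    then show "cl (X' r) \<noteq> cl (X' (pt (X' r) - 1))" using X'(1) r by simp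
  qed
  moreover have "picked l X'" "heavy l X'" using main unfolding picked_def heavy_def by blast+
  ultimately show ?thesis using rep' X'(2) unfolding X'_def[symmetric] by blast
qed

lemma colour_phase:
  assumes rep: "rep D l X s" and p: "picked l X" and col: "coloured (2 ^ B) l X" "0 < B"
  shows "\<exists>X'. rep D l X' (exec adj (agg k N M D colour_query colour_dec) s) \<and>
     coloured (2 * B) l X' \<and> (\<forall>r\<in>leaders l. lf (X' r) = lf (X r) \<and> pt (X' r) = pt (X r))"
proof -
  let ?R = "leaders l"
  let ?W = "\<lambda>r j. \<Sum>q\<in>?R. weight l r q * colour_query (X r) (X q) j"
  obtain S where S: "\<forall>r\<in>?R. summary k N (S r) (?W r)"
    and rep': "rep D l (\<lambda>r. core (colour_dec (X r) (S r))) (exec adj (agg k N M D colour_query colour_dec) s)"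
    using agg_correct[folded leaders_def, OF rep core_queries(2) bounded_queries(2)[OF N2] core_decs(2) small_decs(2)[OF N b_pos]] by blast
  define X' where "X' = (\<lambda>r. core (colour_dec (X r) (S r)))"
  have X': "lf (X' r) = lf (X r)" "pt (X' r) = pt (X r)"
    "cl (X' r) = (if \<exists>j. 0 < S r j then cv_step (cl (X r)) (SOME j. 0 < S r j) else cl (X r) mod 2)" for r
    by (simp_all add: X'_def colour_dec_def)
  have none: "cl (X' r) = cl (X r) mod 2" if r: "r \<in> ?R" "pt (X r) = 0" for r
  proof -
    have "?W r j = 0" for j using r(2) by (simp add: colour_query_def)
    then have "S r j = 0" for j using S r(1) unfolding summary_def by (metis le_zero_eq not_less)
    then show ?thesis using X'(3) by simp
  qed
  have some: "cl (X' r) = cv_step (cl (X r)) (cl (X q))"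
    if r: "r \<in> ?R" "pt (X r) = Suc q" "q \<in> ?R" "0 < weight l r q" for r q
  proof -
    have W: "?W r j = (if j = cl (X q) then weight l r q else 0)" for j
    proof -
      have "?W r j = (\<Sum>s\<in>?R. weight l r s * (if j = cl (X q) \<and> s = q then 1 else 0))"
        using rep_root[OF rep] r by (intro sum.cong) (auto simp: colour_query_def)
      then show ?thesis using sum_delta_mult[OF finite_leaders r(3), of "weight l r" "j = cl (X q)" "\<lambda>_. 1"] by simp
    qed
    have "{j. j < N \<and> ?W r j \<noteq> 0} \<subseteq> {cl (X q)}" using W by (auto split: if_splits)
    then have "card {j. j < N \<and> ?W r j \<noteq> 0} \<le> card {cl (X q)}" by (intro card_mono) auto
    then have card: "card {j. j < N \<and> ?W r j \<noteq> 0} \<le> k" using k2 by simp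
    have eq: "S r j = ?W r j" if "j < N" for j using S r(1) summary_exact[OF _ card that] by blast
    have qN: "cl (X q) < N" using rep_root[OF rep r(3)] by (simp add: small_def)
    have "0 < S r j \<longleftrightarrow> j = cl (X q)" for j
    proof (cases "j < N")
      case True
      then show ?thesis using eq W r(4) by simp
    next
      case False
      then show ?thesis using S r(1) qN by (auto simp: summary_def)
    qed
    then show ?thesis using X'(3)[of r] by simp
  qed
  have "coloured (2 * B) l X'"
    unfolding coloured_def
  proof (intro ballI conjI impI)
    fix r assume r: "r \<in> ?R"
    show "cl (X' r) < 2 * B"
    proof (cases "pt (X r) = 0")
      case True
      then show ?thesis using none[OF r] col(2) by (simp add: less_le_trans[of _ 2])
    next
      case False
      then obtain q where q: "q \<in> ?R" "pt (X r) = Suc q" "0 < weight l r q" using picked_target[OF p r False] by blast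
      then show ?thesis using some[OF r q(2,1,3)] col r by (auto simp: coloured_def intro: cv_step_less)
    qed
    assume "pt (X' r) \<noteq> 0"
    then obtain q where q: "q \<in> ?R" "pt (X r) = Suc q" "0 < weight l r q"
      using p r X'(2) unfolding picked_def by metis
    have rq: "cl (X r) \<noteq> cl (X q)" using col(1) r q(2) by (auto simp: coloured_def)
    show "cl (X' r) \<noteq> cl (X' (pt (X' r) - 1))"
    proof (cases "pt (X q) = 0")
      case True
      then show ?thesis using some[OF r q(2,1,3)] none[OF q(1)] cv_step_proper_root[OF rq] X'(2) q(2) by simp
    next
      case False
      then obtain q' where q': "q' \<in> ?R" "pt (X q) = Suc q'" "0 < weight l q q'" using picked_target[OF p q(1) False] by blast
      then have "cl (X q) \<noteq> cl (X q')" using col(1) q(1) by (auto simp: coloured_def)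
      then show ?thesis
        using some[OF r q(2,1,3)] some[OF q(1) q'(2,1,3)] cv_step_proper[OF rq] X'(2) q(2) by simp
    qed
  qed
  then show ?thesis using rep' X'(1,2) unfolding X'_def[symmetric] by blast
qed

definition half_sided :: "nat \<Rightarrow> (nat \<Rightarrow> nat) \<Rightarrow> (nat \<Rightarrow> st) \<Rightarrow> bool" where
  "half_sided a l X \<longleftrightarrow> (\<forall>r\<in>leaders l. if cl (X r) < a then lf (X r) = 0 \<or> lf (X r) = 2 else lf (X r) = 1)"

abbreviation potential :: "(nat \<Rightarrow> nat) \<Rightarrow> (nat \<Rightarrow> st) \<Rightarrow> int" where
  "potential l X \<equiv> leaf_potential (leaders l) (\<lambda>r. pt (X r)) (\<lambda>r. int (out_weight l X r)) (\<lambda>r. int (lf (X r)))"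

text \<open>Clusters of one colour are never joined by a chosen edge, so they may decide
  simultaneously. Their two counters are exact, hence comparing them gives the sign demanded by
  \<open>leaf_potential_step\<close>.\<close>

lemma side_phase:
  assumes rep: "rep D l X s" and p: "picked l X" and col: "coloured B l X" and h: "half_sided a l X"
  shows "\<exists>X'. rep D l X' (exec adj (agg k N M D side_query (side_dec a)) s) \<and>
     half_sided (Suc a) l X' \<and> potential l X \<le> potential l X' \<and>
     (\<forall>r\<in>leaders l. cl (X' r) = cl (X r) \<and> pt (X' r) = pt (X r))"
proof -
  let ?R = "leaders l"
  let ?W = "\<lambda>r j. \<Sum>q\<in>?R. weight l r q * side_query (X r) (X q) j"
  obtain S where S: "\<forall>r\<in>?R. summary k N (S r) (?W r)"
    and rep': "rep D l (\<lambda>r. core (side_dec a (X r) (S r))) (exec adj (agg k N M D side_query (side_dec a)) s)"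
    using agg_correct[folded leaders_def, OF rep core_queries(3) bounded_queries(3)[OF N2] core_decs(3) small_decs(3)[OF N b_pos]] by blast
  define X' where "X' = (\<lambda>r. core (side_dec a (X r) (S r)))"
  have X': "cl (X' r) = cl (X r)" "pt (X' r) = pt (X r)"
    "lf (X' r) = (if cl (X r) = a then (if pt (X r) \<noteq> 0 \<and> S r 1 \<le> S r 0 then 2 else 0) else lf (X r))" for r
    by (simp_all add: X'_def side_dec_def)
  have lf2: "lf (X r) \<le> 2" if "r \<in> ?R" for r
    using h that unfolding half_sided_def by (metis dual_order.refl le0 one_le_numeral)
  have S0: "S r 0 = (if pt (X r) = 0 then 0 else out_weight l X r * (2 - lf (X (pt (X r) - 1))))"
    and S1: "S r 1 = (\<Sum>u\<in>{u \<in> ?R. pt (X u) = Suc r}. out_weight l X u * lf (X u))" if r: "r \<in> ?R" for r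
  proof -
    have "{j. j < N \<and> ?W r j \<noteq> 0} \<subseteq> {0, 1}" by (rule subsetI, rule ccontr) (simp add: side_query_def)
    then have "card {j. j < N \<and> ?W r j \<noteq> 0} \<le> card {0, 1 :: nat}" by (intro card_mono) auto
    then have card: "card {j. j < N \<and> ?W r j \<noteq> 0} \<le> k" using k2 by simp
    have eq: "S r j = ?W r j" if "j < N" for j using S r summary_exact[OF _ card that] by blast
    show "S r 0 = (if pt (X r) = 0 then 0 else out_weight l X r * (2 - lf (X (pt (X r) - 1))))"
    proof (cases "pt (X r) = 0")
      case True
      then show ?thesis using eq N2 by (simp add: side_query_def)
    next
      case False
      then obtain q where q: "q \<in> ?R" "pt (X r) = Suc q" using picked_target[OF p r False] by blast
      have "?W r 0 = (\<Sum>s\<in>?R. weight l r s * (if True \<and> s = q then 2 - lf (X s) else 0))"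
        using rep_root[OF rep] q(2) by (intro sum.cong) (auto simp: side_query_def)
      also have "\<dots> = weight l r q * (2 - lf (X q))"
        by (subst sum_delta_mult[OF finite_leaders q(1)]) simp
      finally show ?thesis using eq[of 0] N2 q(2) by (simp add: out_weight_def)
    qed
    have N1: "1 < N" using N2 by simp
    \<comment> \<open>An edge chosen by \<open>u\<close> is counted here from its target
      \<open>r\<close>; symmetry of \<open>weight\<close> identifies it with the outgoing weight of
      \<open>u\<close>.\<close>
    have "S r 1 = (\<Sum>u\<in>?R. if pt (X u) = Suc r then out_weight l X u * lf (X u) else 0)"
      unfolding eq[OF N1]
    proof (intro sum.cong refl)
      fix u assume "u \<in> ?R"
      then show "weight l r u * side_query (X r) (X u) 1 = (if pt (X u) = Suc r then out_weight l X u * lf (X u) else 0)"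
        using rep_root[OF rep r] weight_sym[of l r u] by (simp add: side_query_def out_weight_def)
    qed
    then show "S r 1 = (\<Sum>u\<in>{u \<in> ?R. pt (X u) = Suc r}. out_weight l X u * lf (X u))"
      unfolding sum.inter_filter[OF finite_leaders] .
  qed
  have half: "half_sided (Suc a) l X'"
    using h unfolding half_sided_def X' by (auto simp: less_Suc_eq)
  \<comment> \<open>The new sides are patched by the old ones outside the leaders, since the step
    lemma requires agreement on all indices outside the colour class.\<close>
  have "leaf_potential ?R (\<lambda>r. pt (X r)) (\<lambda>r. int (out_weight l X r)) (\<lambda>r. int (lf (X r)))
    \<le> leaf_potential ?R (\<lambda>r. pt (X r)) (\<lambda>r. int (out_weight l X r)) (\<lambda>r. int (if r \<in> ?R then lf (X' r) else lf (X r)))"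
  proof (rule leaf_potential_step[where A = "{r \<in> ?R. cl (X r) = a}"])
    fix r assume r: "r \<in> {r \<in> ?R. cl (X r) = a}"
    show "int (lf (X r)) = 1" using h r unfolding half_sided_def by auto
    have 0: "int (S r 0) = (if pt (X r) = 0 then 0 else int (out_weight l X r) * (2 - int (lf (X (pt (X r) - 1)))))"
    proof (cases "pt (X r) = 0")
      case False
      then obtain q where "q \<in> ?R" "pt (X r) = Suc q" using picked_target[OF p _ False] r by blast
      then show ?thesis using S0 r lf2[of q] by (simp add: of_nat_diff)
    qed (use S0 r in simp)
    have 1: "int (S r 1) = (\<Sum>u\<in>{u \<in> ?R. pt (X u) = Suc r}. int (out_weight l X u) * int (lf (X u)))"
      using S1 r by simp
    show "0 \<le> (int (if r \<in> ?R then lf (X' r) else lf (X r)) - 1) *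
        ((if pt (X r) = 0 then 0 else int (out_weight l X r) * (2 - int (lf (X (pt (X r) - 1)))))
         - (\<Sum>u\<in>{u \<in> ?R. pt (X u) = Suc r}. int (out_weight l X u) * int (lf (X u))))"
      unfolding 0[symmetric] 1[symmetric]
    proof (cases "pt (X r) \<noteq> 0 \<and> S r 1 \<le> S r 0")
      case True
      then show "0 \<le> (int (if r \<in> ?R then lf (X' r) else lf (X r)) - 1) * (int (S r 0) - int (S r 1))"
        using r X'(3) by simp
    next
      case False
      then have "S r 0 \<le> S r 1" using S0 r by auto
      then show "0 \<le> (int (if r \<in> ?R then lf (X' r) else lf (X r)) - 1) * (int (S r 0) - int (S r 1))"
        using r X'(3)[of r] False by simp
    qed
    assume "pt (X r) \<noteq> 0"
    then show "pt (X r) - 1 \<notin> {r \<in> ?R. cl (X r) = a}" using col r by (auto simp: coloured_def)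
  next
    fix r assume "r \<notin> {r \<in> ?R. cl (X r) = a}"
    then show "int (if r \<in> ?R then lf (X' r) else lf (X r)) = int (lf (X r))" using X'(3) by auto
  qed (use finite_leaders in auto)
  also have "\<dots> = potential l X'"
    unfolding leaf_potential_def
  proof (intro sum.cong refl)
    fix r assume r: "r \<in> ?R"
    have "pt (X r) \<noteq> 0 \<Longrightarrow> pt (X r) - 1 \<in> ?R" using p r unfolding picked_def by fastforce
    then show "(if pt (X r) = 0 then 0 else int (out_weight l X r) * int (if r \<in> ?R then lf (X' r) else lf (X r))
          * (2 - int (if pt (X r) - 1 \<in> ?R then lf (X' (pt (X r) - 1)) else lf (X (pt (X r) - 1)))))
      = (if pt (X' r) = 0 then 0 else int (out_weight l X' r) * int (lf (X' r)) * (2 - int (lf (X' (pt (X' r) - 1)))))"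
      using r X'(2) by (simp add: out_weight_def)
  qed
  finally show ?thesis using rep' half X'(1,2) unfolding X'_def[symmetric] by blast
qed

lemma join_phase:
  assumes rep: "rep D l X s" and p: "picked l X"
  shows "\<exists>X'. rep D l X' (exec adj (agg k N M D join_query join_dec) s) \<and>
     (\<forall>r\<in>leaders l. pt (X' r) = pt (X r) \<and>
        lf (X' r) = (if lf (X r) = 2 \<and> pt (X r) \<noteq> 0 \<and> lf (X (pt (X r) - 1)) = 0 then 3 else lf (X r)))"
proof -
  let ?R = "leaders l"
  let ?W = "\<lambda>r j. \<Sum>q\<in>?R. weight l r q * join_query (X r) (X q) j"
  obtain S where S: "\<forall>r\<in>?R. summary k N (S r) (?W r)"
    and rep': "rep D l (\<lambda>r. core (join_dec (X r) (S r))) (exec adj (agg k N M D join_query join_dec) s)"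
    using agg_correct[folded leaders_def, OF rep core_queries(4) bounded_queries(4)[OF N2] core_decs(4) small_decs(4)[OF N b_pos]] by blast
  define X' where "X' = (\<lambda>r. core (join_dec (X r) (S r)))"
  have X': "pt (X' r) = pt (X r)" "lf (X' r) = (if lf (X r) = 2 \<and> 0 < S r 0 then 3 else lf (X r))" for r
    by (simp_all add: X'_def join_dec_def)
  have S0: "0 < S r 0 \<longleftrightarrow> pt (X r) \<noteq> 0 \<and> lf (X (pt (X r) - 1)) = 0" if r: "r \<in> ?R" for r
  proof -
    have "{j. j < N \<and> ?W r j \<noteq> 0} \<subseteq> {0}" by (rule subsetI, rule ccontr) (simp add: join_query_def)
    then have "card {j. j < N \<and> ?W r j \<noteq> 0} \<le> card {0 :: nat}" by (intro card_mono) auto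
    then have card: "card {j. j < N \<and> ?W r j \<noteq> 0} \<le> k" using k2 by simp
    have eq: "S r 0 = ?W r 0" using S r summary_exact[OF _ card, of "S r" 0] N2 by auto
    show ?thesis
    proof (cases "pt (X r) = 0")
      case True
      then show ?thesis using eq by (simp add: join_query_def)
    next
      case False
      then obtain q where q: "q \<in> ?R" "pt (X r) = Suc q" "0 < weight l r q" using picked_target[OF p r False] by blast
      have "?W r 0 = (\<Sum>s\<in>?R. weight l r s * (if lf (X q) = 0 \<and> s = q then 1 else 0))"
        using rep_root[OF rep] q(2) by (intro sum.cong) (auto simp: join_query_def)
      also have "\<dots> = (if lf (X q) = 0 then weight l r q * 1 else 0)"
        by (rule sum_delta_mult[OF finite_leaders q(1)])
      finally show ?thesis using eq q by simp
    qed
  qed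
  show ?thesis using rep' X' S0 unfolding X'_def[symmetric] by (intro exI[of _ X']) simp
qed

end

section \<open>Merging clusters\<close>

definition phase :: "nat \<Rightarrow> nat \<Rightarrow> nat \<Rightarrow> nat \<Rightarrow> nat \<Rightarrow> round list" where
  "phase k N M T D = replicate D bfs_round @ agg k N M D count_query pick_dec
     @ concat (replicate T (agg k N M D colour_query colour_dec))
     @ concat (map (\<lambda>a. agg k N M D side_query (side_dec a)) [0..<6])
     @ agg k N M D join_query join_dec @ [merge_round]"

lemma relpow_sym: "sym R \<Longrightarrow> (a, b) \<in> R ^^ n \<Longrightarrow> (b, a) \<in> R ^^ n"
proof (induction n arbitrary: a)
  case (Suc n)
  then obtain c where "(a, c) \<in> R" "(c, b) \<in> R ^^ n" by (meson relpow_Suc_D2)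
  then show ?case using Suc by (meson relpow_Suc_I symD)
qed simp

lemma relpow_subset:
  fixes R S :: "('a \<times> 'a) set"
  assumes "R \<subseteq> S"
  shows "(a, b) \<in> R ^^ n \<Longrightarrow> (a, b) \<in> S ^^ n"
proof (induction n arbitrary: b)
  case (Suc n)
  then obtain c where "(a, c) \<in> R ^^ n" "(c, b) \<in> R" by (meson relpow_Suc_E)
  then show ?case using Suc.IH assms by (meson relpow_Suc_I subsetD)
qed simp

lemma relpow_compose: "(a, b) \<in> R ^^ m \<Longrightarrow> (b, c) \<in> R ^^ n \<Longrightarrow> (a, c) \<in> R ^^ (m + n)"
  by (auto simp: relpow_add)

lemma cv_bits_pos: "0 < b \<Longrightarrow> 0 < cv_bits b"
  using cv_bits_ge[of b] by (cases "cv_bits b") auto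

context phase_network
begin

definition start :: "nat \<Rightarrow> (nat \<Rightarrow> nat) \<Rightarrow> (nat \<Rightarrow> st) \<Rightarrow> bool" where
  "start D l s \<longleftrightarrow> rad D l \<and> (\<forall>v\<in>V. s v =
     \<lparr>ld = l v, pt = 0, cl = 0, lf = 0, par = (if l v = v then Suc v else 0), sm = \<lambda>_. 0\<rparr>)"

lemma start_small:
  assumes "start D l s" "v \<in> V"
  shows "small k N M (s v)"
proof -
  have "l v < N" "v < N" using assms V_less by (auto simp: start_def rad_def)
  then show ?thesis using assms by (auto simp: start_def small_def)
qed

lemma bfs_phase:
  assumes "start D l s"
  shows "\<exists>X. rep D l X (exec adj (replicate D bfs_round) s)"
proof -
  let ?s = "exec adj (replicate D bfs_round) s"
  have rad: "rad D l" using assms by (simp add: start_def)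
  have s: "ld (s v) = l v" "par (s v) = (if l v = v then Suc v else 0)"
    "core (s v) = \<lparr>ld = l v, pt = 0, cl = 0, lf = 0, par = 0, sm = \<lambda>_. 0\<rparr>" "sm (s v) = (\<lambda>_. 0)" if "v \<in> V" for v
    using assms that by (auto simp: start_def core_def)
  have t1: "\<exists>dep. tree D l (\<lambda>v. par (?s v)) dep"
    by (rule bfs_tree(1)[OF rad _ _ refl]) (simp_all add: s)
  have t2: "?s v = (s v)\<lparr>par := par (?s v)\<rparr>" if "v \<in> V" for v
    by (rule bfs_tree(2)[OF rad _ _ refl that]) (simp_all add: s)
  have eq: "core (?s v) = core (s v) \<and> ld (?s v) = ld (s v) \<and> sm (?s v) = sm (s v)" if "v \<in> V" for v
  proof -
    from t2[OF that] obtain p where "?s v = (s v)\<lparr>par := p\<rparr>" by blast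
    then show ?thesis by simp
  qed
  have sm: "small k N M (?s v)" if "v \<in> V" for v
  proof (rule small_exec[OF _ adj_V V_less _ that])
    fix F assume "F \<in> set (replicate D bfs_round)"
    then show "small_round k N M F" using small_rounds(1) by (metis in_set_replicate)
  qed (auto intro: start_small[OF assms])
  show ?thesis
    unfolding rep_def
    using t1 rad s eq sm
    by (intro exI[of _ "\<lambda>r. \<lparr>ld = r, pt = 0, cl = 0, lf = 0, par = 0, sm = \<lambda>_. 0\<rparr>"] conjI ballI) simp_all
qed

lemma picked_cong: "picked l X \<Longrightarrow> (\<And>r. r \<in> leaders l \<Longrightarrow> pt (X' r) = pt (X r)) \<Longrightarrow> picked l X'"
  by (simp add: picked_def)

lemma colour_phases:
  assumes "rep D l X s" "picked l X" "coloured (2 ^ B) l X" "0 < B"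
  shows "\<exists>X'. rep D l X' (exec adj (concat (replicate T (agg k N M D colour_query colour_dec))) s) \<and>
     coloured (2 ^ (cv_bits ^^ T) B) l X' \<and> (\<forall>r\<in>leaders l. lf (X' r) = lf (X r) \<and> pt (X' r) = pt (X r))"
  using assms
proof (induction T arbitrary: X s B)
  case 0
  then show ?case by auto
next
  case (Suc T)
  obtain X1 where X1: "rep D l X1 (exec adj (agg k N M D colour_query colour_dec) s)"
     "coloured (2 * B) l X1" "\<forall>r\<in>leaders l. lf (X1 r) = lf (X r) \<and> pt (X1 r) = pt (X r)"
    using colour_phase[OF Suc.prems] by blast
  have "picked l X1" using picked_cong[OF Suc.prems(2)] X1(3) by simp
  moreover have "coloured (2 ^ cv_bits B) l X1"
    using X1(2) cv_bits_ge[of B] unfolding coloured_def by (meson less_le_trans)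
  ultimately obtain X2 where "rep D l X2 (exec adj (concat (replicate T (agg k N M D colour_query colour_dec)))
       (exec adj (agg k N M D colour_query colour_dec) s))"
     "coloured (2 ^ (cv_bits ^^ T) (cv_bits B)) l X2" "\<forall>r\<in>leaders l. lf (X2 r) = lf (X1 r) \<and> pt (X2 r) = pt (X1 r)"
    using Suc.IH[OF X1(1)] cv_bits_pos[OF Suc.prems(4)] by blast
  then show ?case using X1(3) by (intro exI[of _ X2]) (simp add: funpow_swap1)
qed

lemma side_phases:
  assumes "rep D l X s" "picked l X" "coloured B l X" "half_sided a l X"
  shows "\<exists>X'. rep D l X' (exec adj (concat (map (\<lambda>a. agg k N M D side_query (side_dec a)) [a..<a + m])) s) \<and>
     half_sided (a + m) l X' \<and> potential l X \<le> potential l X' \<and>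
     (\<forall>r\<in>leaders l. cl (X' r) = cl (X r) \<and> pt (X' r) = pt (X r))"
  using assms
proof (induction m arbitrary: X s a)
  case 0
  then show ?case by auto
next
  case (Suc m)
  obtain X1 where X1: "rep D l X1 (exec adj (agg k N M D side_query (side_dec a)) s)"
     "half_sided (Suc a) l X1" "potential l X \<le> potential l X1"
     "\<forall>r\<in>leaders l. cl (X1 r) = cl (X r) \<and> pt (X1 r) = pt (X r)"
    using side_phase[OF Suc.prems] by blast
  have p: "picked l X1" using picked_cong[OF Suc.prems(2)] X1(4) by simp
  have c: "coloured B l X1"
    unfolding coloured_def
  proof (intro ballI conjI impI)
    fix r assume r: "r \<in> leaders l"
    show "cl (X1 r) < B" using X1(4) Suc.prems(3) r by (simp add: coloured_def)
    assume "pt (X1 r) \<noteq> 0"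
    then obtain q where "q \<in> leaders l" "pt (X1 r) = Suc q" using picked_target[OF p r] by blast
    then show "cl (X1 r) \<noteq> cl (X1 (pt (X1 r) - 1))" using X1(4) Suc.prems(3) r by (fastforce simp: coloured_def)
  qed
  obtain X2 where "rep D l X2 (exec adj (concat (map (\<lambda>a. agg k N M D side_query (side_dec a)) [Suc a..<Suc a + m]))
        (exec adj (agg k N M D side_query (side_dec a)) s))"
     "half_sided (Suc a + m) l X2" "potential l X1 \<le> potential l X2"
     "\<forall>r\<in>leaders l. cl (X2 r) = cl (X1 r) \<and> pt (X2 r) = pt (X1 r)"
    using Suc.IH[OF X1(1) p c X1(2)] by blast
  moreover have "[a..<a + Suc m] = a # [Suc a..<Suc a + m]" by (simp add: upt_conv_Cons)
  ultimately show ?case using X1(3,4) by (intro exI[of _ X2]) simp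
qed

text \<open>Ordered pairs are counted, so every cut edge contributes twice.\<close>

definition cut :: "(nat \<Rightarrow> nat) \<Rightarrow> nat" where
  "cut l = card {(x, y). adj x y \<and> l x \<noteq> l y}"

lemma cut_eq_weights: "cut l = (\<Sum>r\<in>leaders l. \<Sum>s\<in>leaders l - {r}. weight l r s)"
proof -
  let ?I = "Sigma (leaders l) (\<lambda>r. leaders l - {r})"
  let ?A = "\<lambda>z. {(x, y). adj x y \<and> l x = fst z \<and> l y = snd z}"
  have "{(x, y). adj x y \<and> l x \<noteq> l y} = (\<Union>z\<in>?I. ?A z)"
    using adj_V by (fastforce simp: leaders_def)
  then have "cut l = card (\<Union>z\<in>?I. ?A z)" by (simp only: cut_def)
  moreover have "card (\<Union>z\<in>?I. ?A z) = (\<Sum>z\<in>?I. card (?A z))"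
    using finite_leaders finite_adj by (intro card_UN_disjoint) fastforce+
  moreover have "(\<Sum>z\<in>?I. card (?A z)) = (\<Sum>(r, s)\<in>?I. weight l r s)"
    by (intro sum.cong refl) (simp only: weight_def split_beta)
  moreover have "(\<Sum>r\<in>leaders l. \<Sum>s\<in>leaders l - {r}. weight l r s) = (\<Sum>(r, s)\<in>?I. weight l r s)"
    by (intro sum.Sigma ballI finite_Diff finite_leaders)
  ultimately show ?thesis by metis
qed

text \<open>No target joins another cluster itself, so merging produces stars and no chains:
  \<open>l'\<close> is idempotent and radii at most triple, plus one. Every chosen edge of a joining
  cluster becomes internal in both orders, hence the factor \<open>2\<close>.\<close>

lemma merge_clusters:
  assumes rep: "rep D l X s"
    and target: "\<And>r. r \<in> leaders l \<Longrightarrow> lf (X r) = 3 \<Longrightarrow>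
      \<exists>q. q \<in> leaders l \<and> pt (X r) = Suc q \<and> 0 < weight l r q \<and> lf (X q) \<noteq> 3"
  defines "l' v \<equiv> (if lf (X (l v)) = 3 then pt (X (l v)) - 1 else l v)"
  shows "start (3 * D + 1) l' (step adj merge_round s)"
    "cut l' + 2 * (\<Sum>r\<in>{r\<in>leaders l. lf (X r) = 3}. out_weight l X r) \<le> cut l"
proof -
  have rad: "rad D l" using rep by (simp add: rep_def)
  let ?J = "{r\<in>leaders l. lf (X r) = 3}"
  have lead: "l v \<in> leaders l" if "v \<in> V" for v using that by (simp add: leaders_def)
  have fix_l: "l q = q \<and> q \<in> V" if "q \<in> leaders l" for q using that rad by (auto simp: leaders_def rad_def)
  have mono: "rel l \<subseteq> rel l'" by (auto simp: rel_def l'_def)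
  have sym: "sym (rel l')" using adj_sym by (auto simp: rel_def sym_def)
  have path: "\<exists>m\<le>D. (l v, v) \<in> rel l' ^^ m" if "v \<in> V" for v
    using rad that relpow_subset[OF mono] unfolding rad_def by meson
  have "rad (3 * D + 1) l'"
    unfolding rad_def
  proof (intro ballI)
    fix v assume v: "v \<in> V"
    obtain m1 where m1: "m1 \<le> D" "(l v, v) \<in> rel l' ^^ m1" using path[OF v] by blast
    show "l' v \<in> V \<and> l' (l' v) = l' v \<and> (\<exists>m\<le>3 * D + 1. (l' v, v) \<in> rel l' ^^ m)"
    proof (cases "lf (X (l v)) = 3")
      case False
      then have "l' v = l v" "l' (l v) = l v" using fix_l[OF lead[OF v]] by (simp_all add: l'_def)
      then show ?thesis using m1 fix_l[OF lead[OF v]] by (metis add_increasing2 le_add2 le_trans mult_2 numeral_3_eq_3 add_leD1 mult_Suc zero_le_one)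
    next
      case True
      then obtain q where q: "q \<in> leaders l" "pt (X (l v)) = Suc q" "0 < weight l (l v) q" "lf (X q) \<noteq> 3"
        using target[OF lead[OF v]] by blast
      have l'v: "l' v = q" using True q by (simp add: l'_def)
      have l'q: "l' q = q" using fix_l[OF q(1)] q(4) by (simp add: l'_def)
      have "{(x, y). adj x y \<and> l x = l v \<and> l y = q} \<noteq> {}" using q(3) unfolding weight_def by (metis card.empty less_irrefl)
      then obtain x y where xy: "adj x y" "l x = l v" "l y = q" by blast
      have V: "x \<in> V" "y \<in> V" using xy(1) adj_V by blast+
      obtain m2 where m2: "m2 \<le> D" "(q, y) \<in> rel l' ^^ m2" using path[OF V(2)] xy(3) by blast
      obtain m3 where m3: "m3 \<le> D" "(l v, x) \<in> rel l' ^^ m3" using path[OF V(1)] xy(2) by metis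
      have "l' x = q" "l' y = q" using True q xy by (simp_all add: l'_def)
      then have "(y, x) \<in> rel l' ^^ 1" using adj_sym[OF xy(1)] by (simp add: rel_def)
      \<comment> \<open>From the centre to the boundary node \<open>y\<close>, across to
        \<open>x\<close>, back to the old leader, and from there to \<open>v\<close>.\<close>
      then have "(q, v) \<in> rel l' ^^ (m2 + 1 + m3 + m1)"
        using m2 relpow_sym[OF sym m3(2)] m1(2) relpow_compose by metis
      moreover have "m2 + 1 + m3 + m1 \<le> 3 * D + 1" using m1 m2 m3 by simp
      ultimately have "\<exists>m\<le>3 * D + 1. (q, v) \<in> rel l' ^^ m" by blast
      then show ?thesis unfolding l'v l'q using fix_l[OF q(1)] by blast
    qed
  qed
  moreover have "step adj merge_round s v =
     \<lparr>ld = l' v, pt = 0, cl = 0, lf = 0, par = (if l' v = v then Suc v else 0), sm = \<lambda>_. 0\<rparr>" if "v \<in> V" for v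
  proof -
    have "core (s v) = X (l v)" "ld (s v) = l v" using rep that by (auto simp: rep_def)
    then have "lf (s v) = lf (X (l v))" "pt (s v) = pt (X (l v))" by (metis core_simps(3,5))+
    then have "(if lf (s v) = 3 then pt (s v) - 1 else ld (s v)) = l' v"
      using \<open>ld (s v) = l v\<close> unfolding l'_def by simp
    then show ?thesis by (simp only: step_def merge_round_def Let_def)
  qed
  ultimately show "start (3 * D + 1) l' (step adj merge_round s)" by (simp add: start_def)
  define A where "A r = {(x, y). adj x y \<and> l x = r \<and> l y = pt (X r) - 1}" for r
  define A' where "A' r = {(x, y). adj x y \<and> l y = r \<and> l x = pt (X r) - 1}" for r
  have fin: "finite (A r)" "finite (A' r)" for r unfolding A_def A'_def by (rule finite_adj)+
  have tgt: "pt (X r) - 1 \<in> leaders l \<and> pt (X r) - 1 \<notin> ?J \<and> pt (X r) \<noteq> 0" if "r \<in> ?J" for r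
    using target[of r] that by auto
  have cA: "card (A r) = out_weight l X r" "card (A' r) = out_weight l X r" if "r \<in> ?J" for r
  proof -
    show "card (A r) = out_weight l X r" using tgt[OF that] by (simp add: A_def out_weight_def weight_def)
    have "card (A' r) = weight l (pt (X r) - 1) r" unfolding A'_def weight_def by (rule arg_cong[where f = card]) auto
    then show "card (A' r) = out_weight l X r" using tgt[OF that] by (simp add: out_weight_def weight_sym[of l r])
  qed
  have finJ: "finite ?J" using finite_leaders by simp
  have cU: "card (\<Union>r\<in>?J. A r) = (\<Sum>r\<in>?J. out_weight l X r)"
  proof -
    have "card (\<Union>r\<in>?J. A r) = (\<Sum>r\<in>?J. card (A r))"
      using finJ fin by (intro card_UN_disjoint) (auto simp: A_def)
    also have "\<dots> = (\<Sum>r\<in>?J. out_weight l X r)" by (intro sum.cong refl cA)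
    finally show ?thesis .
  qed
  have cU': "card (\<Union>r\<in>?J. A' r) = (\<Sum>r\<in>?J. out_weight l X r)"
  proof -
    have "card (\<Union>r\<in>?J. A' r) = (\<Sum>r\<in>?J. card (A' r))"
      using finJ fin by (intro card_UN_disjoint) (auto simp: A'_def)
    also have "\<dots> = (\<Sum>r\<in>?J. out_weight l X r)" by (intro sum.cong refl cA)
    finally show ?thesis .
  qed
  \<comment> \<open>Two clusters that chose each other cannot both join, because a target never
    joins.\<close>
  have dis: "(\<Union>r\<in>?J. A r) \<inter> (\<Union>r\<in>?J. A' r) = {}"
  proof -
    have "z \<notin> A' r'" if "z \<in> A r" "r \<in> ?J" "r' \<in> ?J" for z r r'
    proof
      assume "z \<in> A' r'"
      then have "r = pt (X r') - 1" using that(1) by (auto simp: A_def A'_def)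
      then show False using tgt[OF that(3)] that(2) by blast
    qed
    then show ?thesis by blast
  qed
  let ?P = "{(x, y). adj x y \<and> l x \<noteq> l y}" and ?P' = "{(x, y). adj x y \<and> l' x \<noteq> l' y}"
  have sub: "z \<in> ?P - ?P'" if r: "r \<in> ?J" and z: "z \<in> A r \<union> A' r" for z r
  proof -
    obtain x y where xy: "z = (x, y)" by (cases z)
    let ?q = "pt (X r) - 1"
    have adj: "adj x y" and ends: "(l x = r \<and> l y = ?q) \<or> (l y = r \<and> l x = ?q)"
      using z unfolding xy A_def A'_def by auto
    have 1: "?q \<noteq> r" "lf (X ?q) \<noteq> 3" "lf (X r) = 3" using tgt[OF r] r by auto
    then have "l' x = ?q \<and> l' y = ?q" using ends unfolding l'_def by auto
    moreover have "l x \<noteq> l y" using ends 1(1) by metis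
    ultimately show ?thesis using adj unfolding xy by simp
  qed
  have "l x = l y \<Longrightarrow> l' x = l' y" for x y unfolding l'_def by simp
  then have P': "?P' \<subseteq> ?P" by blast
  have finP: "finite ?P" by (rule finite_adj)
  have "card ((\<Union>r\<in>?J. A r) \<union> (\<Union>r\<in>?J. A' r)) = 2 * (\<Sum>r\<in>?J. out_weight l X r)"
    using finJ fin dis cU cU' by (subst card_Un_disjoint) auto
  moreover have "card ((\<Union>r\<in>?J. A r) \<union> (\<Union>r\<in>?J. A' r)) \<le> card (?P - ?P')"
    using sub finP by (intro card_mono) blast+
  moreover have "card (?P - ?P') = cut l - cut l'"
    unfolding cut_def using P' finP by (intro card_Diff_subset) (auto intro: finite_subset)
  moreover have "cut l' \<le> cut l" unfolding cut_def by (rule card_mono[OF finP P'])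
  ultimately show "cut l' + 2 * (\<Sum>r\<in>?J. out_weight l X r) \<le> cut l" by linarith
qed

definition sparse :: "nat \<Rightarrow> (nat \<Rightarrow> nat) \<Rightarrow> bool" where
  "sparse C l \<longleftrightarrow> (\<forall>F\<subseteq>leaders l. F \<noteq> {} \<longrightarrow>
     card {(r, s). r \<in> F \<and> s \<in> F \<and> r \<noteq> s \<and> 0 < weight l r s} < 2 * C * card F)"

text \<open>The errors sum to at most \<open>cut l / (8 * C)\<close>. Multiplied by the sparsity
  factor \<open>4 * C\<close> they take up at most half of the cut, so the chosen edges account for
  the other half.\<close>

lemma heavy_sum:
  assumes "heavy l X" "sparse C l" "8 * C \<le> k + 1"
  shows "cut l \<le> 8 * C * (\<Sum>r\<in>leaders l. out_weight l X r)"
proof -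
  obtain t where t: "\<And>r q. r \<in> leaders l \<Longrightarrow> q \<in> leaders l - {r} \<Longrightarrow> weight l r q \<le> out_weight l X r + t r"
     "\<And>r. r \<in> leaders l \<Longrightarrow> (k + 1) * t r \<le> (\<Sum>q\<in>leaders l - {r}. weight l r q)"
    using assms(1) unfolding heavy_def by metis
  have "cut l \<le> 4 * C * (\<Sum>r\<in>leaders l. out_weight l X r + t r)"
    unfolding cut_eq_weights
    using t(1) assms(2) by (intro sparse_weight_bound finite_leaders weight_sym) (auto simp: sparse_def)
  moreover have "8 * C * (\<Sum>r\<in>leaders l. t r) \<le> cut l"
  proof -
    have "8 * C * (\<Sum>r\<in>leaders l. t r) \<le> (k + 1) * (\<Sum>r\<in>leaders l. t r)"
      using assms(3) by (rule mult_right_mono) simp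
    also have "\<dots> = (\<Sum>r\<in>leaders l. (k + 1) * t r)" by (rule sum_distrib_left)
    also have "\<dots> \<le> (\<Sum>r\<in>leaders l. \<Sum>q\<in>leaders l - {r}. weight l r q)" by (intro sum_mono t(2))
    finally show ?thesis unfolding cut_eq_weights .
  qed
  ultimately show ?thesis by (simp add: sum.distrib algebra_simps)
qed

text \<open>The resulting partition is fixed before \<open>C\<close> is quantified: it is valid on
  any network, and sparsity is used only for its cut.\<close>

lemma phase_correct:
  assumes st: "start D l s" and T: "(cv_bits ^^ T) b \<le> 3"
  shows "\<exists>l'. start (3 * D + 1) l' (exec adj (phase k N M (Suc T) D) s) \<and>
    (\<forall>C. sparse C l \<and> 8 * C \<le> k + 1 \<longrightarrow> 16 * C * cut l' + cut l \<le> 16 * C * cut l)"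
proof -
  obtain X0 where r0: "rep D l X0 (exec adj (replicate D bfs_round) s)" using bfs_phase[OF st] by blast
  let ?s0 = "exec adj (replicate D bfs_round) s"
  let ?s1 = "exec adj (agg k N M D count_query pick_dec) ?s0"
  let ?s2 = "exec adj (concat (replicate T (agg k N M D colour_query colour_dec))) ?s1"
  let ?s3 = "exec adj (agg k N M D colour_query colour_dec) ?s2"
  let ?s4 = "exec adj (concat (map (\<lambda>a. agg k N M D side_query (side_dec a)) [0..<6])) ?s3"
  let ?s5 = "exec adj (agg k N M D join_query join_dec) ?s4"
  have ex: "exec adj (phase k N M (Suc T) D) s = step adj merge_round ?s5"
  proof -
    have "replicate (Suc T) x = replicate T x @ [x]" for x :: "round list" by (simp add: replicate_append_same)
    then show ?thesis unfolding phase_def by (simp del: replicate.simps upt_Suc)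
  qed
  obtain X1 where X1: "rep D l X1 ?s1" "picked l X1" "heavy l X1" "coloured N l X1" "\<forall>r\<in>leaders l. lf (X1 r) = 1"
    using pick_phase[OF r0] by blast
  obtain X2 where X2: "rep D l X2 ?s2" "coloured (2 ^ (cv_bits ^^ T) b) l X2"
    "\<forall>r\<in>leaders l. lf (X2 r) = lf (X1 r) \<and> pt (X2 r) = pt (X1 r)"
    using colour_phases[OF X1(1,2) X1(4)[unfolded N] b_pos] by blast
  have p2: "picked l X2" using picked_cong[OF X1(2)] X2(3) by simp
  have pos: "0 < (cv_bits ^^ T) b" using b_pos cv_bits_pos by (induction T) auto
  obtain X3 where X3: "rep D l X3 ?s3" "coloured (2 * (cv_bits ^^ T) b) l X3"
    "\<forall>r\<in>leaders l. lf (X3 r) = lf (X2 r) \<and> pt (X3 r) = pt (X2 r)"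
    using colour_phase[OF X2(1) p2 X2(2) pos] by blast
  have p3: "picked l X3" using picked_cong[OF p2] X3(3) by simp
  \<comment> \<open>The extra recolouring of \<open>Suc T\<close> turns three-bit colours into
    colours below \<open>2 * 3\<close>, one for each of the six side choices.\<close>
  have "2 * (cv_bits ^^ T) b \<le> 6" using T by simp
  then have c3: "coloured 6 l X3" using X3(2) unfolding coloured_def by (meson less_le_trans)
  have h3: "half_sided 0 l X3" using X1(5) X2(3) X3(3) by (simp add: half_sided_def)
  obtain X4 where X4: "rep D l X4 ?s4" "half_sided 6 l X4" "potential l X3 \<le> potential l X4"
    "\<forall>r\<in>leaders l. cl (X4 r) = cl (X3 r) \<and> pt (X4 r) = pt (X3 r)"
    using side_phases[OF X3(1) p3 c3 h3, of 6] by auto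
  have p4: "picked l X4" using picked_cong[OF p3] X4(4) by simp
  have lf4: "lf (X4 r) = 0 \<or> lf (X4 r) = 2" if "r \<in> leaders l" for r
    using X4(2,4) c3 that unfolding half_sided_def coloured_def by metis
  obtain X5 where X5: "rep D l X5 ?s5" "\<forall>r\<in>leaders l. pt (X5 r) = pt (X4 r) \<and>
        lf (X5 r) = (if lf (X4 r) = 2 \<and> pt (X4 r) \<noteq> 0 \<and> lf (X4 (pt (X4 r) - 1)) = 0 then 3 else lf (X4 r))"
    using join_phase[OF X4(1) p4] by blast
  let ?J = "{r \<in> leaders l. lf (X5 r) = 3}"
  have target: "\<exists>q. q \<in> leaders l \<and> pt (X5 r) = Suc q \<and> 0 < weight l r q \<and> lf (X5 q) \<noteq> 3"
    if r: "r \<in> leaders l" "lf (X5 r) = 3" for r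
  proof -
    have j: "pt (X4 r) \<noteq> 0" "lf (X4 (pt (X4 r) - 1)) = 0" "pt (X5 r) = pt (X4 r)"
      using X5(2) r lf4[OF r(1)] by (auto split: if_splits)
    then obtain q where q: "q \<in> leaders l" "pt (X4 r) = Suc q" "0 < weight l r q" using picked_target[OF p4 r(1)] by blast
    then have "lf (X5 q) \<noteq> 3" using X5(2) j(2) by auto
    then show ?thesis using q j(3) by auto
  qed
  define l' where "l' v = (if lf (X5 (l v)) = 3 then pt (X5 (l v)) - 1 else l v)" for v
  have st': "start (3 * D + 1) l' (step adj merge_round ?s5)"
    and cut': "cut l' + 2 * (\<Sum>r\<in>?J. out_weight l X5 r) \<le> cut l"
    using merge_clusters[OF X5(1) target] unfolding l'_def by blast+
  have ow: "out_weight l X4 r = out_weight l X1 r" "out_weight l X5 r = out_weight l X1 r" "out_weight l X3 r = out_weight l X1 r"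
    if "r \<in> leaders l" for r
    using that X2(3) X3(3) X4(4) X5(2) by (simp_all add: out_weight_def)
  \<comment> \<open>While all clusters are undecided, each chosen edge contributes its weight times
    \<open>1 * (2 - 1)\<close>.\<close>
  have pot3: "potential l X3 = int (\<Sum>r\<in>leaders l. out_weight l X1 r)"
    unfolding leaf_potential_def of_nat_sum
  proof (intro sum.cong refl)
    fix r assume r: "r \<in> leaders l"
    have lf3: "lf (X3 q) = 1" if "q \<in> leaders l" for q using that X1(5) X2(3) X3(3) by simp
    show "(if pt (X3 r) = 0 then 0 else int (out_weight l X3 r) * int (lf (X3 r)) * (2 - int (lf (X3 (pt (X3 r) - 1)))))
        = int (out_weight l X1 r)"
    proof (cases "pt (X3 r) = 0")
      case True
      then show ?thesis using ow(3)[OF r] by (simp add: out_weight_def)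
    next
      case False
      then obtain q where "q \<in> leaders l" "pt (X3 r) = Suc q" using picked_target[OF p3 r] by blast
      then show ?thesis using lf3 r ow(3)[OF r] by simp
    qed
  qed
  \<comment> \<open>Once all sides are \<open>0\<close> or \<open>2\<close>, the product of the two
    factors is \<open>4\<close> on an edge from a leaf to a centre and \<open>0\<close>
    otherwise.\<close>
  have pot4: "potential l X4 = int (4 * (\<Sum>r\<in>?J. out_weight l X5 r))"
  proof -
    have "potential l X4 = (\<Sum>r\<in>leaders l. if lf (X5 r) = 3 then int (4 * out_weight l X5 r) else 0)"
      unfolding leaf_potential_def
    proof (intro sum.cong refl)
      fix r assume r: "r \<in> leaders l"
      show "(if pt (X4 r) = 0 then 0 else int (out_weight l X4 r) * int (lf (X4 r)) * (2 - int (lf (X4 (pt (X4 r) - 1)))))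
        = (if lf (X5 r) = 3 then int (4 * out_weight l X5 r) else 0)"
      proof (cases "pt (X4 r) = 0")
        case True
        then show ?thesis using X5(2) r lf4[OF r] by auto
      next
        case False
        then obtain q where q: "q \<in> leaders l" "pt (X4 r) = Suc q" using picked_target[OF p4 r] by blast
        then show ?thesis using lf4[OF r] lf4[OF q(1)] X5(2) r ow[OF r] by auto
      qed
    qed
    also have "\<dots> = (\<Sum>r\<in>?J. int (4 * out_weight l X5 r))"
      by (rule sum.inter_filter[OF finite_leaders, symmetric])
    finally show ?thesis by (simp add: sum_distrib_left)
  qed
  have gain: "(\<Sum>r\<in>leaders l. out_weight l X1 r) \<le> 4 * (\<Sum>r\<in>?J. out_weight l X5 r)"
    using X4(3) unfolding pot3 pot4 by (simp only: of_nat_le_iff)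
  have "16 * C * cut l' + cut l \<le> 16 * C * cut l" if "sparse C l" "8 * C \<le> k + 1" for C
  proof -
    have "cut l \<le> 8 * C * (4 * (\<Sum>r\<in>?J. out_weight l X5 r))"
      using heavy_sum[OF X1(3) that] gain by (meson le_trans mult_le_mono2)
    moreover have "16 * C * (cut l' + 2 * (\<Sum>r\<in>?J. out_weight l X5 r)) \<le> 16 * C * cut l"
      using cut' by (rule mult_le_mono2)
    ultimately show ?thesis by (simp add: algebra_simps)
  qed
  then show ?thesis using st' unfolding ex by blast
qed

end

primrec radius :: "nat \<Rightarrow> nat" where
  "radius 0 = 0"
| "radius (Suc i) = 3 * radius i + 1"

lemma radius_eq: "2 * radius i + 1 = 3 ^ i"
  by (induction i) auto

definition program :: "nat \<Rightarrow> nat \<Rightarrow> nat \<Rightarrow> nat \<Rightarrow> nat \<Rightarrow> round list" where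
  "program k N M T L = concat (map (\<lambda>i. phase k N M T (radius i)) [0..<L])"

lemma program_simps [simp]:
  "program k N M T 0 = []"
  "program k N M T (Suc L) = program k N M T L @ phase k N M T (radius L)"
  by (simp_all add: program_def)

lemma length_agg: "length (agg k N M D c dec) = 2 * D + 2"
  by (simp add: agg_def)

lemma length_phase: "length (phase k N M T D) = D + (T + 8) * (2 * D + 2) + 1"
proof -
  have "length (concat (replicate T (agg k N M D colour_query colour_dec))) = T * (2 * D + 2)"
    by (induction T) (simp_all add: length_agg)
  moreover have "length (concat (map (\<lambda>a. agg k N M D side_query (side_dec a)) as)) = length as * (2 * D + 2)" for as
    by (induction as) (simp_all add: length_agg)
  ultimately show ?thesis unfolding phase_def by (simp add: length_agg algebra_simps)
qed

text \<open>Phase lengths grow geometrically with the radii, and the sum keeps the order of the last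
  phase.\<close>

lemma length_program: "length (program k N M T L) \<le> (T + 9) * 3 ^ L"
proof (induction L)
  case (Suc L)
  have p: "1 \<le> (3::nat) ^ L" by simp
  have D: "2 * radius L + 2 \<le> 2 * 3 ^ L" "radius L + 1 \<le> 2 * 3 ^ L" using radius_eq[of L] p by linarith+
  have "length (phase k N M T (radius L)) \<le> 2 * 3 ^ L + (T + 8) * (2 * 3 ^ L)"
    unfolding length_phase using D(2) mult_le_mono2[OF D(1), of "T + 8"] by linarith
  then show ?case using Suc.IH by (simp add: algebra_simps)
qed simp

lemma program_rounds:
  assumes "F \<in> set (program k N M T L)" "N = 2 ^ b" "0 < b"
  shows "local_round F" "small_round k N M F"
proof -
  have ag: "local_round F \<and> small_round k N M F"
    if "F \<in> set (agg k N M D c dec)" "small_dec k N M dec" for D c dec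
  proof -
    have "F = up_round k N M c \<or> F = root_round dec \<or> F = down_round"
      using that(1) unfolding agg_def by (simp del: replicate.simps) (metis in_set_replicate)
    then show ?thesis using local_rounds small_rounds that(2) by blast
  qed
  note d = small_decs[OF assms(2,3)]
  obtain i where "F \<in> set (phase k N M T (radius i))" using assms(1) by (auto simp: program_def)
  then have "local_round F \<and> small_round k N M F"
    unfolding phase_def
    using ag[OF _ d(1)] ag[OF _ d(2)] ag[OF _ d(3)] ag[OF _ d(4)] local_rounds(1,5) small_rounds(1,5)
    by (auto simp del: upt_Suc)
  then show "local_round F" "small_round k N M F" by blast+
qed

context phase_network
begin

lemma start_id:
  assumes "\<And>v. v \<in> V \<Longrightarrow> s v = \<lparr>ld = v, pt = 0, cl = 0, lf = 0, par = Suc v, sm = \<lambda>_. 0\<rparr>"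
  shows "start 0 (\<lambda>v. v) s"
  using assms by (auto simp: start_def rad_def intro!: exI[of _ 0])

lemma program_correct:
  assumes st: "start 0 l0 s" and T: "(cv_bits ^^ T) b \<le> 3"
  shows "\<exists>l. start (radius L) l (exec adj (program k N M (Suc T) L) s) \<and>
    (\<forall>C. (\<forall>D l. rad D l \<longrightarrow> sparse C l) \<and> 0 < C \<and> 8 * C \<le> k + 1 \<longrightarrow>
       real (cut l) \<le> (1 - 1 / (16 * real C)) ^ L * real (cut l0))"
proof (induction L)
  case 0
  then show ?case using st by auto
next
  case (Suc L)
  then obtain l where l: "start (radius L) l (exec adj (program k N M (Suc T) L) s)"
    "\<And>C. (\<forall>D l. rad D l \<longrightarrow> sparse C l) \<Longrightarrow> 0 < C \<Longrightarrow> 8 * C \<le> k + 1 \<Longrightarrow>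
       real (cut l) \<le> (1 - 1 / (16 * real C)) ^ L * real (cut l0)" by blast
  obtain l' where l': "start (radius (Suc L)) l' (exec adj (program k N M (Suc T) (Suc L)) s)"
    "\<And>C. sparse C l \<Longrightarrow> 8 * C \<le> k + 1 \<Longrightarrow> 16 * C * cut l' + cut l \<le> 16 * C * cut l"
    using phase_correct[OF l(1) T] by auto
  have "real (cut l') \<le> (1 - 1 / (16 * real C)) ^ Suc L * real (cut l0)"
    if C: "\<forall>D l. rad D l \<longrightarrow> sparse C l" "0 < C" "8 * C \<le> k + 1" for C
  proof -
    have "rad (radius L) l" using l(1) by (simp add: start_def)
    then have "16 * C * cut l' + cut l \<le> 16 * C * cut l" using C by (intro l'(2)) blast+
    then have "real (16 * C * cut l' + cut l) \<le> real (16 * C * cut l)" by (rule of_nat_mono)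
    then have "real (cut l') \<le> (1 - 1 / (16 * real C)) * real (cut l)"
      using C(2) by (simp add: field_simps)
    also have "\<dots> \<le> (1 - 1 / (16 * real C)) * ((1 - 1 / (16 * real C)) ^ L * real (cut l0))"
      using C(2) by (intro mult_left_mono l(2) C) simp
    finally show ?thesis by simp
  qed
  then show ?case using l'(1) by blast
qed

lemma cut_id_le:
  assumes "sparse C (\<lambda>v. v)" "V \<noteq> {}"
  shows "cut (\<lambda>v. v) \<le> 2 * C * card V"
proof -
  have "weight (\<lambda>v. v) r s = (if adj r s then 1 else 0)" for r s
  proof -
    have "{(x, y). adj x y \<and> x = r \<and> y = s} = (if adj r s then {(r, s)} else {})" by auto
    then show ?thesis by (simp add: weight_def)
  qed
  then have "{(r, s). r \<in> V \<and> s \<in> V \<and> r \<noteq> s \<and> 0 < weight (\<lambda>v. v) r s} = {(x, y). adj x y \<and> x \<noteq> y}"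
    using adj_V by auto
  then have "card {(x, y). adj x y \<and> x \<noteq> y} < 2 * C * card V"
    using assms unfolding sparse_def leaders_def by auto
  then show ?thesis by (simp add: cut_def)
qed

end

section \<open>Simulation in the CONGEST model\<close>

definition flatten_map :: "(nat \<Rightarrow> nat) \<Rightarrow> nat list" where
  "flatten_map f = concat (map (\<lambda>j. [j, f j]) (sorted_list_of_set {j. f j \<noteq> 0}))"

fun unflatten_map :: "nat list \<Rightarrow> nat \<Rightarrow> nat" where
  "unflatten_map (a # b # xs) = (unflatten_map xs)(a := b)"
| "unflatten_map _ = (\<lambda>_. 0)"

lemma unflatten_flatten: "finite {j. f j \<noteq> 0} \<Longrightarrow> unflatten_map (flatten_map f) = f"
proof -
  assume fin: "finite {j. f j \<noteq> 0}"
  have "unflatten_map (concat (map (\<lambda>j. [j, f j]) js)) = (\<lambda>j. if j \<in> set js then f j else 0)" for js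
    by (induction js) (auto simp: fun_eq_iff)
  then show ?thesis using fin by (auto simp: flatten_map_def fun_eq_iff)
qed

text \<open>A transition is not told the identifier of its node, so the identifier is stored in
  front of the state.\<close>

definition encode_state :: "nat \<Rightarrow> st \<Rightarrow> nat list" where
  "encode_state v s = [v, ld s, pt s, cl s, lf s, par s] @ flatten_map (sm s)"

definition decode_state :: "nat list \<Rightarrow> st" where
  "decode_state xs = \<lparr>ld = xs ! 1, pt = xs ! 2, cl = xs ! 3, lf = xs ! 4, par = xs ! 5,
     sm = unflatten_map (drop 6 xs)\<rparr>"

lemma small_finite: "small k N M s \<Longrightarrow> finite {j. sm s j \<noteq> 0}"
  by (rule finite_subset[of _ "{..<N}"]) (auto simp: small_def not_less[symmetric])

lemma decode_encode: "small k N M s \<Longrightarrow> decode_state (encode_state v s) = s"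
  using unflatten_flatten[OF small_finite[of k N M s]] by (simp add: decode_state_def encode_state_def)

lemma hd_encode: "hd (encode_state v s) = v" "encode_state v s ! 1 = ld s"
  by (simp_all add: encode_state_def)

lemma local_roundD:
  "local_round F \<Longrightarrow> (\<And>j. j \<in> Nb \<Longrightarrow> r j = r' j) \<Longrightarrow> F v s Nb r = F v s Nb r'"
  unfolding local_round_def by blast

text \<open>The model delivers \<open>0\<close> from non-neighbours. Nonzero messages therefore
  reveal the neighbourhood, and nodes need not store it.\<close>

lemma list_encode_pos: "xs \<noteq> [] \<Longrightarrow> list_encode xs \<noteq> 0"
  by (cases xs) auto

lemma prod_encode_less: "x < 2 ^ q \<Longrightarrow> y < 2 ^ q \<Longrightarrow> prod_encode (x, y) < 2 ^ (2 * q + 2)"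
proof -
  assume "x < 2 ^ q" "y < 2 ^ q"
  then have s: "x + y + 1 < 2 ^ (q + 1)" by simp
  have t: "2 * triangle m = m * (m + 1)" for m by (induction m) auto
  have "2 * prod_encode (x, y) \<le> 2 * ((x + y + 1) * (x + y + 1))"
    using t[of "x + y"] by (simp add: prod_encode_def algebra_simps)
  also have "(x + y + 1) * (x + y + 1) < 2 ^ (q + 1) * 2 ^ (q + 1)"
    using s by (intro mult_strict_mono) simp_all
  also have "\<dots> = (2::nat) ^ (2 * q + 2)" by (simp only: power_add[symmetric]) simp
  finally show ?thesis by simp
qed

text \<open>Each pairing turns \<open>q\<close> bits into \<open>2 * q + 2\<close>, which is below
  \<open>3 * q\<close> as \<open>q \<ge> 3\<close>. The exponential growth in the length is
  acceptable because states have a constant number of entries.\<close>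

lemma list_encode_less:
  assumes "\<forall>x\<in>set xs. x < 2 ^ b"
  shows "list_encode xs < 2 ^ ((b + 3) * 3 ^ length xs)"
  using assms
proof (induction xs)
  case (Cons x xs)
  let ?q = "(b + 3) * 3 ^ length xs"
  have q: "b + 3 \<le> ?q" by simp
  have "b \<le> ?q" using q by linarith
  then have "(2::nat) ^ b \<le> 2 ^ ?q" by (rule power_increasing) simp
  then have "x < 2 ^ ?q" using Cons.prems by (auto intro: less_le_trans)
  then have "prod_encode (x, list_encode xs) < 2 ^ (2 * ?q + 2)"
    using Cons by (intro prod_encode_less) auto
  then have "list_encode (x # xs) \<le> 2 ^ (2 * ?q + 2)" by simp
  also have "\<dots> < (2::nat) ^ (3 * ?q)" using q by (intro power_strict_increasing) linarith+
  finally show ?case by (simp add: algebra_simps)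
qed simp

lemma message_bound:
  assumes s: "small k N M s" and v: "v < N" and b: "N < 2 ^ b" "M < 2 ^ b" "2 \<le> b"
  shows "list_encode (encode_state v s) < 2 ^ ((b + 3) * 3 ^ (2 * k + 6))"
proof -
  let ?xs = "encode_state v s"
  have fin: "finite {j. sm s j \<noteq> 0}" by (rule small_finite[OF s])
  have "length (concat (map (\<lambda>j. [j, f j]) js)) = 2 * length js" for f :: "nat \<Rightarrow> nat" and js
    by (induction js) auto
  then have "length (flatten_map (sm s)) = 2 * card {j. sm s j \<noteq> 0}"
    using fin by (simp add: flatten_map_def)
  then have len: "length ?xs \<le> 2 * k + 6" using s by (simp add: encode_state_def small_def)
  have "(4::nat) \<le> 2 ^ b" using power_increasing[OF b(3), of "2::nat"] by simp
  then have "\<forall>x\<in>set ?xs. x < 2 ^ b"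
    using s v b fin by (auto simp: encode_state_def flatten_map_def small_def not_less intro: le_less_trans)
      (metis le_less_trans less_imp_le_nat not_less)
  then have "list_encode ?xs < 2 ^ ((b + 3) * 3 ^ length ?xs)" by (rule list_encode_less)
  also have "\<dots> \<le> 2 ^ ((b + 3) * 3 ^ (2 * k + 6))" using len by (intro power_increasing mult_le_mono2) auto
  finally show ?thesis .
qed

definition simulate :: "(nat \<Rightarrow> real \<Rightarrow> round list) \<Rightarrow> congest_alg" where
  "simulate P = \<lparr>
     a_init = (\<lambda>n e d i Nb tp. encode_state i \<lparr>ld = i, pt = 0, cl = 0, lf = 0, par = Suc i, sm = \<lambda>_. 0\<rparr>),
     a_msg = (\<lambda>n e d t tp xs j. list_encode xs),
     a_trans = (\<lambda>n e d t tp xs rec. encode_state (hd xs)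
        ((P n e ! t) (hd xs) (decode_state xs) {j. rec j \<noteq> 0} (\<lambda>j. decode_state (list_decode (rec j))))),
     a_out = (\<lambda>xs. xs ! 1),
     a_rounds = (\<lambda>n e d. length (P n e))\<rparr>"

lemma simulate_simps [simp]:
  "a_init (simulate P) n e d i Nb tape = encode_state i \<lparr>ld = i, pt = 0, cl = 0, lf = 0, par = Suc i, sm = \<lambda>_. 0\<rparr>"
  "a_msg (simulate P) n e d t tape xs j = list_encode xs"
  "a_trans (simulate P) n e d t tape xs rec = encode_state (hd xs)
     ((P n e ! t) (hd xs) (decode_state xs) {j. rec j \<noteq> 0} (\<lambda>j. decode_state (list_decode (rec j))))"
  "a_out (simulate P) xs = xs ! 1"
  "a_rounds (simulate P) n e d = length (P n e)"
  by (simp_all add: simulate_def)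

text \<open>Clusters are named by identifiers of nodes, so the whole analysis takes place on the
  copy of the graph whose vertices are the identifiers.\<close>

definition id_adj :: "nat \<Rightarrow> (nat \<Rightarrow> nat \<Rightarrow> bool) \<Rightarrow> (nat \<Rightarrow> nat) \<Rightarrow> nat \<Rightarrow> nat \<Rightarrow> bool" where
  "id_adj n E ids i j \<longleftrightarrow> (\<exists>u<n. \<exists>v<n. ids u = i \<and> ids v = j \<and> E u v)"

definition initial_state :: "nat \<Rightarrow> st" where
  "initial_state v = \<lparr>ld = v, pt = 0, cl = 0, lf = 0, par = Suc v, sm = \<lambda>_. 0\<rparr>"

lemma run_simulate:
  assumes inj: "inj_on ids {0..<n}" and ids: "\<And>v. v < n \<Longrightarrow> ids v < N"
    and P: "\<And>F. F \<in> set (P n e) \<Longrightarrow> local_round F \<and> small_round k N M F" and N: "4 \<le> N"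
    and v: "v < n" and t: "t \<le> length (P n e)"
  shows "run (simulate P) n e d E ids tp t v
      = encode_state (ids v) (exec (id_adj n E ids) (take t (P n e)) initial_state (ids v)) \<and>
    small k N M (exec (id_adj n E ids) (take t (P n e)) initial_state (ids v))"
proof -
  let ?adj = "id_adj n E ids"
  let ?s = "\<lambda>t. exec ?adj (take t (P n e)) initial_state"
  have sm: "small k N M (?s t (ids v))" if "v < n" for t v
  proof (rule small_exec)
    show "small_round k N M F" if "F \<in> set (take t (P n e))" for F using P that by (meson in_set_takeD)
    show "i \<in> ids ` {0..<n} \<and> j \<in> ids ` {0..<n}" if "?adj i j" for i j
      using that unfolding id_adj_def by force
    show "ids ` {0..<n} \<subseteq> {..<N}" using ids by auto
    show "small k N M (initial_state i)" if "i \<in> ids ` {0..<n}" for i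
      using that ids N by (auto simp: initial_state_def small_def Suc_le_eq)
    show "ids v \<in> ids ` {0..<n}" using that by simp
  qed
  have "run (simulate P) n e d E ids tp t v = encode_state (ids v) (?s t (ids v))"
    using v t
  proof (induction t arbitrary: v)
    case 0
    then show ?case by (simp add: initial_state_def)
  next
    case (Suc t)
    define rec where "rec j = (if (\<exists>u<n. E v u \<and> ids u = j)
             then (let u = (THE u. u < n \<and> E v u \<and> ids u = j)
                   in list_encode (run (simulate P) n e d E ids tp t u)) else 0)" for j
    have rec: "rec j = list_encode (encode_state j (?s t j))" if adj: "?adj (ids v) j" for j
    proof -
      obtain u v' where u: "u < n" "v' < n" "E v' u" "ids v' = ids v" "ids u = j" using adj by (auto simp: id_adj_def)
      then have E: "E v u" using inj Suc.prems(1) by (metis atLeastLessThan_iff inj_onD le0)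
      have "(THE u. u < n \<and> E v u \<and> ids u = j) = u"
        using u E inj by (intro the_equality) (auto dest: inj_onD)
      then have "rec j = list_encode (run (simulate P) n e d E ids tp t u)"
        using u E by (auto simp: rec_def Let_def)
      then show ?thesis using Suc.IH[OF u(1)] Suc.prems(2) u(5) by simp
    qed
    have rec0: "rec j = 0" if "\<not> ?adj (ids v) j" for j
      using that Suc.prems(1) unfolding rec_def id_adj_def by auto
    have Nb: "{j. rec j \<noteq> 0} = {j. ?adj (ids v) j}"
    proof -
      have "rec j \<noteq> 0 \<longleftrightarrow> ?adj (ids v) j" for j
      proof (cases "?adj (ids v) j")
        case True
        have "list_encode (encode_state j (?s t j)) \<noteq> 0"
          by (rule list_encode_pos) (simp add: encode_state_def)
        then show ?thesis using rec[OF True] True by simp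
      qed (simp add: rec0)
      then show ?thesis by simp
    qed
    have r: "decode_state (list_decode (rec j)) = ?s t j" if adj: "?adj (ids v) j" for j
    proof -
      obtain u where "u < n" "ids u = j" using adj by (auto simp: id_adj_def)
      then have "small k N M (?s t j)" using sm by blast
      then show ?thesis using rec[OF adj] decode_encode by simp
    qed
    let ?F = "P n e ! t"
    have F: "?F \<in> set (P n e)" using Suc.prems(2) by simp
    have IH: "run (simulate P) n e d E ids tp t v = encode_state (ids v) (?s t (ids v))"
      using Suc by simp
    have dec: "decode_state (encode_state (ids v) (?s t (ids v))) = ?s t (ids v)"
      using decode_encode sm[OF Suc.prems(1)] by blast
    have l: "local_round ?F" using P[OF F] by blast
    have 1: "run (simulate P) n e d E ids tp (Suc t) v
       = encode_state (ids v) (?F (ids v) (?s t (ids v)) {j. rec j \<noteq> 0} (\<lambda>j. decode_state (list_decode (rec j))))"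
      using IH dec unfolding run.simps simulate_simps rec_def by (simp only: hd_encode)
    have 2: "?F (ids v) (?s t (ids v)) {j. rec j \<noteq> 0} (\<lambda>j. decode_state (list_decode (rec j)))
        = ?F (ids v) (?s t (ids v)) {j. ?adj (ids v) j} (?s t)"
      unfolding Nb by (rule local_roundD[OF l]) (simp add: r)
    have 3: "?F (ids v) (?s t (ids v)) {j. ?adj (ids v) j} (?s t) = ?s (Suc t) (ids v)"
      using Suc.prems(2) by (simp add: take_Suc_conv_app_nth step_def)
    show ?case unfolding 1 2 3 ..
  qed
  then show ?thesis using sm[OF v] by blast
qed

section \<open>From identifiers back to the input graph\<close>

lemma relpow_walk:
  assumes "x \<in> S"
  shows "(x, y) \<in> inner_rel E S ^^ m \<Longrightarrow>
    \<exists>xs. walk_in E S xs \<and> hd xs = x \<and> last xs = y \<and> length xs = Suc m"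
proof (induction m arbitrary: y)
  case 0
  then show ?case using assms by (intro exI[of _ "[x]"]) (simp add: walk_in_def)
next
  case (Suc m)
  then obtain z where z: "(x, z) \<in> inner_rel E S ^^ m" "(z, y) \<in> inner_rel E S" by (meson relpow_Suc_E)
  obtain xs where xs: "walk_in E S xs" "hd xs = x" "last xs = z" "length xs = Suc m"
    using Suc.IH[OF z(1)] by blast
  have ne: "xs \<noteq> []" using xs(4) by auto
  have "E ((xs @ [y]) ! i) ((xs @ [y]) ! Suc i)" if i: "Suc i < length (xs @ [y])" for i
  proof (cases "Suc i < length xs")
    case True
    then show ?thesis using xs(1) by (simp add: walk_in_def nth_append)
  next
    case False
    then have "i = m" using i xs(4) by simp
    then have "(xs @ [y]) ! i = z" "(xs @ [y]) ! Suc i = y"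
      using xs(3,4) ne by (simp_all add: nth_append last_conv_nth)
    then show ?thesis using z(2) by (simp add: inner_rel_def)
  qed
  moreover have "set (xs @ [y]) \<subseteq> S" using xs(1) z(2) by (auto simp: walk_in_def inner_rel_def)
  ultimately have "walk_in E S (xs @ [y])" by (simp add: walk_in_def)
  then show ?case using xs ne by (intro exI[of _ "xs @ [y]"]) simp
qed

lemma relpow_map:
  assumes "\<And>a b. (a, b) \<in> R \<Longrightarrow> (f a, f b) \<in> Q"
  shows "(a, b) \<in> R ^^ m \<Longrightarrow> (f a, f b) \<in> Q ^^ m"
proof (induction m arbitrary: b)
  case (Suc m)
  then obtain c where "(a, c) \<in> R ^^ m" "(c, b) \<in> R" by (meson relpow_Suc_E)
  then show ?case using Suc.IH assms by (meson relpow_Suc_I)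
qed simp

locale id_graph =
  fixes n :: nat and E :: "nat \<Rightarrow> nat \<Rightarrow> bool" and ids :: "nat \<Rightarrow> nat"
  assumes simple: "simple_graph n E" and inj: "inj_on ids {0..<n}"
begin

abbreviation "V \<equiv> ids ` {0..<n}"
abbreviation "adj \<equiv> id_adj n E ids"

definition node :: "nat \<Rightarrow> nat" where "node i = the_inv_into {0..<n} ids i"

lemma node_ids: "v < n \<Longrightarrow> node (ids v) = v"
  unfolding node_def using inj by (simp add: the_inv_into_f_f)

lemma ids_node: "i \<in> V \<Longrightarrow> ids (node i) = i \<and> node i < n"
  using node_ids by auto

lemma adj_ids: "u < n \<Longrightarrow> v < n \<Longrightarrow> adj (ids u) (ids v) \<longleftrightarrow> E u v"
  unfolding id_adj_def using inj by (metis atLeastLessThan_iff inj_onD le0)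

lemma adj_node: "adj i j \<Longrightarrow> E (node i) (node j)"
  unfolding id_adj_def using node_ids by auto

lemma adj_props: "adj i j \<Longrightarrow> adj j i" "adj i j \<Longrightarrow> i \<in> V \<and> j \<in> V" "\<not> adj i i"
proof -
  show "adj i j \<Longrightarrow> adj j i" using simple unfolding id_adj_def simple_graph_def by blast
  show "adj i j \<Longrightarrow> i \<in> V \<and> j \<in> V" unfolding id_adj_def by force
  show "\<not> adj i i" using simple inj unfolding id_adj_def simple_graph_def
    by (metis atLeastLessThan_iff inj_onD le0)
qed

lemma cluster_connected:
  assumes l: "\<And>v. v \<in> V \<Longrightarrow> l v \<in> V \<and> l (l v) = l v \<and> (\<exists>m. (l v, v) \<in> {(x, y). adj x y \<and> l x = l y} ^^ m)"
  shows "conn adj {v \<in> V. l v = r}"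
proof -
  let ?S = "{v \<in> V. l v = r}"
  let ?I = "inner_rel adj ?S"
  have sym: "sym ?I" using adj_props(1) by (auto simp: sym_def inner_rel_def)
  have reach: "(r, v) \<in> ?I\<^sup>*" if v: "v \<in> ?S" for v
  proof -
    obtain m where "(l v, v) \<in> {(x, y). adj x y \<and> l x = l y} ^^ m" using l v by blast
    then have m: "(r, v) \<in> {(x, y). adj x y \<and> l x = l y} ^^ m" using v by simp
    have r: "r \<in> ?S" using l[of v] v by auto
    have "w \<in> ?S \<and> (r, w) \<in> ?I\<^sup>*" if "(r, w) \<in> {(x, y). adj x y \<and> l x = l y} ^^ m" for w m
      using that
    proof (induction m arbitrary: w)
      case 0
      then show ?case using r by simp
    next
      case (Suc m)
      then obtain u where u: "(r, u) \<in> {(x, y). adj x y \<and> l x = l y} ^^ m" "(u, w) \<in> {(x, y). adj x y \<and> l x = l y}"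
        by (meson relpow_Suc_E)
      have "u \<in> ?S" "(r, u) \<in> ?I\<^sup>*" using Suc.IH[OF u(1)] by blast+
      moreover have "w \<in> ?S" using u(2) \<open>u \<in> ?S\<close> adj_props(2) by auto
      moreover have "(u, w) \<in> ?I" using calculation u(2) by (auto simp: inner_rel_def)
      ultimately show ?case by (meson rtrancl_into_rtrancl)
    qed
    then show ?thesis using m by blast
  qed
  have "(v, r) \<in> ?I\<^sup>*" if "v \<in> ?S" for v using reach[OF that] sym by (meson sym_rtrancl symD)
  then show ?thesis unfolding conn_def using reach by (meson rtrancl_trans)
qed

text \<open>A complete minor on \<open>h\<close> branch sets contains every simple graph on
  \<open>h\<close> vertices.\<close>

lemma complete_minor_has_minor:
  assumes B: "\<And>i. i < h \<Longrightarrow> B i \<noteq> {} \<and> B i \<subseteq> V \<and> conn adj (B i)"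
    and dis: "\<And>i j. i < h \<Longrightarrow> j < h \<Longrightarrow> i \<noteq> j \<Longrightarrow> B i \<inter> B j = {} \<and> touch adj (B i) (B j)"
    and EH: "simple_graph h EH"
  shows "has_minor n E h EH"
  unfolding has_minor_def
proof (intro exI[of _ "\<lambda>i. node ` B i"] conjI allI impI)
  have in_V: "x \<in> V" if "i < h" "x \<in> B i" for i x using B[OF that(1)] that(2) by blast
  fix i assume i: "i < h"
  show "node ` B i \<noteq> {}" using B[OF i] by simp
  show "node ` B i \<subseteq> {0..<n}" using in_V[OF i] ids_node by auto
  show "connected_in E (node ` B i)"
    unfolding connected_in_def
  proof (intro ballI)
    fix x y assume "x \<in> node ` B i" "y \<in> node ` B i"
    then obtain a b where ab: "a \<in> B i" "b \<in> B i" "x = node a" "y = node b" by blast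
    then obtain m where m: "(a, b) \<in> inner_rel adj (B i) ^^ m"
      using B[OF i] unfolding conn_def by (meson rtrancl_imp_relpow)
    have "(node a, node b) \<in> inner_rel E (node ` B i) ^^ m"
      by (rule relpow_map[OF _ m]) (auto simp: inner_rel_def adj_node)
    then show "\<exists>xs. walk_in E (node ` B i) xs \<and> hd xs = x \<and> last xs = y"
      using relpow_walk[of x "node ` B i" y m E] ab by blast
  qed
  fix j assume j: "j < h"
  show "node ` B i \<inter> node ` B j = {}" if "i \<noteq> j"
  proof -
    have "x = y" if "x \<in> B i" "y \<in> B j" "node x = node y" for x y
      using that in_V i j ids_node by metis
    then show ?thesis using dis[OF i j that] by blast
  qed
  assume "EH i j"
  then have "i \<noteq> j" using EH by (auto simp: simple_graph_def)
  then obtain x y where "x \<in> B i" "y \<in> B j" "adj x y" using dis[OF i j] by (auto simp: touch_def)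
  then show "\<exists>x\<in>node ` B i. \<exists>y\<in>node ` B j. E x y" using adj_node by blast
qed

text \<open>Connected disjoint clusters are a family to which Mader's bound applies; too many
  touching pairs would yield a complete minor on \<open>h\<close> branch sets and hence
  \<open>EH\<close>.\<close>

lemma minor_free_sparse:
  assumes free: "minor_free n E h EH" and EH: "simple_graph h EH"
    and l: "\<And>v. v \<in> V \<Longrightarrow> l v \<in> V \<and> l (l v) = l v \<and> (\<exists>m. (l v, v) \<in> {(x, y). adj x y \<and> l x = l y} ^^ m)"
    and F: "F \<subseteq> l ` V" "F \<noteq> {}"
  shows "card {(r, s). r \<in> F \<and> s \<in> F \<and> r \<noteq> s \<and> (\<exists>x y. adj x y \<and> l x = r \<and> l y = s)} < 2 * 2 ^ h * card F"
proof (rule ccontr)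
  assume neg: "\<not> ?thesis"
  define S where "S r = {v \<in> V. l v = r}" for r
  have finF: "finite F" using F(1) by (rule finite_subset) simp
  have self: "r \<in> S r" if "r \<in> F" for r using that F(1) l by (auto simp: S_def)
  have injS: "inj_on S F"
  proof (rule inj_onI)
    fix r s assume "r \<in> F" "s \<in> F" "S r = S s"
    then have "r \<in> S s" using self by blast
    moreover have "l r = r" using self[OF \<open>r \<in> F\<close>] by (simp add: S_def)
    ultimately show "r = s" by (simp add: S_def)
  qed
  have tp: "touching_pairs adj (S ` F) = map_prod S S `
      {(r, s). r \<in> F \<and> s \<in> F \<and> r \<noteq> s \<and> (\<exists>x y. adj x y \<and> l x = r \<and> l y = s)}" (is "?T = _ ` ?P")
  proof
    show "?T \<subseteq> map_prod S S ` ?P"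
    proof (rule subrelI)
      fix A B assume "(A, B) \<in> ?T"
      then obtain r s where rs: "r \<in> F" "s \<in> F" "A = S r" "B = S s" "A \<noteq> B" "touch adj A B"
        by (auto simp: touching_pairs_def)
      then have "(r, s) \<in> ?P" by (auto simp: touch_def S_def)
      then show "(A, B) \<in> map_prod S S ` ?P" using rs(3,4) by force
    qed
    show "map_prod S S ` ?P \<subseteq> ?T"
    proof
      fix z assume "z \<in> map_prod S S ` ?P"
      then obtain r s x y where rs: "z = (S r, S s)" "r \<in> F" "s \<in> F" "r \<noteq> s" "adj x y" "l x = r" "l y = s" by auto
      then have "x \<in> S r" "y \<in> S s" using adj_props(2) by (auto simp: S_def)
      then have "touch adj (S r) (S s)" using rs(5) unfolding touch_def by blast
      moreover have "S r \<noteq> S s" using injS rs by (meson inj_onD)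
      ultimately show "z \<in> ?T" using rs by (simp add: touching_pairs_def)
    qed
  qed
  have "inj_on (map_prod S S) ?P"
  proof (rule inj_on_subset)
    show "inj_on (map_prod S S) (F \<times> F)" using injS by (rule map_prod_inj_on[OF _ injS])
  qed auto
  then have "card ?T = card ?P" unfolding tp by (rule card_image)
  moreover have "card (S ` F) = card F" using injS by (rule card_image)
  ultimately have dens: "2 * 2 ^ h * card (S ` F) \<le> card ?T" using neg by simp
  have f: "finite (S ` F)" "S ` F \<noteq> {}" using finF F(2) by simp_all
  have "conn adj (S r)" for r unfolding S_def by (rule cluster_connected) (rule l)
  then have c: "\<forall>A\<in>S ` F. A \<noteq> {} \<and> conn adj A" using self by blast
  have d: "\<forall>A\<in>S ` F. \<forall>B\<in>S ` F. A \<noteq> B \<longrightarrow> A \<inter> B = {}"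
  proof (intro ballI impI)
    fix A B assume "A \<in> S ` F" "B \<in> S ` F" "A \<noteq> B"
    then obtain r s where "A = S r" "B = S s" "r \<noteq> s" by blast
    then show "A \<inter> B = {}" by (simp add: S_def) blast
  qed
  have "\<exists>G :: nat \<Rightarrow> nat set set. (\<forall>i<h. G i \<noteq> {} \<and> G i \<subseteq> S ` F \<and> conn adj (\<Union>(G i))) \<and>
      (\<forall>i<h. \<forall>j<h. i \<noteq> j \<longrightarrow> \<Union>(G i) \<inter> \<Union>(G j) = {} \<and> touch adj (\<Union>(G i)) (\<Union>(G j)))"
    by (rule dense_family_has_complete_minor[OF _ f c d dens]) (rule adj_props(1))
  then obtain G :: "nat \<Rightarrow> nat set set" where
    G0: "\<forall>i<h. G i \<noteq> {} \<and> G i \<subseteq> S ` F \<and> conn adj (\<Union>(G i))"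
      "\<forall>i<h. \<forall>j<h. i \<noteq> j \<longrightarrow> \<Union>(G i) \<inter> \<Union>(G j) = {} \<and> touch adj (\<Union>(G i)) (\<Union>(G j))"
    by (elim exE conjE)
  note G = G0(1)[rule_format] G0(2)[rule_format]
  have "has_minor n E h EH"
  proof (rule complete_minor_has_minor[OF _ G(2) EH])
    fix i assume i: "i < h"
    obtain A where A: "A \<in> G i" "A \<in> S ` F" using G(1)[OF i] by blast
    then have "A \<noteq> {}" using self by blast
    then have "\<Union>(G i) \<noteq> {}" using A(1) by blast
    moreover have "\<Union>(G i) \<subseteq> V" using G(1)[OF i] by (auto simp: S_def)
    ultimately show "\<Union>(G i) \<noteq> {} \<and> \<Union>(G i) \<subseteq> V \<and> conn adj (\<Union>(G i))" using G(1)[OF i] by blast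
  qed
  then show False using free by (simp add: minor_free_def)
qed

text \<open>Two nodes of a part are joined through their leader, hence twice the radius.\<close>

lemma valid_partition_of_clusters:
  assumes l: "\<And>v. v \<in> V \<Longrightarrow> l v \<in> V \<and> l (l v) = l v \<and> (\<exists>m\<le>D. (l v, v) \<in> {(x, y). adj x y \<and> l x = l y} ^^ m)"
    and D: "real (2 * D) \<le> D'" and out: "\<And>v. v < n \<Longrightarrow> outp v = l (ids v)"
  shows "valid_partition n E ids outp D'"
  unfolding valid_partition_def
proof (intro allI impI conjI)
  let ?R = "{(x, y). adj x y \<and> l x = l y}"
  have sym: "sym ?R" using adj_props(1) by (auto simp: sym_def)
  fix v assume v: "v < n"
  have vV: "ids v \<in> V" using v by simp
  obtain r where r: "r < n" "ids r = l (ids v)" using l[OF vV] by auto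
  then show "\<exists>r<n. ids r = outp v \<and> outp r = outp v" using l[OF vV] out v by metis
  fix u assume u: "u < n" "outp u = outp v"
  have uV: "ids u \<in> V" using u by simp
  obtain m1 where m1: "m1 \<le> D" "(l (ids v), ids v) \<in> ?R ^^ m1" using l[OF vV] by blast
  obtain m2 where m2: "m2 \<le> D" "(l (ids u), ids u) \<in> ?R ^^ m2" using l[OF uV] by blast
  have eq: "l (ids u) = l (ids v)" using u out v by simp
  have p: "(ids u, ids v) \<in> ?R ^^ (m2 + m1)"
    using relpow_compose[OF relpow_sym[OF sym m2(2)]] m1(2) eq by simp
  let ?S = "{w. w < n \<and> outp w = outp v}"
  have walk: "(u, node y) \<in> inner_rel E ?S ^^ m \<and> l y = l (ids v)" if "(ids u, y) \<in> ?R ^^ m" for y m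
    using that
  proof (induction m arbitrary: y)
    case 0
    then show ?case using eq node_ids[OF u(1)] by auto
  next
    case (Suc m)
    then obtain z where z: "(ids u, z) \<in> ?R ^^ m" "(z, y) \<in> ?R" by (meson relpow_Suc_E)
    have IH: "(u, node z) \<in> inner_rel E ?S ^^ m" "l z = l (ids v)" using Suc.IH[OF z(1)] by blast+
    have a: "adj z y" "l y = l (ids v)" using z(2) IH(2) by auto
    have zy: "z \<in> V" "y \<in> V" using adj_props(2)[OF a(1)] by blast+
    have "outp (node z) = outp v" "outp (node y) = outp v"
      using out[of "node z"] out[of "node y"] ids_node[OF zy(1)] ids_node[OF zy(2)] IH(2) a(2) out[OF v] by simp_all
    then have "(node z, node y) \<in> inner_rel E ?S"
      using ids_node[OF zy(1)] ids_node[OF zy(2)] adj_node[OF a(1)] by (simp add: inner_rel_def)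
    then show ?case using IH(1) a(2) by (meson relpow_Suc_I)
  qed
  have path: "(u, v) \<in> inner_rel E ?S ^^ (m2 + m1)"
    using conjunct1[OF walk[OF p]] by (simp only: node_ids[OF v])
  have uS: "u \<in> ?S" using u by simp
  from relpow_walk[OF uS path] obtain xs
    where xs: "walk_in E ?S xs" "hd xs = u" "last xs = v" "length xs = Suc (m2 + m1)"
    by (elim exE conjE)
  have "real (m2 + m1) \<le> real (2 * D)" using m1(1) m2(1) by simp
  then show "\<exists>xs. walk_in E ?S xs \<and> hd xs = u \<and> last xs = v \<and> real (length xs - 1) \<le> D'"
    using xs D by (intro exI[of _ xs]) simp
qed

lemma cut_edges_of_clusters:
  assumes out: "\<And>v. v < n \<Longrightarrow> outp v = l (ids v)"
  shows "2 * cut_edges n E outp \<le> card {(x, y). adj x y \<and> l x \<noteq> l y}"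
proof -
  let ?A = "{(u, v). u < v \<and> v < n \<and> E u v \<and> outp u \<noteq> outp v}"
  let ?C = "{(x, y). adj x y \<and> l x \<noteq> l y}"
  have fin: "finite ?A" by (rule finite_subset[of _ "{0..<n} \<times> {0..<n}"]) auto
  have finC: "finite ?C" by (rule finite_subset[of _ "V \<times> V"]) (use adj_props(2) in auto)
  have dis: "?A \<inter> prod.swap ` ?A = {}" by auto
  have sub: "map_prod ids ids ` (?A \<union> prod.swap ` ?A) \<subseteq> ?C"
  proof
    fix z assume "z \<in> map_prod ids ids ` (?A \<union> prod.swap ` ?A)"
    then obtain u v where uv: "z = (ids u, ids v)" "(u, v) \<in> ?A \<or> (v, u) \<in> ?A" by auto
    then have n: "u < n" "v < n" "outp u \<noteq> outp v" "E u v"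
      using simple by (auto simp: simple_graph_def)
    then show "z \<in> ?C" using uv(1) out adj_ids by simp
  qed
  have "inj_on (map_prod ids ids) ({0..<n} \<times> {0..<n})" using inj by (rule map_prod_inj_on[OF _ inj])
  then have inj': "inj_on (map_prod ids ids) (?A \<union> prod.swap ` ?A)"
    by (rule inj_on_subset) auto
  have "2 * card ?A = card (?A \<union> prod.swap ` ?A)"
    using fin dis by (simp add: card_Un_disjoint card_image)
  also have "\<dots> = card (map_prod ids ids ` (?A \<union> prod.swap ` ?A))" using inj' by (simp add: card_image)
  also have "\<dots> \<le> card ?C" by (rule card_mono[OF finC sub])
  finally show ?thesis by (simp add: cut_edges_def)
qed

end

section \<open>The partition algorithm\<close>

lemma log_ceiling_bound:
  assumes "1 \<le> n"
  shows "n < 2 ^ (nat \<lceil>log 2 (real n)\<rceil> + 1)"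
proof -
  have "real n = 2 powr (log 2 (real n))" using assms by simp
  also have "\<dots> \<le> 2 powr real (nat \<lceil>log 2 (real n)\<rceil>)" by (intro powr_mono) (simp_all add: real_nat_ceiling_ge)
  also have "\<dots> = real (2 ^ nat \<lceil>log 2 (real n)\<rceil>)" by (simp add: powr_realpow)
  finally have "n \<le> 2 ^ nat \<lceil>log 2 (real n)\<rceil>" by (simp only: of_nat_le_iff)
  moreover have "(0::nat) < 2 ^ nat \<lceil>log 2 (real n)\<rceil>" by simp
  ultimately show ?thesis unfolding power_add power_one_right by linarith
qed

text \<open>This is the tangent bound \<open>ln y \<le> y - 1\<close> at
  \<open>y = x / s\<close>.\<close>

lemma linear_log_bound:
  fixes s x :: real
  assumes "0 < s" "0 < x"
  shows "s * ln x \<le> x + s * ln s"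
proof -
  have "ln (x / s) \<le> x / s - 1" using assms by (intro ln_le_minus_one) simp
  then have "ln x \<le> ln s + x / s" using assms by (simp add: ln_div)
  then have "s * ln x \<le> s * (ln s + x / s)" using assms by (intro mult_left_mono) auto
  then show ?thesis using assms by (simp add: algebra_simps)
qed

text \<open>For fixed \<open>c\<close> the bit length of identifiers is logarithmic in
  \<open>n\<close>, so a constant \<open>K\<close> brings it below \<open>n + K\<close>, the form
  from which recolouring starts.\<close>

lemma id_bits_bound:
  "\<exists>K\<ge>5. \<forall>n\<ge>1. real (c * (nat \<lceil>log 2 (real n)\<rceil> + 1) + 3) \<le> real n + real K"
proof (cases "c = 0")
  case True
  then show ?thesis by (intro exI[of _ 5]) auto
next
  case False
  define s where "s = real c / ln 2"
  have s: "0 < s" using False by (simp add: s_def)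
  define K where "K = nat \<lceil>s * ln s\<rceil> + 2 * c + 5"
  have "real (c * (nat \<lceil>log 2 (real n)\<rceil> + 1) + 3) \<le> real n + real K" if n: "1 \<le> n" for n
  proof -
    have "0 \<le> log 2 (real n)" using n by simp
    then have "real (nat \<lceil>log 2 (real n)\<rceil>) \<le> log 2 (real n) + 1" by linarith
    then have "real c * (real (nat \<lceil>log 2 (real n)\<rceil>) + 1) \<le> real c * (log 2 (real n) + 2)"
      by (intro mult_left_mono) auto
    also have "\<dots> = s * ln (real n) + 2 * real c" by (simp add: s_def log_def algebra_simps)
    also have "s * ln (real n) \<le> real n + s * ln s" using s n by (intro linear_log_bound) auto
    also have "s * ln s \<le> real (nat \<lceil>s * ln s\<rceil>)" by (rule real_nat_ceiling_ge)
    finally show ?thesis by (simp add: K_def algebra_simps)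
  qed
  then show ?thesis by (intro exI[of _ K]) (auto simp: K_def)
qed

text \<open>Initially the cut has at most \<open>2 * C * n\<close> ordered pairs and at most
  \<open>2 * e * n\<close> may remain, so it has to shrink by the factor \<open>e / C\<close>. Each
  phase contributes \<open>1 - 1 / (16 * C)\<close>, which is at most
  \<open>exp (- 1 / (16 * C))\<close>.\<close>

definition num_phases :: "nat \<Rightarrow> real \<Rightarrow> nat" where
  "num_phases C e = nat \<lceil>16 * real C * ln (real C / e)\<rceil>"

lemma num_phases_shrink:
  assumes "1 \<le> C" "0 < e" "e < 1"
  shows "(1 - 1 / (16 * real C)) ^ num_phases C e \<le> e / real C"
proof -
  have "(1 - 1 / (16 * real C)) ^ num_phases C e \<le> exp (- (1 / (16 * real C))) ^ num_phases C e"
    using assms(1) exp_ge_add_one_self[of "- (1 / (16 * real C))"] by (intro power_mono) auto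
  also have "\<dots> = exp (- (real (num_phases C e) / (16 * real C)))"
    by (simp add: exp_of_nat_mult[symmetric])
  also have "\<dots> \<le> exp (- ln (real C / e))"
  proof -
    have "16 * real C * ln (real C / e) \<le> real (num_phases C e)"
      unfolding num_phases_def by (rule real_nat_ceiling_ge)
    then have "ln (real C / e) \<le> real (num_phases C e) / (16 * real C)"
      using assms(1) by (simp add: field_simps)
    then show ?thesis by simp
  qed
  also have "\<dots> = e / real C" using assms by (simp add: exp_minus)
  finally show ?thesis .
qed

text \<open>Exchanging base and exponent, \<open>3\<close> to the power
  \<open>16 * C * ln (C / e)\<close> equals \<open>C / e\<close> to the constant power
  \<open>16 * C * ln 3\<close>; rounding up costs the factor \<open>3\<close>.\<close>

lemma three_power_num_phases:
  assumes "1 \<le> C" "0 < e" "e < 1"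
  shows "3 ^ num_phases C e \<le> 3 * real C powr (16 * real C * ln 3) * (1 / e) powr (16 * real C * ln 3)"
proof -
  have pos: "0 < ln (real C / e)" using assms by (simp add: ln_gt_zero)
  then have "0 \<le> 16 * real C * ln (real C / e)" by simp
  then have L: "real (num_phases C e) \<le> 16 * real C * ln (real C / e) + 1" unfolding num_phases_def by linarith
  have "(3::real) ^ num_phases C e = 3 powr real (num_phases C e)" by (simp add: powr_realpow)
  also have "\<dots> \<le> 3 powr (16 * real C * ln (real C / e) + 1)" using L by (intro powr_mono) auto
  also have "\<dots> = 3 * (real C / e) powr (16 * real C * ln 3)"
    using assms by (simp add: powr_add powr_def exp_add algebra_simps)
  also have "\<dots> = 3 * real C powr (16 * real C * ln 3) * (1 / e) powr (16 * real C * ln 3)"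
    using assms by (simp add: powr_divide)
  finally show ?thesis .
qed

definition id_bits :: "nat \<Rightarrow> nat \<Rightarrow> nat" where
  "id_bits cid n = cid * (nat \<lceil>log 2 (real n)\<rceil> + 1) + 3"

definition partition_program :: "nat \<Rightarrow> nat \<Rightarrow> nat \<Rightarrow> nat \<Rightarrow> real \<Rightarrow> round list" where
  "partition_program C cid K n e = program (8 * C) (2 ^ id_bits cid n) (n * (n * 4)) (Suc (logstar n + K)) (num_phases C e)"

context id_graph
begin

lemma partition_algorithm:
  assumes n: "1 \<le> n" and ids: "\<forall>v<n. ids v < n ^ cid" and C: "C = 2 ^ h"
    and K: "5 \<le> K" "real (id_bits cid n) \<le> real n + real K"
    and e: "0 < e" "e < 1" and EH: "simple_graph h EH"
  defines "A \<equiv> simulate (partition_program C cid K)"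
  shows "bandwidth_ok A ((cid + 10) * 3 ^ (16 * C + 6)) n e d E ids tp"
    and "valid_partition n E ids (alg_output A n e d E ids tp) (3 ^ num_phases C e)"
    and "minor_free n E h EH \<Longrightarrow> real (cut_edges n E (alg_output A n e d E ids tp)) \<le> e * real n"
proof -
  let ?b = "id_bits cid n" and ?k = "8 * C" and ?M = "n * (n * 4)"
  let ?N = "2 ^ ?b :: nat"
  let ?q = "nat \<lceil>log 2 (real n)\<rceil> + 1"
  let ?P = "partition_program C cid K n e"
  let ?L = "num_phases C e"
  have nq: "n < 2 ^ ?q" by (rule log_ceiling_bound[OF n])
  have C1: "1 \<le> C" using C by simp
  have idN: "ids v < ?N" if "v < n" for v
  proof -
    have "ids v < n ^ cid" using ids that by blast
    also have "\<dots> \<le> (2 ^ ?q) ^ cid" using nq by (intro power_mono) auto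
    also have "\<dots> = 2 ^ (cid * ?q)" by (simp only: power_mult[symmetric] mult.commute)
    also have "\<dots> \<le> ?N" by (intro power_increasing) (simp_all add: id_bits_def)
    finally show ?thesis .
  qed
  have b: "3 \<le> ?b" by (simp add: id_bits_def)
  have N4: "4 \<le> ?N" using power_increasing[of 2 ?b "2::nat"] b by simp
  have cardV: "card V = n" using inj by (simp add: card_image)
  interpret net: phase_network V adj ?k ?N ?M ?b
  proof
    show "finite V" by simp
    show "adj u v \<Longrightarrow> adj v u" "adj u v \<Longrightarrow> u \<in> V \<and> v \<in> V" "\<not> adj v v" for u v
      using adj_props by blast+
    show "V \<subseteq> {..<?N}" using idN by auto
    show "card V * (card V * 4) \<le> ?M" by (simp add: cardV)
    show "2 \<le> ?k" using C1 by simp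
  qed (use b in auto)
  have rounds: "local_round F \<and> small_round ?k ?N ?M F" if "F \<in> set ?P" for F
    using program_rounds[OF that[unfolded partition_program_def] refl] b by simp
  have run: "run A n e d E ids tp t v = encode_state (ids v) (exec adj (take t ?P) initial_state (ids v)) \<and>
      small ?k ?N ?M (exec adj (take t ?P) initial_state (ids v))" if "v < n" "t \<le> length ?P" for t v
    unfolding A_def by (rule run_simulate[where P = "partition_program C cid K" and n = n and e = e and ids = ids, OF inj _ _ N4 that]) (use idN rounds in blast)+
  \<comment> \<open>One bit length that accommodates both identifiers and counters.\<close>
  have big: "?N < 2 ^ (?b + 2 * ?q + 2)" by (intro power_strict_increasing) auto
  have "?M < 2 ^ (?b + 2 * ?q + 2)"
  proof -
    have "n * n \<le> 2 ^ ?q * 2 ^ ?q" using nq by (intro mult_mono) auto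
    then have "?M \<le> 2 ^ ?q * 2 ^ ?q * 4" by simp
    also have "\<dots> = 2 ^ (?q + ?q + 2)" by (simp add: power_add)
    also have "\<dots> < 2 ^ (?b + 2 * ?q + 2)" using b by (intro power_strict_increasing) auto
    finally show ?thesis .
  qed
  note msg = message_bound[OF _ _ big this]
  show "bandwidth_ok A ((cid + 10) * 3 ^ (16 * C + 6)) n e d E ids tp"
    unfolding bandwidth_ok_def A_def simulate_simps
  proof (intro allI impI)
    fix t v u assume t: "t < length ?P" and v: "v < n"
    have r: "run A n e d E ids tp t v = encode_state (ids v) (exec adj (take t ?P) initial_state (ids v))"
      "small ?k ?N ?M (exec adj (take t ?P) initial_state (ids v))"
      using run[OF v less_imp_le[OF t]] by blast+
    have "list_encode (run A n e d E ids tp t v) < 2 ^ ((?b + 2 * ?q + 2 + 3) * 3 ^ (2 * ?k + 6))"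
      unfolding r(1) by (rule msg[OF r(2) idN[OF v]]) simp
    also have "\<dots> \<le> 2 ^ ((cid + 10) * 3 ^ (16 * C + 6) * ?q)"
    proof (rule power_increasing)
      \<comment> \<open>The left side is \<open>cid * ?q + 2 * ?q + 8\<close>, and \<open>?q\<close>
        is at least \<open>1\<close>; this explains the \<open>10\<close>.\<close>
      have "?b + 2 * ?q + 2 + 3 \<le> (cid + 10) * ?q" by (simp add: id_bits_def algebra_simps)
      then have "(?b + 2 * ?q + 2 + 3) * 3 ^ (2 * ?k + 6) \<le> (cid + 10) * ?q * 3 ^ (2 * ?k + 6)"
        by (rule mult_le_mono1)
      then show "(?b + 2 * ?q + 2 + 3) * 3 ^ (2 * ?k + 6) \<le> (cid + 10) * 3 ^ (16 * C + 6) * ?q"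
      proof -
        have "16 * C + 6 = 2 * ?k + 6" by simp
        then show ?thesis using \<open>(?b + 2 * ?q + 2 + 3) * 3 ^ (2 * ?k + 6) \<le> (cid + 10) * ?q * 3 ^ (2 * ?k + 6)\<close>
          by (simp only: mult_ac)
      qed
    qed simp
    finally show "list_encode (run (simulate (partition_program C cid K)) n e d E ids tp t v)
        < 2 ^ ((cid + 10) * 3 ^ (16 * C + 6) * ?q)" unfolding A_def .
  qed
  have st: "net.start 0 (\<lambda>v. v) initial_state" by (rule net.start_id) (simp add: initial_state_def)
  have T: "(cv_bits ^^ (logstar n + K)) ?b \<le> 3" by (rule cv_bits_logstar[OF K])
  obtain l where l: "net.start (radius ?L) l (exec adj ?P initial_state)"
    and shrink: "\<And>C'. (\<forall>D l. net.rad D l \<longrightarrow> net.sparse C' l) \<Longrightarrow> 0 < C' \<Longrightarrow> 8 * C' \<le> ?k + 1 \<Longrightarrow>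
       real (net.cut l) \<le> (1 - 1 / (16 * real C')) ^ ?L * real (net.cut (\<lambda>v. v))"
    using net.program_correct[OF st T, of ?L] unfolding partition_program_def[symmetric] by blast
  have out: "alg_output A n e d E ids tp v = l (ids v)" if v: "v < n" for v
  proof -
    have "run A n e d E ids tp (length ?P) v = encode_state (ids v) (exec adj ?P initial_state (ids v))"
      using run[OF v order.refl] by simp
    moreover have "ld (exec adj ?P initial_state (ids v)) = l (ids v)"
      using l v by (simp add: net.start_def)
    moreover have "alg_output A n e d E ids tp v = run A n e d E ids tp (length ?P) v ! 1"
      unfolding alg_output_def A_def simulate_simps ..
    ultimately show ?thesis by (simp only: hd_encode)
  qed
  have rad: "net.rad (radius ?L) l" using l by (simp add: net.start_def)
  show "valid_partition n E ids (alg_output A n e d E ids tp) (3 ^ ?L)"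
  proof (rule valid_partition_of_clusters[where l = l])
    show "alg_output A n e d E ids tp v = l (ids v)" if "v < n" for v by (rule out[OF that])
    show "l v \<in> V \<and> l (l v) = l v \<and> (\<exists>m\<le>radius ?L. (l v, v) \<in> {(x, y). adj x y \<and> l x = l y} ^^ m)"
      if "v \<in> V" for v using rad that unfolding net.rad_def net.rel_def by blast
    have "2 * radius ?L \<le> 3 ^ ?L" using radius_eq[of ?L] by linarith
    then have "real (2 * radius ?L) \<le> real (3 ^ ?L)" by (rule of_nat_mono)
    then show "real (2 * radius ?L) \<le> 3 ^ ?L" by simp
  qed
  assume free: "minor_free n E h EH"
  have sparse: "net.sparse C l'" if "net.rad D l'" for D l'
    unfolding net.sparse_def
  proof (intro allI impI)
    fix F assume F: "F \<subseteq> net.leaders l'" "F \<noteq> {}"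
    have w: "0 < net.weight l' r s \<longleftrightarrow> (\<exists>x y. adj x y \<and> l' x = r \<and> l' y = s)" for r s
      unfolding net.weight_def card_gt_0_iff using net.finite_adj by auto
    show "card {(r, s). r \<in> F \<and> s \<in> F \<and> r \<noteq> s \<and> 0 < net.weight l' r s} < 2 * C * card F"
      unfolding w C
    proof (rule minor_free_sparse[OF free EH _ F(1)[unfolded net.leaders_def] F(2)])
      show "l' v \<in> V \<and> l' (l' v) = l' v \<and> (\<exists>m. (l' v, v) \<in> {(x, y). adj x y \<and> l' x = l' y} ^^ m)"
        if "v \<in> V" for v using \<open>net.rad D l'\<close> that unfolding net.rad_def net.rel_def by blast
    qed
  qed
  have "real (net.cut l) \<le> (1 - 1 / (16 * real C)) ^ ?L * real (net.cut (\<lambda>v. v))"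
    using sparse C1 by (intro shrink) auto
  also have "\<dots> \<le> (e / real C) * real (2 * C * n)"
  proof (intro mult_mono num_phases_shrink C1 e of_nat_mono)
    have "net.sparse C (\<lambda>v. v)" using sparse[of 0 "\<lambda>v. v"] st by (simp add: net.start_def)
    then show "net.cut (\<lambda>v. v) \<le> 2 * C * n" using net.cut_id_le n cardV by fastforce
  qed (use e in auto)
  also have "\<dots> = 2 * (e * real n)" using C1 by simp
  finally have cut: "real (net.cut l) \<le> 2 * (e * real n)" .
  have "2 * cut_edges n E (alg_output A n e d E ids tp) \<le> net.cut l"
    unfolding net.cut_def by (rule cut_edges_of_clusters[where l = l]) (rule out)
  then have "real (2 * cut_edges n E (alg_output A n e d E ids tp)) \<le> real (net.cut l)" by (rule of_nat_mono)
  then show "real (cut_edges n E (alg_output A n e d E ids tp)) \<le> e * real n" using cut by simp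
qed

end

lemma prob_space_coin_tapes: "prob_space coin_tapes"
  unfolding coin_tapes_def by (intro prob_space_PiM prob_space_measure_pmf)

theorem mainTheorem5:
  fixes h :: nat and EH :: "nat \<Rightarrow> nat \<Rightarrow> bool" and cid :: nat
  assumes "simple_graph h EH" and "cid \<ge> 1"
  shows "\<exists>(A :: congest_alg) (c :: real) (B :: nat). c > 0 \<and>
    (\<forall>n E ids e d. n \<ge> 1 \<and> simple_graph n E \<and> inj_on ids {0..<n} \<and>
        (\<forall>v<n. ids v < n ^ cid) \<and> 0 < e \<and> e < 1 \<and> 0 < d \<and> d < 1 \<longrightarrow>
       real (a_rounds A n e d) \<le> c * (1 / e) powr c * (ln (1 / d) + real (logstar n) + 1) \<and>
       (\<forall>tp. bandwidth_ok A B n e d E ids tp \<and>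
              valid_partition n E ids (alg_output A n e d E ids tp) (c * (1 / e) powr c)) \<and>
       (minor_free n E h EH \<longrightarrow>
          measure coin_tapes {tp \<in> space coin_tapes.
             real (cut_edges n E (alg_output A n e d E ids tp)) \<le> e * real n} \<ge> 1 - d))"
proof -
  define C :: nat where "C = 2 ^ h"
  have C1: "1 \<le> C" by (simp add: C_def)
  obtain K where K: "5 \<le> K" "\<And>n. 1 \<le> n \<Longrightarrow> real (id_bits cid n) \<le> real n + real K"
    using id_bits_bound[of cid] unfolding id_bits_def by blast
  define A where "A = simulate (partition_program C cid K)"
  define B where "B = (cid + 10) * 3 ^ (16 * C + 6)"
  define a where "a = 16 * real C * ln 3"
  define c0 where "c0 = 3 * real C powr a * (real K + 10)"
  \<comment> \<open>In the statement \<open>c\<close> is at once factor and exponent, so it has to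
    dominate both \<open>c0\<close> and \<open>a\<close>; raising the exponent is harmless because
    \<open>1 / e > 1\<close>.\<close>
  define c where "c = a + c0"
  have a0: "0 \<le> a" by (simp add: a_def)
  have c0: "3 * real C powr a \<le> c0" "0 < c0" using C1 by (auto simp: c0_def mult_le_cancel_left1)
  have c: "a \<le> c" "c0 \<le> c" "0 < c" using a0 c0(2) by (auto simp: c_def)
  have powr_le: "3 ^ num_phases C e * y \<le> c * (1 / e) powr c * z"
    if e: "0 < e" "e < 1" and yz: "0 \<le> y" "3 * real C powr a * y \<le> c0 * z" "0 \<le> z" for e y z
  proof -
    have "3 ^ num_phases C e * y \<le> (3 * real C powr a * (1 / e) powr a) * y"
      using three_power_num_phases[OF C1 e] yz(1) unfolding a_def by (rule mult_right_mono)
    also have "\<dots> = (1 / e) powr a * (3 * real C powr a * y)" by simp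
    also have "\<dots> \<le> (1 / e) powr c * (c * z)"
    proof (rule mult_mono)
      show "(1 / e) powr a \<le> (1 / e) powr c" using e c(1) by (intro powr_mono) auto
      show "3 * real C powr a * y \<le> c * z" using yz(2,3) mult_right_mono[OF c(2) yz(3)] by linarith
    qed (use yz(1) in auto)
    finally show ?thesis by (simp add: mult_ac)
  qed
  have "real (a_rounds A n e d) \<le> c * (1 / e) powr c * (ln (1 / d) + real (logstar n) + 1) \<and>
       (\<forall>tp. bandwidth_ok A B n e d E ids tp \<and>
              valid_partition n E ids (alg_output A n e d E ids tp) (c * (1 / e) powr c)) \<and>
       (minor_free n E h EH \<longrightarrow>
          measure coin_tapes {tp \<in> space coin_tapes.
             real (cut_edges n E (alg_output A n e d E ids tp)) \<le> e * real n} \<ge> 1 - d)"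
    if n: "1 \<le> n" and E: "simple_graph n E" "inj_on ids {0..<n}" and ids: "\<forall>v<n. ids v < n ^ cid"
      and e: "0 < e" "e < 1" and d: "0 < d" "d < 1" for n E ids e d
  proof -
    interpret id_graph n E ids using E by unfold_locales
    note alg = partition_algorithm[OF n ids C_def K(1) K(2)[OF n] e assms(1), folded A_def B_def]
    have ln: "0 \<le> ln (1 / d)" using d by (simp add: ln_div)
    have rounds: "real (a_rounds A n e d) \<le> c * (1 / e) powr c * (ln (1 / d) + real (logstar n) + 1)"
    proof -
      have "a_rounds A n e d \<le> (Suc (logstar n + K) + 9) * 3 ^ num_phases C e"
        unfolding A_def simulate_simps partition_program_def by (rule length_program)
      then have "real (a_rounds A n e d) \<le> real ((Suc (logstar n + K) + 9) * 3 ^ num_phases C e)"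
        by (rule of_nat_mono)
      also have "\<dots> = 3 ^ num_phases C e * (real (logstar n) + real K + 10)" by simp
      also have "\<dots> \<le> c * (1 / e) powr c * (ln (1 / d) + real (logstar n) + 1)"
      proof (rule powr_le[OF e])
        have "real (logstar n) + real K + 10 \<le> (real K + 10) * (real (logstar n) + 1)" by (simp add: algebra_simps)
        also have "\<dots> \<le> (real K + 10) * (ln (1 / d) + real (logstar n) + 1)" using ln by (intro mult_left_mono) auto
        finally have "3 * real C powr a * (real (logstar n) + real K + 10)
            \<le> 3 * real C powr a * ((real K + 10) * (ln (1 / d) + real (logstar n) + 1))"
          by (rule mult_left_mono) simp
        then show "3 * real C powr a * (real (logstar n) + real K + 10)
            \<le> c0 * (ln (1 / d) + real (logstar n) + 1)" by (simp add: c0_def mult_ac)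
      qed (use ln in auto)
      finally show ?thesis .
    qed
    have diam: "3 ^ num_phases C e \<le> c * (1 / e) powr c"
      using powr_le[OF e, of 1 1] c0(1) by simp
    have valid: "valid_partition n E ids (alg_output A n e d E ids tp) (c * (1 / e) powr c)" for tp
      using alg(2)[of d tp] diam unfolding valid_partition_def by (meson order.trans)
    have "measure coin_tapes {tp \<in> space coin_tapes.
             real (cut_edges n E (alg_output A n e d E ids tp)) \<le> e * real n} \<ge> 1 - d"
      if "minor_free n E h EH"
    proof -
      \<comment> \<open>The cut bound holds for every tape, so the event is the whole space and has
        probability one.\<close>
      have "{tp \<in> space coin_tapes. real (cut_edges n E (alg_output A n e d E ids tp)) \<le> e * real n}
          = space coin_tapes" using alg(3)[OF that] by blast
      then show ?thesis using prob_space.prob_space[OF prob_space_coin_tapes] d by simp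
    qed
    then show ?thesis using rounds alg(1) valid by blast
  qed
  then show ?thesis using c(3) by (intro exI[of _ A] exI[of _ c] exI[of _ B]) blast
qed

end
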